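(* Let $m,n\in\mathbb{Z}$ with $|m|\ge 2$ and $|n|\ge 2$, let $\Gamma=\mathrm{BS}(m,n)$, and let $q\in\mathbb{Z}_{\ge1}\cup\{\infty\}$ be an $(m,n)$-phenotype (a value taken by $\mathrm{PH}_{m,n}$). Let $$\mathcal{HT}_q=\{\Lambda\in\mathcal K_q:\ \text{the action } \Lambda\backslash\Gamma\curvearrowleft\Gamma \text{ is highly transitive}\}.$$ Then $\mathcal{HT}_q$ is a dense $G_\delta$ subset of $\mathcal K_q$ if and only if either $q=1$, or $q=\infty$ and $|m|\neq|n|$. In all other cases, $\mathcal{HT}_q=\emptyset$; more precisely, in those cases, for every infinite index subgroup $\Lambda\le\Gamma$ with $\mathrm{PH}_{m,n}(\Lambda)=q$, the action $\Lambda\backslash\Gamma\curvearrowleft\Gamma$ is not primitive.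
   Context: $\mathrm{BS}(m,n)=\langle b,t\mid tb^mt^{-1}=b^n\rangle$. All actions are right actions; $\Lambda\backslash\Gamma\curvearrowleft\Gamma$ denotes the action on right cosets by right multiplication. $\mathrm{Sub}(\Gamma)$ is the set of subgroups of $\Gamma$ with the topology generated by the clopen sets $\mathcal V(\mathcal I,\mathcal O)=\{\Lambda:\mathcal I\subseteq\Lambda,\ \mathcal O\cap\Lambda=\emptyset\}$ for finite $\mathcal I,\mathcal O\subseteq\Gamma$ (a compact Polish space), and $\Gamma$ acts on it by conjugation. For a prime $p$ and integer $k\neq 0$, $|k|_p$ denotes the $p$-adic valuation. Phenotype: for $L\in\mathbb{Z}_{\ge1}$ let $\mathcal P_{m,n}(L)=\{p \text{ prime}: |m|_p=|n|_p \text{ and } |L|_p>|n|_p\}$ and $\mathrm{Ph}_{m,n}(L)=\prod_{p\in\mathcal P_{m,n}(L)}p^{|L|_p}$; set $\mathrm{Ph}_{m,n}(\infty)=\infty$. For $\Lambda\le\Gamma$, $\mathrm{PH}_{m,n}(\Lambda)=\mathrm{Ph}_{m,n}([\langle b\rangle:\langle b\rangle\cap\Lambda])$. An $(m,n)$-phenotype is an element of $\mathrm{PH}_{m,n}(\mathrm{Sub}(\Gamma))$. $\mathcal K(\Gamma)$ is the perfect kernel of $\mathrm{Sub}(\Gamma)$ (its largest closed subset without isolated points); it equals the set of $\Lambda$ such that the double coset space $\Lambda\backslash\Gamma/\langle b\rangle$ is infinite. $\mathcal K_q=\mathcal K(\Gamma)\cap\mathrm{PH}_{m,n}^{-1}(q)$.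 A transitive action on an infinite set $X$ is highly transitive if for every $d$, all pairwise distinct $x_1,\dots,x_d\in X$ and all pairwise distinct $y_1,\dots,y_d\in X$, some $\gamma\in\Gamma$ satisfies $x_i\gamma=y_i$ for all $i$. An action is primitive if it preserves no equivalence relation other than equality and the full relation. *)

theory Defs
  imports "HOL-Analysis.Analysis" "HOL-Algebra.Coset" "HOL-Algebra.Generated_Groups" "HOL-Computational_Algebra.Primes"
begin

datatype gen = Bg | Tg

text \<open>A word is a list of letters; a letter is a generator together with a flag
  (True = inverse letter).\<close>
type_synonym word = "(gen \<times> bool) list"

definition bpow :: "int \<Rightarrow> word" where
  "bpow k = replicate (nat \<bar>k\<bar>) (Bg, k < 0)"

text \<open>Equality in BS(m,n) = < b, t | t b^m t^-1 = b^n >: the smallest congruence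
  (w.r.t. concatenation) on words containing free cancellation and the relator.\<close>
inductive bs_rel :: "int \<Rightarrow> int \<Rightarrow> word \<Rightarrow> word \<Rightarrow> bool" for m n where
  bs_refl: "bs_rel m n w w"
| bs_sym: "bs_rel m n u v \<Longrightarrow> bs_rel m n v u"
| bs_trans: "bs_rel m n u v \<Longrightarrow> bs_rel m n v w \<Longrightarrow> bs_rel m n u w"
| bs_cancel: "bs_rel m n (u @ [(g, s), (g, \<not> s)] @ v) (u @ v)"
| bs_relator: "bs_rel m n (u @ ([(Tg, False)] @ bpow m @ [(Tg, True)]) @ v) (u @ bpow n @ v)"

definition bsR :: "int \<Rightarrow> int \<Rightarrow> (word \<times> word) set" where
  "bsR m n = {(x, y). bs_rel m n x y}"

definition BS :: "int \<Rightarrow> int \<Rightarrow> word set monoid" where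
  "BS m n = \<lparr> carrier = UNIV // bsR m n,
              monoid.mult = (\<lambda>A B. bsR m n `` {a @ b | a b. a \<in> A \<and> b \<in> B}),
              one = bsR m n `` {[]} \<rparr>"

definition bgen :: "int \<Rightarrow> int \<Rightarrow> word set" where
  "bgen m n = bsR m n `` {[(Bg, False)]}"

definition bcyc :: "int \<Rightarrow> int \<Rightarrow> word set set" where
  "bcyc m n = generate (BS m n) {bgen m n}"

definition b_index :: "int \<Rightarrow> int \<Rightarrow> word set set \<Rightarrow> enat" where
  "b_index m n \<Lambda> =
     (let C = rcosets\<^bsub>(BS m n)\<lparr>carrier := bcyc m n\<rparr>\<^esub> (bcyc m n \<inter> \<Lambda>)
      in if finite C then enat (card C) else \<infinity>)"

definition ph_primes :: "int \<Rightarrow> int \<Rightarrow> nat \<Rightarrow> nat set" where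
  "ph_primes m n L = {p. Factorial_Ring.prime p \<and> multiplicity p (nat \<bar>m\<bar>) = multiplicity p (nat \<bar>n\<bar>)
                          \<and> multiplicity p L > multiplicity p (nat \<bar>n\<bar>)}"

definition Ph :: "int \<Rightarrow> int \<Rightarrow> enat \<Rightarrow> enat" where
  "Ph m n L = (case L of \<infinity> \<Rightarrow> \<infinity>
                | enat l \<Rightarrow> enat (\<Prod>p\<in>ph_primes m n l. p ^ multiplicity p l))"

definition PH :: "int \<Rightarrow> int \<Rightarrow> word set set \<Rightarrow> enat" where
  "PH m n \<Lambda> = Ph m n (b_index m n \<Lambda>)"

definition SubG :: "int \<Rightarrow> int \<Rightarrow> word set set set" where
  "SubG m n = {\<Lambda>. subgroup \<Lambda> (BS m n)}"

definition phenotypes :: "int \<Rightarrow> int \<Rightarrow> enat set" where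
  "phenotypes m n = PH m n ` SubG m n"

definition Sub_top :: "int \<Rightarrow> int \<Rightarrow> word set set topology" where
  "Sub_top m n = subtopology
     (topology_generated_by
        {{\<Lambda>. I \<subseteq> \<Lambda> \<and> J \<inter> \<Lambda> = {}} | I J.
           finite I \<and> finite J \<and> I \<subseteq> carrier (BS m n) \<and> J \<subseteq> carrier (BS m n)})
     (SubG m n)"

definition perfect_kernel :: "'a topology \<Rightarrow> 'a set" where
  "perfect_kernel X = Union {P. closedin X P \<and> P \<subseteq> (derived_set_of) X P}"

definition Kq :: "int \<Rightarrow> int \<Rightarrow> enat \<Rightarrow> word set set set" where
  "Kq m n q = perfect_kernel (Sub_top m n) \<inter> {\<Lambda>. PH m n \<Lambda> = q}"

definition highly_transitive :: "int \<Rightarrow> int \<Rightarrow> word set set \<Rightarrow> bool" where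
  "highly_transitive m n \<Lambda> \<longleftrightarrow>
     infinite (rcosets\<^bsub>BS m n\<^esub> \<Lambda>) \<and>
     (\<forall>xs ys. length xs = length ys \<and> distinct xs \<and> distinct ys \<and>
        set xs \<subseteq> rcosets\<^bsub>BS m n\<^esub> \<Lambda> \<and> set ys \<subseteq> rcosets\<^bsub>BS m n\<^esub> \<Lambda> \<longrightarrow>
        (\<exists>\<gamma>\<in>carrier (BS m n). \<forall>i<length xs. xs ! i #>\<^bsub>BS m n\<^esub> \<gamma> = ys ! i))"

definition primitive_action :: "int \<Rightarrow> int \<Rightarrow> word set set \<Rightarrow> bool" where
  "primitive_action m n \<Lambda> \<longleftrightarrow>
     (\<forall>R. equiv (rcosets\<^bsub>BS m n\<^esub> \<Lambda>) R \<and>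
          (\<forall>x y \<gamma>. (x, y) \<in> R \<and> \<gamma> \<in> carrier (BS m n) \<longrightarrow>
                    (x #>\<^bsub>BS m n\<^esub> \<gamma>, y #>\<^bsub>BS m n\<^esub> \<gamma>) \<in> R)
        \<longrightarrow> R = Id_on (rcosets\<^bsub>BS m n\<^esub> \<Lambda>) \<or>
            R = (rcosets\<^bsub>BS m n\<^esub> \<Lambda>) \<times> (rcosets\<^bsub>BS m n\<^esub> \<Lambda>))"

definition HTq :: "int \<Rightarrow> int \<Rightarrow> enat \<Rightarrow> word set set set" where
  "HTq m n q = {\<Lambda> \<in> Kq m n q. highly_transitive m n \<Lambda>}"

definition dense_gdelta_in :: "'a topology \<Rightarrow> 'a set \<Rightarrow> bool" where
  "dense_gdelta_in X S \<longleftrightarrow> gdelta_in X S \<and> X closure_of S = topspace X"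

end

theory Submission
  imports Defs
begin

text \<open>
  An action of \<open>BS(m,n)\<close> is a permutation \<open>b\<close> together with a bijection \<open>t\<close> that carries the
  \<open>b\<^sup>n\<close>-orbits equivariantly onto the \<open>b\<^sup>m\<close>-orbits. Such a \<open>t\<close> can be built from finite
  approximations: partial bijections of this kind touching finitely many \<open>b\<close>-orbits, extended by
  gluing a free \<open>b\<^sup>n\<close>-orbit to a \<open>b\<^sup>m\<close>-orbit of the same length in an untouched \<open>b\<close>-orbit. Starting
  from a finite piece of the coset action of \<open>\<Lambda>\<close> with infinitely many \<open>b\<close>-orbits, a generic union
  is an action with infinitely many \<open>b\<close>-orbits whose point stabiliser has the phenotype of \<open>\<Lambda>\<close>
  and agrees with \<open>\<Lambda>\<close> on a prescribed finite set of words. Two incompatible gluings show that these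
  subgroups form a set that is dense in itself, hence lie in the perfect kernel. Conversely, a
  subgroup of finite phenotype with finitely many \<open>b\<close>-orbits has finite index and is isolated, and
  for infinite phenotype and \<open>\<bar>m\<bar> \<noteq> \<bar>n\<bar>\<close> counting \<open>b\<^sup>n\<close>- against \<open>b\<^sup>m\<close>-orbits excludes finitely many
  \<open>b\<close>-orbits.

  For high transitivity, one word moves all points of a finite tuple into fresh \<open>b\<close>-orbits. Two
  points \<open>x\<close> and \<open>x b\<^sup>k\<close> of the same \<open>b\<close>-orbit are separated by powers of \<open>t\<close> or of its inverse:
  each step turns the difference \<open>k = n a\<close> into \<open>m a\<close> (or back), so for a prime \<open>p\<close> with different
  valuations in \<open>m\<close> and \<open>n\<close> one direction lowers the valuation of \<open>k\<close>; primes with equal valuations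
  separate at once by the hypothesis on the phenotype. After all orbit lengths have been made
  equal, gluing the loops \<open>t b t\<inverse> b\<inverse>\<close> realises any prescribed partial permutation of the tuple.

  In the remaining cases an invariant equivalence relation is given by \<open>y = x b\<^sup>k\<close> with
  \<open>x b\<^sup>p\<^sup>k = x\<close> for a prime \<open>p\<close> dividing the phenotype, or by the \<open>b\<^sup>n\<close>-orbits if \<open>\<bar>m\<bar> = \<bar>n\<bar>\<close>.
\<close>

section \<open>Partial actions\<close>

text \<open>
  A \<open>t\<close>-edge joins a \<open>b\<^sup>n\<close>-orbit inside a \<open>b\<close>-orbit of length \<open>N\<close> to a \<open>b\<^sup>m\<close>-orbit of the same length
  inside a \<open>b\<close>-orbit of length \<open>M\<close>. Throughout, length \<open>0\<close> stands for an infinite orbit, so that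
  \<open>x b\<^sup>k = x\<close> iff the length divides \<open>k\<close> in both cases.
\<close>

definition edge_compat :: "int \<Rightarrow> int \<Rightarrow> nat \<Rightarrow> nat \<Rightarrow> bool" where
  "edge_compat n m N M \<longleftrightarrow> (\<forall>k. int N dvd n * k \<longleftrightarrow> int M dvd m * k)"

lemma edge_compat_sym: "edge_compat n m N M \<longleftrightarrow> edge_compat m n M N"
  by (auto simp: edge_compat_def)

fun lstep :: "(int \<Rightarrow> 'x \<Rightarrow> 'x) \<Rightarrow> ('x \<times> 'x) set \<Rightarrow> gen \<times> bool \<Rightarrow> 'x \<Rightarrow> 'x \<Rightarrow> bool" where
  "lstep B T (Bg, s) x y \<longleftrightarrow> y = B (if s then - 1 else 1) x"
| "lstep B T (Tg, s) x y \<longleftrightarrow> (if s then (y, x) \<in> T else (x, y) \<in> T)"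

fun pact :: "(int \<Rightarrow> 'x \<Rightarrow> 'x) \<Rightarrow> ('x \<times> 'x) set \<Rightarrow> word \<Rightarrow> 'x \<Rightarrow> 'x \<Rightarrow> bool" where
  "pact B T [] x y \<longleftrightarrow> x = y"
| "pact B T (a # w) x y \<longleftrightarrow> (\<exists>z. lstep B T a x z \<and> pact B T w z y)"

definition flipt :: "word \<Rightarrow> word" where
  "flipt = map (\<lambda>(g, s). (g, if g = Tg then \<not> s else s))"

lemma pact_append: "pact B T (u @ v) x y \<longleftrightarrow> (\<exists>z. pact B T u x z \<and> pact B T v z y)"
  by (induction u arbitrary: x) auto

lemma lstep_mono: "lstep B T a x y \<Longrightarrow> T \<subseteq> T' \<Longrightarrow> lstep B T' a x y"
  by (cases "(B, T, a, x, y)" rule: lstep.cases) (auto split: if_splits)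

lemma pact_mono: "pact B T w x y \<Longrightarrow> T \<subseteq> T' \<Longrightarrow> pact B T' w x y"
  by (induction w arbitrary: x) (auto intro: lstep_mono)

lemma flipt_flipt [simp]: "flipt (flipt w) = w"
proof (induction w)
  case (Cons a w)
  then show ?case by (cases a) (auto simp: flipt_def split: if_splits)
qed (simp add: flipt_def)

lemma pact_flipt: "pact B (T\<inverse>) (flipt w) x y \<longleftrightarrow> pact B T w x y"
proof (induction w arbitrary: x)
  case Nil
  then show ?case by (simp add: flipt_def)
next
  case (Cons a w)
  obtain g s where a: "a = (g, s)" by force
  have "lstep B (T\<inverse>) (g, if g = Tg then \<not> s else s) x z \<longleftrightarrow> lstep B T a x z" for z
    by (cases g) (auto simp: a)
  moreover have "flipt (a # w) = (g, if g = Tg then \<not> s else s) # flipt w"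
    by (simp add: flipt_def a)
  ultimately show ?case using Cons.IH by simp
qed

locale orbit_system =
  fixes B :: "int \<Rightarrow> 'x \<Rightarrow> 'x" and sz :: "'x \<Rightarrow> nat" and S :: "nat set" and m n :: int
  assumes m2: "2 \<le> \<bar>m\<bar>" and n2: "2 \<le> \<bar>n\<bar>"
    and B_zero: "B 0 x = x"
    and B_add: "B (j + k) x = B j (B k x)"
    and B_fix: "B k x = x \<longleftrightarrow> int (sz x) dvd k"
    and sz_in: "sz x \<in> S"
    and fresh: "N \<in> S \<Longrightarrow> finite F \<Longrightarrow> \<exists>x. sz x = N \<and> (\<forall>y\<in>F. \<forall>k. B k y \<noteq> x)"
    and S_compat: "N \<in> S \<Longrightarrow> edge_compat n m N M \<Longrightarrow> M \<in> S"
    and S_compat': "M \<in> S \<Longrightarrow> edge_compat n m N M \<Longrightarrow> N \<in> S"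
begin

text \<open>Exchanging \<open>m\<close> with \<open>n\<close> and \<open>t\<close> with its inverse turns every statement into its mirror image.\<close>

lemma dual: "orbit_system B sz S n m"
proof
  show "N \<in> S \<Longrightarrow> edge_compat m n N M \<Longrightarrow> M \<in> S" for N M
    using S_compat' edge_compat_sym by blast
  show "M \<in> S \<Longrightarrow> edge_compat m n N M \<Longrightarrow> N \<in> S" for N M
    using S_compat edge_compat_sym by blast
qed (fact m2 n2 B_zero B_add B_fix sz_in fresh | assumption)+

lemma B_eq: "B j x = B k x \<longleftrightarrow> int (sz x) dvd j - k"
proof -
  have "B j x = B k x \<longleftrightarrow> B (- k) (B j x) = B (- k) (B k x)"
  proof
    assume "B (- k) (B j x) = B (- k) (B k x)"
    then have "B k (B (- k) (B j x)) = B k (B (- k) (B k x))" by simp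
    then show "B j x = B k x" by (simp flip: B_add)
  qed simp
  also have "\<dots> \<longleftrightarrow> B (j - k) x = x" by (simp flip: B_add add: B_zero)
  finally show ?thesis by (simp add: B_fix)
qed

lemma B_B: "B j (B k x) = B (j + k) x" by (simp add: B_add)

lemma B_swap: "y = B k x \<longleftrightarrow> x = B (- k) y"
  by (auto simp: B_B B_zero)

lemma sz_B [simp]: "sz (B k x) = sz x"
proof -
  have "B j (B k x) = B k x \<longleftrightarrow> B j x = x" for j
    by (simp add: B_B B_eq B_fix)
  then have "\<forall>j. int (sz (B k x)) dvd j \<longleftrightarrow> int (sz x) dvd j" by (simp add: B_fix)
  then show ?thesis by (metis dvd_antisym dvd_refl int_dvd_int_iff)
qed

definition orb :: "'x \<Rightarrow> 'x set" where "orb x = range (\<lambda>k. B k x)"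

lemma B_in_orb [simp]: "B k x \<in> orb x" by (simp add: orb_def)

lemma orb_refl [simp]: "x \<in> orb x" using B_in_orb[of 0 x] by (simp add: B_zero)

lemma orb_iff: "y \<in> orb x \<longleftrightarrow> (\<exists>k. y = B k x)" by (auto simp: orb_def)

lemma orb_eq: "y \<in> orb x \<Longrightarrow> orb y = orb x"
proof -
  assume "y \<in> orb x"
  then obtain k where y: "y = B k x" by (auto simp: orb_iff)
  have "z \<in> orb y \<longleftrightarrow> z \<in> orb x" for z
  proof
    assume "z \<in> orb y" then show "z \<in> orb x" by (auto simp: orb_iff y B_B)
  next
    assume "z \<in> orb x"
    then obtain j where "z = B j x" by (auto simp: orb_iff)
    then have "z = B (j - k) y" by (simp add: y B_B)
    then show "z \<in> orb y" by (auto simp: orb_iff)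
  qed
  then show ?thesis by blast
qed

lemma orb_sym: "y \<in> orb x \<longleftrightarrow> x \<in> orb y"
  using orb_eq orb_refl by metis

lemma orb_B [simp]: "orb (B k x) = orb x" by (rule orb_eq) simp

lemma B_in_orb_iff [simp]: "B k x \<in> orb y \<longleftrightarrow> x \<in> orb y"
  using orb_sym[of "B k x" y] orb_sym[of x y] by simp

definition piso :: "('x \<times> 'x) set \<Rightarrow> bool" where
  "piso T \<longleftrightarrow> single_valued T \<and> single_valued (T\<inverse>) \<and>
     (\<forall>x y k. (x, y) \<in> T \<longrightarrow> (B (n * k) x, B (m * k) y) \<in> T) \<and>
     (\<exists>F. finite F \<and> Field T \<subseteq> (\<Union>f\<in>F. orb f))"

text \<open>No component of the partial action is a complete action, so every component can still be extended.\<close>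

definition unsat :: "('x \<times> 'x) set \<Rightarrow> bool" where
  "unsat T \<longleftrightarrow> (\<forall>C. C \<noteq> {} \<longrightarrow> (\<forall>x\<in>C. orb x \<subseteq> C) \<longrightarrow> C \<subseteq> Domain T \<longrightarrow> C \<subseteq> Range T \<longrightarrow>
     T `` C \<subseteq> C \<longrightarrow> T\<inverse> `` C \<subseteq> C \<longrightarrow> False)"

definition cond :: "('x \<times> 'x) set \<Rightarrow> bool" where
  "cond T \<longleftrightarrow> piso T \<and> unsat T"

lemma piso_sv: "piso T \<Longrightarrow> (x, y) \<in> T \<Longrightarrow> (x, z) \<in> T \<Longrightarrow> y = z"
  unfolding piso_def single_valued_def by blast

lemma piso_inj: "piso T \<Longrightarrow> (x, y) \<in> T \<Longrightarrow> (z, y) \<in> T \<Longrightarrow> x = z"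
  unfolding piso_def single_valued_def by blast

lemma piso_eqv: "piso T \<Longrightarrow> (x, y) \<in> T \<Longrightarrow> (B (n * k) x, B (m * k) y) \<in> T"
  unfolding piso_def by blast

lemma piso_Domain: "piso T \<Longrightarrow> B (n * k) x \<in> Domain T \<longleftrightarrow> x \<in> Domain T"
proof -
  assume T: "piso T"
  have 1: "x \<in> Domain T \<Longrightarrow> B (n * k) x \<in> Domain T" for x k
    using piso_eqv[OF T] by blast
  show ?thesis using 1[of x k] 1[of "B (n * k) x" "- k"] by (auto simp: B_B B_zero)
qed

lemma piso_Range: "piso T \<Longrightarrow> B (m * k) x \<in> Range T \<longleftrightarrow> x \<in> Range T"
proof -
  assume T: "piso T"
  have 1: "x \<in> Range T \<Longrightarrow> B (m * k) x \<in> Range T" for x k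
    using piso_eqv[OF T] by blast
  show ?thesis using 1[of x k] 1[of "B (m * k) x" "- k"] by (auto simp: B_B B_zero)
qed

lemma piso_compat:
  assumes "piso T" "(x, y) \<in> T" shows "edge_compat n m (sz x) (sz y)"
proof -
  have "int (sz x) dvd n * k \<longleftrightarrow> int (sz y) dvd m * k" for k
  proof -
    have "(B (n * k) x, B (m * k) y) \<in> T" using piso_eqv[OF assms] .
    then have "B (n * k) x = x \<longleftrightarrow> B (m * k) y = y"
      using assms piso_sv[OF assms(1)] piso_inj[OF assms(1)] by metis
    then show ?thesis by (simp add: B_fix)
  qed
  then show ?thesis by (simp add: edge_compat_def)
qed

lemma piso_dual: "orbit_system.piso B n m (T\<inverse>) \<longleftrightarrow> piso T"
  unfolding orbit_system.piso_def[OF dual] piso_def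
  using orbit_system.orb_def[OF dual] orb_def by (auto simp: Field_converse)

lemma unsat_dual: "unsat (T\<inverse>) \<longleftrightarrow> unsat T"
  unfolding unsat_def Domain_converse Range_converse converse_converse by blast

lemma cond_dual: "orbit_system.cond B n m (T\<inverse>) \<longleftrightarrow> cond T"
  unfolding orbit_system.cond_def[OF dual] cond_def piso_dual by (simp add: unsat_dual)

lemma cond_piso: "cond T \<Longrightarrow> piso T" by (simp add: cond_def)

definition ext :: "('x \<times> 'x) set \<Rightarrow> 'i set \<Rightarrow> ('i \<Rightarrow> 'x) \<Rightarrow> ('i \<Rightarrow> 'x) \<Rightarrow> ('x \<times> 'x) set" where
  "ext T I f g = T \<union> {(B (n * k) (f i), B (m * k) (g i)) | i k. i \<in> I}"

lemma ext_iff: "(x, y) \<in> ext T I f g \<longleftrightarrow>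
    (x, y) \<in> T \<or> (\<exists>i\<in>I. \<exists>k. x = B (n * k) (f i) \<and> y = B (m * k) (g i))"
  by (auto simp: ext_def)

lemma ext_cond:
  assumes T: "cond T" and I: "finite I"
    and f: "\<And>i. i \<in> I \<Longrightarrow> f i \<notin> Domain T"
    and g: "\<And>i. i \<in> I \<Longrightarrow> g i \<notin> Range T"
    and fg: "\<And>i j k. i \<in> I \<Longrightarrow> j \<in> I \<Longrightarrow> g j = B (m * k) (g i) \<longleftrightarrow> f j = B (n * k) (f i)"
    and leaf: "\<And>i k. i \<in> I \<Longrightarrow> B k (g i) \<notin> Domain T"
    and leaf': "\<And>i j k. i \<in> I \<Longrightarrow> j \<in> I \<Longrightarrow> B k (g i) \<noteq> f j"
  shows "cond (ext T I f g)"
proof -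
  let ?E = "ext T I f g"
  have P: "piso T" and U: "unsat T" using T by (auto simp: cond_def)
  have fD: "B (n * k) (f i) \<notin> Domain T" if "i \<in> I" for i k using piso_Domain[OF P] f that by blast
  have gR: "B (m * k) (g i) \<notin> Range T" if "i \<in> I" for i k using piso_Range[OF P] g that by blast
  have shift: "B (m * k) (g i) = B (m * l) (g j) \<longleftrightarrow> B (n * k) (f i) = B (n * l) (f j)"
    if "i \<in> I" "j \<in> I" for i j k l
  proof -
    have "B (m * k) (g i) = B (m * l) (g j) \<longleftrightarrow> g j = B (m * (k - l)) (g i)"
      using B_swap[of "B (m * k) (g i)" "m * l" "g j"] by (auto simp: B_B algebra_simps)
    also have "\<dots> \<longleftrightarrow> f j = B (n * (k - l)) (f i)" using fg that by blast
    also have "\<dots> \<longleftrightarrow> B (n * k) (f i) = B (n * l) (f j)"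
      using B_swap[of "B (n * k) (f i)" "n * l" "f j"] by (auto simp: B_B algebra_simps)
    finally show ?thesis .
  qed
  have sv: "single_valued ?E"
  proof (rule single_valuedI)
    fix x y z assume "(x, y) \<in> ?E" "(x, z) \<in> ?E"
    then show "y = z" unfolding ext_iff using piso_sv[OF P] fD shift by (metis DomainI)
  qed
  have inj: "single_valued (?E\<inverse>)"
  proof (rule single_valuedI, unfold converse_iff)
    fix x y z assume "(y, x) \<in> ?E" "(z, x) \<in> ?E"
    then show "y = z" unfolding ext_iff using piso_inj[OF P] gR shift by (metis RangeI)
  qed
  have eqv: "(B (n * k) x, B (m * k) y) \<in> ?E" if "(x, y) \<in> ?E" for x y k
  proof -
    from that consider "(x, y) \<in> T" | i l where "i \<in> I" "x = B (n * l) (f i)" "y = B (m * l) (g i)"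
      unfolding ext_iff by blast
    then show ?thesis
    proof cases
      case 1 then show ?thesis using piso_eqv[OF P] by (auto simp: ext_iff)
    next
      case 2
      then have "B (n * k) x = B (n * (k + l)) (f i)" "B (m * k) y = B (m * (k + l)) (g i)"
        by (auto simp: B_B algebra_simps)
      then show ?thesis using 2(1) by (auto simp: ext_iff)
    qed
  qed
  obtain F where F: "finite F" "Field T \<subseteq> (\<Union>f\<in>F. orb f)" using P by (auto simp: piso_def)
  have "Field ?E \<subseteq> (\<Union>h\<in>F \<union> f ` I \<union> g ` I. orb h)"
    using F(2) by (fastforce simp: Field_def ext_iff Domain_iff Range_iff)
  then have fin: "\<exists>F. finite F \<and> Field ?E \<subseteq> (\<Union>f\<in>F. orb f)"
    using F(1) I by (intro exI[of _ "F \<union> f ` I \<union> g ` I"]) auto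
  have "unsat ?E" unfolding unsat_def
  proof (intro allI impI)
    fix C assume C: "C \<noteq> {}" "\<forall>x\<in>C. orb x \<subseteq> C" "C \<subseteq> Domain ?E" "C \<subseteq> Range ?E" "?E `` C \<subseteq> C" "?E\<inverse> `` C \<subseteq> C"
    have gC: "B k (g i) \<notin> C" if i: "i \<in> I" for i k
    proof
      assume "B k (g i) \<in> C"
      then have "orb (g i) \<subseteq> C" using C(2) by force
      then have "g i \<in> Domain ?E" using C(3) orb_refl by blast
      then obtain j l where "j \<in> I" "g i = B (n * l) (f j)"
        using leaf[OF i, of 0] by (auto simp: B_zero ext_iff Domain_iff)
      then have "B (- (n * l)) (g i) = f j" by (simp add: B_B B_zero)
      then show False using leaf'[OF i \<open>j \<in> I\<close>] by blast
    qed
    have fC: "B (n * k) (f i) \<notin> C" if i: "i \<in> I" for i k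
      using gC[OF i, of "m * k"] C(5) i by (auto simp: ext_iff Image_iff subset_iff)
    have "C \<subseteq> Domain T"
    proof
      fix x assume x: "x \<in> C"
      then obtain y where "(x, y) \<in> ?E" using C(3) by blast
      then show "x \<in> Domain T" using fC x by (auto simp: ext_iff)
    qed
    moreover have "C \<subseteq> Range T"
    proof
      fix x assume x: "x \<in> C"
      then obtain y where "(y, x) \<in> ?E" using C(4) by blast
      then show "x \<in> Range T" using gC x by (auto simp: ext_iff)
    qed
    moreover have "T \<subseteq> ?E" by (auto simp: ext_def)
    then have "T `` C \<subseteq> C" "T\<inverse> `` C \<subseteq> C" using C(5,6) by blast+
    ultimately show False using U C(1,2) unfolding unsat_def by blast
  qed
  then show ?thesis unfolding cond_def piso_def using sv inj eqv fin by blast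
qed

lemma fresh_choice:
  assumes I: "finite I" and G: "finite G"
    and c: "\<forall>N\<in>S. edge_compat n m N (c N)"
  shows "\<exists>g. (\<forall>i\<in>I. sz (g i) = c (sz (f i)) \<and> (\<forall>h\<in>G. g i \<notin> orb h)) \<and>
     (\<forall>i\<in>I. \<forall>j\<in>I. g j \<in> orb (g i) \<longrightarrow> (\<exists>a. f j = B (n * a) (f i) \<and> g j = B (m * a) (g i))) \<and>
     (\<forall>i\<in>I. \<forall>j\<in>I. \<forall>a. f j = B (n * a) (f i) \<longrightarrow> g j = B (m * a) (g i))"
  using I
proof (induction I rule: finite_induct)
  case empty
  then show ?case by simp
next
  case (insert i I)
  then obtain g where g1: "\<And>i. i \<in> I \<Longrightarrow> sz (g i) = c (sz (f i))"
    and g2: "\<And>i h. i \<in> I \<Longrightarrow> h \<in> G \<Longrightarrow> g i \<notin> orb h"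
    and g3: "\<And>i j. i \<in> I \<Longrightarrow> j \<in> I \<Longrightarrow> g j \<in> orb (g i) \<Longrightarrow> \<exists>a. f j = B (n * a) (f i) \<and> g j = B (m * a) (g i)"
    and g4: "\<And>i j a. i \<in> I \<Longrightarrow> j \<in> I \<Longrightarrow> f j = B (n * a) (f i) \<Longrightarrow> g j = B (m * a) (g i)"
    by blast
  have cc: "int (sz x) dvd n * k \<longleftrightarrow> int (c (sz x)) dvd m * k" for x k
    using c[rule_format, OF sz_in[of x]] by (simp add: edge_compat_def)
  have self: "B (n * a) x = x \<longleftrightarrow> B (m * a) y = y" if "sz y = c (sz x)" for a x y
    using cc that by (simp add: B_fix)
  show ?case
  proof (cases "\<exists>j\<in>I. \<exists>a. f i = B (n * a) (f j)")
    case True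
    then obtain j a where j: "j \<in> I" and fi: "f i = B (n * a) (f j)" by blast
    let ?g = "g(i := B (m * a) (g j))"
    have 1: "\<forall>i'\<in>insert i I. sz (?g i') = c (sz (f i')) \<and> (\<forall>h\<in>G. ?g i' \<notin> orb h)"
      using g1 g2 j fi by auto
    have 3: "\<exists>e. f i2 = B (n * e) (f i1) \<and> ?g i2 = B (m * e) (?g i1)"
      if A: "i1 \<in> insert i I" "i2 \<in> insert i I" "?g i2 \<in> orb (?g i1)" for i1 i2
    proof -
      define r1 where "r1 = (if i1 = i then j else i1)"
      define e1 where "e1 = (if i1 = i then a else 0)"
      define r2 where "r2 = (if i2 = i then j else i2)"
      define e2 where "e2 = (if i2 = i then a else 0)"
      have r: "r1 \<in> I" "r2 \<in> I" using A j by (auto simp: r1_def r2_def)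
      have e: "f i1 = B (n * e1) (f r1)" "?g i1 = B (m * e1) (g r1)" "f i2 = B (n * e2) (f r2)" "?g i2 = B (m * e2) (g r2)"
        using fi by (auto simp: r1_def r2_def e1_def e2_def B_zero)
      have "g r2 \<in> orb (g r1)" using A(3) unfolding e by simp
      then obtain u where "f r2 = B (n * u) (f r1)" "g r2 = B (m * u) (g r1)" using g3 r by blast
      then have "f i2 = B (n * (e2 + u - e1)) (f i1)" "?g i2 = B (m * (e2 + u - e1)) (?g i1)"
        unfolding e by (simp_all add: B_B algebra_simps)
      then show ?thesis by blast
    qed
    have 4: "?g i2 = B (m * e) (?g i1)"
      if A: "i1 \<in> insert i I" "i2 \<in> insert i I" "f i2 = B (n * e) (f i1)" for i1 i2 e
    proof -
      define r1 where "r1 = (if i1 = i then j else i1)"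
      define e1 where "e1 = (if i1 = i then a else 0)"
      define r2 where "r2 = (if i2 = i then j else i2)"
      define e2 where "e2 = (if i2 = i then a else 0)"
      have r: "r1 \<in> I" "r2 \<in> I" using A j by (auto simp: r1_def r2_def)
      have e: "f i1 = B (n * e1) (f r1)" "?g i1 = B (m * e1) (g r1)" "f i2 = B (n * e2) (f r2)" "?g i2 = B (m * e2) (g r2)"
        using fi by (auto simp: r1_def r2_def e1_def e2_def B_zero)
      have "B (n * e2) (f r2) = B (n * e) (B (n * e1) (f r1))" using A(3) unfolding e .
      then have "f r2 = B (n * (e + e1 - e2)) (f r1)"
        using B_swap[of "B (n * e) (B (n * e1) (f r1))" "n * e2" "f r2"] by (simp add: B_B algebra_simps)
      then have "g r2 = B (m * (e + e1 - e2)) (g r1)" using g4 r by blast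
      then show ?thesis unfolding e by (simp add: B_B algebra_simps)
    qed
    show ?thesis using 1 3 4 by (intro exI[of _ ?g]) blast
  next
    case False
    have "c (sz (f i)) \<in> S" using S_compat[OF sz_in c[rule_format, OF sz_in]] .
    then obtain y where y: "sz y = c (sz (f i))" "\<forall>z\<in>G \<union> g ` I. \<forall>k. B k z \<noteq> y"
      using fresh[of "c (sz (f i))" "G \<union> g ` I"] G insert.hyps by auto
    let ?g = "g(i := y)"
    have yG: "\<And>h. h \<in> G \<Longrightarrow> y \<notin> orb h" and yI: "\<And>j. j \<in> I \<Longrightarrow> y \<notin> orb (g j)"
      using y(2) by (auto simp: orb_iff)
    have yI': "\<And>j. j \<in> I \<Longrightarrow> g j \<notin> orb y" using yI orb_sym by blast
    have 1: "\<forall>i'\<in>insert i I. sz (?g i') = c (sz (f i')) \<and> (\<forall>h\<in>G. ?g i' \<notin> orb h)"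
      using g1 g2 y yG by auto
    have F': "f j \<noteq> B (n * a) (f i)" if "j \<in> I" for j a
    proof
      assume "f j = B (n * a) (f i)"
      then have "f i = B (n * (- a)) (f j)" by (simp add: B_B B_zero)
      then show False using False that by blast
    qed
    have 3: "\<exists>e. f i2 = B (n * e) (f i1) \<and> ?g i2 = B (m * e) (?g i1)"
      if A: "i1 \<in> insert i I" "i2 \<in> insert i I" "?g i2 \<in> orb (?g i1)" for i1 i2
    proof (cases "i1 = i"; cases "i2 = i")
      assume "i1 = i" "i2 = i" then show ?thesis by (intro exI[of _ 0]) (auto simp: B_zero)
    qed (use A g3 yI yI' in auto)
    have 4: "?g i2 = B (m * e) (?g i1)"
      if A: "i1 \<in> insert i I" "i2 \<in> insert i I" "f i2 = B (n * e) (f i1)" for i1 i2 e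
    proof (cases "i1 = i"; cases "i2 = i")
      assume "i1 = i" "i2 = i"
      then show ?thesis using A self[OF y(1), of e] by auto
    qed (use A g4 False F' in auto)
    show ?thesis using 1 3 4 by (intro exI[of _ ?g]) blast
  qed
qed

lemma Field_finite_orbits: "piso T \<Longrightarrow> \<exists>F. finite F \<and> (\<forall>x. (\<forall>h\<in>F. x \<notin> orb h) \<longrightarrow> (\<forall>k. B k x \<notin> Field T))"
proof -
  assume "piso T"
  then obtain F where F: "finite F" "Field T \<subseteq> (\<Union>f\<in>F. orb f)" by (auto simp: piso_def)
  have "B k x \<notin> Field T" if x: "\<forall>h\<in>F. x \<notin> orb h" for x k
  proof
    assume "B k x \<in> Field T"
    then obtain h where "h \<in> F" "B k x \<in> orb h" using F(2) by blast
    then show False using x by simp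
  qed
  then show ?thesis using F(1) by blast
qed

lemma m_not_dvd_1: "\<not> m dvd 1" using m2 by auto
lemma n_not_dvd_1: "\<not> n dvd 1" using n2 by auto

lemma out_ext:
  assumes T: "cond T" and I: "finite I" and G: "finite G"
    and f: "\<forall>i\<in>I. f i \<notin> Domain T"
    and c: "\<forall>N\<in>S. edge_compat n m N (c N)"
  shows "\<exists>g. cond (ext T I f g) \<and>
     (\<forall>i\<in>I. sz (g i) = c (sz (f i)) \<and> (\<forall>k. B k (g i) \<notin> Field T) \<and> (\<forall>h\<in>G. g i \<notin> orb h) \<and>
        (\<forall>k. B k (g i) \<notin> Domain (ext T I f g)) \<and>
        (m dvd int (c (sz (f i))) \<longrightarrow> (\<forall>k. B k (g i) \<in> Range (ext T I f g) \<longrightarrow> m dvd k))) \<and>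
     (\<forall>i\<in>I. \<forall>j\<in>I. g j \<in> orb (g i) \<longrightarrow> (\<exists>a. f j = B (n * a) (f i) \<and> g j = B (m * a) (g i)))"
proof -
  have P: "piso T" using T by (simp add: cond_def)
  obtain F where F: "finite F" "\<And>x k. (\<forall>h\<in>F. x \<notin> orb h) \<Longrightarrow> B k x \<notin> Field T"
    using Field_finite_orbits[OF P] by blast
  have "finite (G \<union> F \<union> f ` I)" using I G F(1) by simp
  from fresh_choice[OF I this c, of f] obtain g where g:
      "\<forall>i\<in>I. sz (g i) = c (sz (f i)) \<and> (\<forall>h\<in>G \<union> F \<union> f ` I. g i \<notin> orb h)"
      "\<forall>i\<in>I. \<forall>j\<in>I. g j \<in> orb (g i) \<longrightarrow> (\<exists>a. f j = B (n * a) (f i) \<and> g j = B (m * a) (g i))"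
      "\<forall>i\<in>I. \<forall>j\<in>I. \<forall>a. f j = B (n * a) (f i) \<longrightarrow> g j = B (m * a) (g i)"
    by (elim exE conjE)
  have g1: "\<And>i. i \<in> I \<Longrightarrow> sz (g i) = c (sz (f i))"
    and g2: "\<And>i h. i \<in> I \<Longrightarrow> h \<in> G \<union> F \<union> f ` I \<Longrightarrow> g i \<notin> orb h"
    and g3: "\<And>i j. i \<in> I \<Longrightarrow> j \<in> I \<Longrightarrow> g j \<in> orb (g i) \<Longrightarrow> \<exists>a. f j = B (n * a) (f i) \<and> g j = B (m * a) (g i)"
    and g4: "\<And>i j a. i \<in> I \<Longrightarrow> j \<in> I \<Longrightarrow> f j = B (n * a) (f i) \<Longrightarrow> g j = B (m * a) (g i)"
    using g by simp_all
  have gF: "B k (g i) \<notin> Field T" if "i \<in> I" for i k using F(2) g2 that by blast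
  have gf: "B k (g i) \<noteq> f j" if "i \<in> I" "j \<in> I" for i j k
  proof
    assume "B k (g i) = f j"
    then have "f j \<in> orb (g i)" by (metis B_in_orb)
    then show False using g2[OF that(1), of "f j"] that(2) orb_sym by blast
  qed
  have fg: "g j = B (m * k) (g i) \<longleftrightarrow> f j = B (n * k) (f i)" if ij: "i \<in> I" "j \<in> I" for i j k
  proof
    assume A: "g j = B (m * k) (g i)"
    then obtain a where a: "f j = B (n * a) (f i)" "g j = B (m * a) (g i)" using g3[OF ij] by auto
    then have "int (sz (g i)) dvd m * (k - a)" using A by (simp add: B_eq algebra_simps)
    then have "int (sz (f i)) dvd n * (k - a)" using c[rule_format, OF sz_in[of "f i"]] g1[OF ij(1)] by (simp add: edge_compat_def)
    then have "B (n * k) (f i) = B (n * a) (f i)" by (simp add: B_eq algebra_simps)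
    then show "f j = B (n * k) (f i)" using a by simp
  next
    assume "f j = B (n * k) (f i)" then show "g j = B (m * k) (g i)" using g4 ij by blast
  qed
  have C: "cond (ext T I f g)"
  proof (rule ext_cond[OF T I])
    show "\<And>i. i \<in> I \<Longrightarrow> g i \<notin> Range T" using gF[of _ 0] by (auto simp: Field_def B_zero)
    show "\<And>i k. i \<in> I \<Longrightarrow> B k (g i) \<notin> Domain T" using gF by (auto simp: Field_def)
  qed (use f fg gf in auto)
  have D: "B k (g i) \<notin> Domain (ext T I f g)" if i: "i \<in> I" for i k
  proof
    assume "B k (g i) \<in> Domain (ext T I f g)"
    then obtain j l where j: "j \<in> I" "B k (g i) = B (n * l) (f j)"
      using gF[OF i] by (auto simp: ext_iff Domain_iff Field_def)
    then have "f j = B (- (n * l) + k) (g i)" using B_swap[of "B k (g i)" "n * l" "f j"] by (simp add: B_B)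
    then show False using gf[OF i j(1)] by metis
  qed
  have R: "m dvd k" if i: "i \<in> I" and mm: "m dvd int (c (sz (f i)))" and k: "B k (g i) \<in> Range (ext T I f g)" for i k
  proof -
    obtain j l where j: "j \<in> I" "B k (g i) = B (m * l) (g j)"
      using gF[OF i] k by (auto simp: ext_iff Range_iff Field_def)
    then have "g j \<in> orb (g i)" by (metis B_in_orb B_in_orb_iff)
    then obtain a where "g j = B (m * a) (g i)" using g3[OF i j(1)] by blast
    then have "B k (g i) = B (m * (l + a)) (g i)" using j by (simp add: B_B algebra_simps)
    then have "int (c (sz (f i))) dvd k - m * (l + a)" by (simp add: B_eq g1[OF i])
    then have "m dvd k - m * (l + a)" using mm dvd_trans by blast
    then have "m dvd (k - m * (l + a)) + m * (l + a)" by (rule dvd_add) simp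
    then show ?thesis by simp
  qed
  show ?thesis
  proof (intro exI[of _ g] conjI ballI allI impI)
    fix i j assume "i \<in> I" "j \<in> I" "g j \<in> orb (g i)"
    then show "\<exists>a. f j = B (n * a) (f i) \<and> g j = B (m * a) (g i)" by (rule g3)
  qed (use C g1 gF g2 D R in auto)
qed

end

text \<open>
  The largest admissible length at the far end of a \<open>t\<close>-edge. It is divisible by \<open>m\<close>, so the
  \<open>b\<^sup>m\<close>-orbit met by the edge is not the whole \<open>b\<close>-orbit.
\<close>

definition edge_size :: "int \<Rightarrow> int \<Rightarrow> nat \<Rightarrow> nat" where
  "edge_size m n N = nat \<bar>m\<bar> * (N div gcd N (nat \<bar>n\<bar>))"

lemma dvd_mult_iff_div_gcd:
  fixes N :: nat and n k :: int
  assumes "n \<noteq> 0"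
  shows "int N dvd n * k \<longleftrightarrow> int (N div gcd N (nat \<bar>n\<bar>)) dvd k"
proof -
  define g where "g = gcd N (nat \<bar>n\<bar>)"
  have g0: "g > 0" using assms by (simp add: g_def)
  define N' where "N' = N div g"
  define n' where "n' = nat \<bar>n\<bar> div g"
  have "g dvd N" "g dvd nat \<bar>n\<bar>" unfolding g_def by (rule gcd_dvd1, rule gcd_dvd2)
  then have N: "N = g * N'" and nn: "nat \<bar>n\<bar> = g * n'" unfolding N'_def n'_def by simp_all
  have cop: "coprime N' n'" unfolding N'_def n'_def g_def using assms by (intro div_gcd_coprime) auto
  have "int N dvd n * k \<longleftrightarrow> N dvd nat \<bar>n\<bar> * nat \<bar>k\<bar>"
    by (simp flip: nat_abs_mult_distrib)
  also have "\<dots> \<longleftrightarrow> N' dvd n' * nat \<bar>k\<bar>" using g0 by (simp add: N nn mult.assoc)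
  also have "\<dots> \<longleftrightarrow> N' dvd nat \<bar>k\<bar>" using cop by (rule coprime_dvd_mult_right_iff)
  also have "\<dots> \<longleftrightarrow> int N' dvd k"
    by simp
  finally show ?thesis unfolding N'_def g_def .
qed

lemma edge_compat_iff:
  assumes "m \<noteq> 0" "n \<noteq> 0"
  shows "edge_compat n m N M \<longleftrightarrow> N div gcd N (nat \<bar>n\<bar>) = M div gcd M (nat \<bar>m\<bar>)"
proof -
  have "edge_compat n m N M \<longleftrightarrow>
      (\<forall>k. int (N div gcd N (nat \<bar>n\<bar>)) dvd k \<longleftrightarrow> int (M div gcd M (nat \<bar>m\<bar>)) dvd k)"
    unfolding edge_compat_def using assms by (simp add: dvd_mult_iff_div_gcd)
  also have "\<dots> \<longleftrightarrow> N div gcd N (nat \<bar>n\<bar>) = M div gcd M (nat \<bar>m\<bar>)"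
    by (metis dvd_antisym dvd_refl int_dvd_int_iff)
  finally show ?thesis .
qed

lemma edge_size_div_gcd: "m \<noteq> 0 \<Longrightarrow> edge_size m n N div gcd (edge_size m n N) (nat \<bar>m\<bar>) = N div gcd N (nat \<bar>n\<bar>)"
  by (simp add: edge_size_def gcd_mult_left)

lemma edge_compat_edge_size: "m \<noteq> 0 \<Longrightarrow> n \<noteq> 0 \<Longrightarrow> edge_compat n m N (edge_size m n N)"
  unfolding edge_compat_iff edge_size_div_gcd ..

lemma dvd_edge_size: "m dvd int (edge_size m n N)"
proof -
  have "int (edge_size m n N) = \<bar>m\<bar> * int (N div gcd N (nat \<bar>n\<bar>))" by (simp add: edge_size_def)
  then show ?thesis by simp
qed

context orbit_system
begin

lemma m0: "m \<noteq> 0" and n0: "n \<noteq> 0" using m2 n2 by auto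

lemma pact_bpow: "pact B T (bpow k) x y \<longleftrightarrow> y = B k x"
proof -
  have *: "pact B T (replicate j (Bg, s)) x y \<longleftrightarrow> y = B (if s then - int j else int j) x" for j s x
  proof (induction j arbitrary: x)
    case 0 then show ?case by (auto simp: B_zero)
  next
    case (Suc j) then show ?case by (cases s) (auto simp: B_B algebra_simps)
  qed
  show ?thesis unfolding bpow_def * by (cases "k < 0") auto
qed

definition reach :: "'i set \<Rightarrow> ('x \<times> 'x) set \<Rightarrow> ('i \<Rightarrow> 'x) \<Rightarrow> ('x \<times> 'x) set \<Rightarrow> ('i \<Rightarrow> 'x) \<Rightarrow> bool" where
  "reach I T f T' g \<longleftrightarrow> T \<subseteq> T' \<and> cond T' \<and> (\<exists>w. \<forall>i\<in>I. pact B T' w (f i) (g i))"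

definition finer :: "'i set \<Rightarrow> ('i \<Rightarrow> 'x) \<Rightarrow> ('i \<Rightarrow> 'x) \<Rightarrow> bool" where
  "finer I f g \<longleftrightarrow> (\<forall>i\<in>I. \<forall>j\<in>I. g j \<in> orb (g i) \<longrightarrow> f j \<in> orb (f i))"

lemma reach_dual: "orbit_system.reach B n m I (T\<inverse>) f (T'\<inverse>) g \<longleftrightarrow> reach I T f T' g"
proof -
  have "(\<exists>w. \<forall>i\<in>I. pact B (T'\<inverse>) w (f i) (g i)) \<longleftrightarrow> (\<exists>w. \<forall>i\<in>I. pact B T' w (f i) (g i))"
    by (metis flipt_flipt pact_flipt)
  then show ?thesis unfolding orbit_system.reach_def[OF dual] reach_def cond_dual by simp
qed

lemma reach_cond: "reach I T f T' g \<Longrightarrow> cond T'" and reach_sub: "reach I T f T' g \<Longrightarrow> T \<subseteq> T'"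
  by (auto simp: reach_def)

lemma reach_refl: "cond T \<Longrightarrow> reach I T f T f"
  unfolding reach_def by (auto intro!: exI[of _ "[]"])

lemma reach_shift: "cond T \<Longrightarrow> reach I T f T (\<lambda>i. B k (f i))"
  unfolding reach_def by (auto intro!: exI[of _ "bpow k"] simp: pact_bpow)

lemma reach_trans:
  assumes "reach I T f T' g" "reach I T' g T'' h" shows "reach I T f T'' h"
proof -
  obtain w v where w: "\<forall>i\<in>I. pact B T' w (f i) (g i)" and v: "\<forall>i\<in>I. pact B T'' v (g i) (h i)"
    and sub: "T \<subseteq> T'" "T' \<subseteq> T''" and c: "cond T''"
    using assms by (auto simp: reach_def)
  have "\<forall>i\<in>I. pact B T'' (w @ v) (f i) (h i)"
    using w v pact_mono[OF _ sub(2)] by (fastforce simp: pact_append)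
  then show ?thesis using sub c unfolding reach_def by blast
qed

lemma reach_t:
  assumes "T \<subseteq> T'" "cond T'" "\<forall>i\<in>I. (f i, g i) \<in> T'" shows "reach I T f T' g"
  unfolding reach_def using assms by (auto intro!: exI[of _ "[(Tg, False)]"])

lemma finer_refl: "finer I f f" by (simp add: finer_def)
lemma finer_trans: "finer I f g \<Longrightarrow> finer I g h \<Longrightarrow> finer I f h" unfolding finer_def by blast
lemma finer_shift: "finer I f (\<lambda>i. B k (f i))" unfolding finer_def by auto

lemma sub_ext: "T \<subseteq> ext T I f g" by (auto simp: ext_def)

lemma out_step:
  assumes T: "cond T" and I: "finite I" and G: "finite G"
    and f: "\<forall>i\<in>I. f i \<notin> Domain T"
    and c: "\<forall>N\<in>S. edge_compat n m N (c N)"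
  shows "\<exists>T' g. reach I T f T' g \<and> finer I f g \<and> (\<forall>i\<in>I. (f i, g i) \<in> T') \<and>
    (\<forall>i\<in>I. sz (g i) = c (sz (f i))) \<and> (\<forall>i\<in>I. \<forall>k. B k (g i) \<notin> Domain T') \<and>
    (\<forall>i\<in>I. \<forall>h\<in>G. g i \<notin> orb h) \<and>
    (\<forall>i\<in>I. m dvd int (c (sz (f i))) \<longrightarrow> (\<forall>k. B k (g i) \<in> Range T' \<longrightarrow> m dvd k)) \<and>
    (\<forall>i\<in>I. \<forall>j\<in>I. g j \<in> orb (g i) \<longrightarrow> (\<exists>a. f j = B (n * a) (f i) \<and> g j = B (m * a) (g i))) \<and>
    Domain T' \<subseteq> Domain T \<union> {B (n * k) (f i) | i k. i \<in> I}"
proof -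
  from out_ext[OF T I G f c] obtain g where C: "cond (ext T I f g)"
    and g: "\<forall>i\<in>I. sz (g i) = c (sz (f i)) \<and> (\<forall>k. B k (g i) \<notin> Field T) \<and> (\<forall>h\<in>G. g i \<notin> orb h) \<and>
        (\<forall>k. B k (g i) \<notin> Domain (ext T I f g)) \<and>
        (m dvd int (c (sz (f i))) \<longrightarrow> (\<forall>k. B k (g i) \<in> Range (ext T I f g) \<longrightarrow> m dvd k))"
    and s: "\<forall>i\<in>I. \<forall>j\<in>I. g j \<in> orb (g i) \<longrightarrow> (\<exists>a. f j = B (n * a) (f i) \<and> g j = B (m * a) (g i))"
    by (elim exE conjE) (assumption | simp)+
  have t: "\<forall>i\<in>I. (f i, g i) \<in> ext T I f g"
    unfolding ext_iff by (metis B_zero mult_zero_right)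
  have "finer I f g" unfolding finer_def using s by (metis B_in_orb)
  moreover have "Domain (ext T I f g) \<subseteq> Domain T \<union> {B (n * k) (f i) | i k. i \<in> I}"
    unfolding ext_def by blast
  ultimately show ?thesis using reach_t[OF sub_ext C t] g s t
    by (intro exI[of _ "ext T I f g"] exI[of _ g]) simp
qed

lemma in_step:
  assumes T: "cond T" and I: "finite I" and G: "finite G"
    and f: "\<forall>i\<in>I. f i \<notin> Range T"
    and c: "\<forall>N\<in>S. edge_compat m n N (c N)"
  shows "\<exists>T' g. reach I T f T' g \<and> finer I f g \<and> (\<forall>i\<in>I. (g i, f i) \<in> T') \<and>
    (\<forall>i\<in>I. sz (g i) = c (sz (f i))) \<and> (\<forall>i\<in>I. \<forall>k. B k (g i) \<notin> Range T') \<and>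
    (\<forall>i\<in>I. \<forall>h\<in>G. g i \<notin> orb h) \<and>
    (\<forall>i\<in>I. n dvd int (c (sz (f i))) \<longrightarrow> (\<forall>k. B k (g i) \<in> Domain T' \<longrightarrow> n dvd k)) \<and>
    (\<forall>i\<in>I. \<forall>j\<in>I. g j \<in> orb (g i) \<longrightarrow> (\<exists>a. f j = B (m * a) (f i) \<and> g j = B (n * a) (g i)))"
proof -
  have T': "orbit_system.cond B n m (T\<inverse>)" using T by (simp add: cond_dual)
  have f': "\<forall>i\<in>I. f i \<notin> Domain (T\<inverse>)" using f by simp
  from orbit_system.out_step[OF dual T' I G f' c] obtain U g where U:
    "orbit_system.reach B n m I (T\<inverse>) f U g" "finer I f g" "\<forall>i\<in>I. (f i, g i) \<in> U"
    "\<forall>i\<in>I. sz (g i) = c (sz (f i))" "\<forall>i\<in>I. \<forall>k. B k (g i) \<notin> Domain U"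
    "\<forall>i\<in>I. \<forall>h\<in>G. g i \<notin> orb h"
    "\<forall>i\<in>I. n dvd int (c (sz (f i))) \<longrightarrow> (\<forall>k. B k (g i) \<in> Range U \<longrightarrow> n dvd k)"
    "\<forall>i\<in>I. \<forall>j\<in>I. g j \<in> orb (g i) \<longrightarrow> (\<exists>a. f j = B (m * a) (f i) \<and> g j = B (n * a) (g i))"
    by (elim exE conjE) (assumption | simp)+
  have "reach I T f (U\<inverse>) g" using U(1) reach_dual[of I T f "U\<inverse>" g] by simp
  then show ?thesis using U(2-) by (intro exI[of _ "U\<inverse>"] exI[of _ g]) simp
qed

lemma finite_orb: "sz x > 0 \<Longrightarrow> finite (orb x)"
proof -
  assume s: "sz x > 0"
  have "orb x \<subseteq> (\<lambda>k. B k x) ` {0..<int (sz x)}"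
  proof
    fix y assume "y \<in> orb x"
    then obtain k where "y = B k x" by (auto simp: orb_iff)
    then have "y = B (k mod int (sz x)) x" by (simp add: B_eq minus_mod_eq_mult_div)
    then show "y \<in> (\<lambda>k. B k x) ` {0..<int (sz x)}" using s by auto
  qed
  then show ?thesis using finite_subset by blast
qed

definition rep :: "'x \<Rightarrow> 'x" where "rep x = (SOME y. y \<in> orb x)"

lemma rep_orb: "rep x \<in> orb x" unfolding rep_def by (rule someI[of _ x]) simp

lemma rep_eq: "y \<in> orb x \<Longrightarrow> rep y = rep x" unfolding rep_def by (simp add: orb_eq)

definition ix :: "'x \<Rightarrow> int" where "ix x = (SOME k. x = B k (rep x))"

lemma ix: "x = B (ix x) (rep x)"
proof -
  have "x \<in> orb (rep x)" using rep_orb orb_sym by blast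
  then show ?thesis unfolding ix_def orb_iff by (rule someI_ex)
qed

lemma free_class_count:
  assumes P: "piso T" and C: "\<forall>x\<in>C. orb x \<subseteq> C" "C \<subseteq> Domain T" "T `` C \<subseteq> C"
    and F: "finite F" "C \<subseteq> (\<Union>f\<in>F. orb f)" and z: "\<forall>x\<in>C. sz x = 0" and ne: "C \<noteq> {}"
    and mn: "\<bar>m\<bar> \<le> \<bar>n\<bar>"
  shows "\<bar>m\<bar> = \<bar>n\<bar>" "C \<subseteq> Range T" "T\<inverse> `` C \<subseteq> C"
proof -
  have inj: "B j x = B k x \<longleftrightarrow> j = k" if "x \<in> C" for x j k using z that by (simp add: B_eq)
  have "\<forall>x\<in>C. \<exists>y. (x, y) \<in> T" using C(2) by blast
  from bchoice[OF this] obtain \<tau> where \<tau>: "\<forall>x\<in>C. (x, \<tau> x) \<in> T" by blast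
  define R where "R = rep ` C"
  have RC: "R \<subseteq> C" using C(1) rep_orb by (auto simp: R_def)
  have "rep ` C \<subseteq> rep ` F"
  proof
    fix r assume "r \<in> rep ` C"
    then obtain x f where "x \<in> C" "r = rep x" "f \<in> F" "x \<in> orb f" using F(2) by blast
    then show "r \<in> rep ` F" using rep_eq by blast
  qed
  then have finR: "finite R" unfolding R_def using F(1) finite_surj by blast
  have repR: "rep r = r" if "r \<in> R" for r using that rep_eq[OF rep_orb] by (auto simp: R_def)
  have BC: "B j r \<in> C" if "r \<in> R" for j r using that RC C(1) B_in_orb by blast
  have tC: "\<tau> (B j r) \<in> C" if "r \<in> R" for j r using \<tau> BC[OF that] C(3) by blast
  define \<Phi> where "\<Phi> = (\<lambda>(r, j). (rep (\<tau> (B j r)), ix (\<tau> (B j r)) mod \<bar>m\<bar>))"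
  have maps: "\<Phi> ` (R \<times> {0..<\<bar>n\<bar>}) \<subseteq> R \<times> {0..<\<bar>m\<bar>}"
    using tC m2 by (auto simp: \<Phi>_def R_def)
  have key: "\<exists>k. (B (j + n * k) r, y) \<in> T"
    if r: "r \<in> R" and y: "y \<in> C" and e: "rep (\<tau> (B j r)) = rep y" "ix (\<tau> (B j r)) mod \<bar>m\<bar> = ix y mod \<bar>m\<bar>" for r j y
  proof -
    from e(2) have "m dvd ix y - ix (\<tau> (B j r))" by (metis abs_dvd_iff mod_eq_dvd_iff)
    then obtain k where k: "ix y - ix (\<tau> (B j r)) = m * k" by blast
    have "y = B (m * k) (\<tau> (B j r))"
      using ix[of y] ix[of "\<tau> (B j r)"] e(1) k by (metis B_B diff_add_cancel)
    moreover have "(B (n * k) (B j r), B (m * k) (\<tau> (B j r))) \<in> T"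
      using piso_eqv[OF P] \<tau> BC[OF r] by blast
    ultimately show ?thesis by (metis B_B add.commute)
  qed
  have injPhi: "inj_on \<Phi> (R \<times> {0..<\<bar>n\<bar>})"
  proof (rule inj_onI, clarify)
    fix r1 j1 r2 j2
    assume r: "r1 \<in> R" "r2 \<in> R" and j: "j1 \<in> {0..<\<bar>n\<bar>}" "j2 \<in> {0..<\<bar>n\<bar>}" and e: "\<Phi> (r1, j1) = \<Phi> (r2, j2)"
    obtain k where "(B (j1 + n * k) r1, \<tau> (B j2 r2)) \<in> T"
      using key[OF r(1) tC[OF r(2)], of j1 j2] e by (auto simp: \<Phi>_def)
    then have eq: "B (j1 + n * k) r1 = B j2 r2" using piso_inj[OF P] \<tau> BC[OF r(2)] by blast
    then have "r1 \<in> orb r2" by (metis B_in_orb B_in_orb_iff)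
    then have rr: "r1 = r2" using rep_eq repR r by metis
    then have "j1 + n * k = j2" using eq inj r(1) RC by blast
    then have "j1 mod \<bar>n\<bar> = j2 mod \<bar>n\<bar>"
      by (metis abs_dvd_iff add_diff_cancel_left' dvd_triv_left mod_eq_dvd_iff)
    then have "j1 = j2" using j by simp
    then show "r1 = r2 \<and> j1 = j2" using rr by simp
  qed
  have "card (R \<times> {0..<\<bar>n\<bar>}) \<le> card (R \<times> {0..<\<bar>m\<bar>})"
    using card_inj_on_le[OF injPhi maps] finR by simp
  then have "card R * nat \<bar>n\<bar> \<le> card R * nat \<bar>m\<bar>" by (simp add: card_cartesian_product)
  moreover have "card R > 0" using finR ne by (simp add: R_def card_gt_0_iff)
  ultimately have "\<bar>n\<bar> \<le> \<bar>m\<bar>" by simp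
  then show eq: "\<bar>m\<bar> = \<bar>n\<bar>" using mn by simp
  have "\<Phi> ` (R \<times> {0..<\<bar>n\<bar>}) = R \<times> {0..<\<bar>m\<bar>}"
    by (rule card_subset_eq[OF _ maps]) (simp_all add: finR card_image[OF injPhi] eq card_cartesian_product)
  then have all: "\<exists>x\<in>C. (x, y) \<in> T" if y: "y \<in> C" for y
  proof -
    have "(rep y, ix y mod \<bar>m\<bar>) \<in> R \<times> {0..<\<bar>m\<bar>}" using y m2 by (auto simp: R_def)
    also have "\<dots> = \<Phi> ` (R \<times> {0..<\<bar>n\<bar>})" using \<open>\<Phi> ` (R \<times> {0..<\<bar>n\<bar>}) = R \<times> {0..<\<bar>m\<bar>}\<close> by simp
    finally obtain r j where r: "r \<in> R" and e: "\<Phi> (r, j) = (rep y, ix y mod \<bar>m\<bar>)" by fastforce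
    obtain k where "(B (j + n * k) r, y) \<in> T" using key[OF r y, of j] e by (auto simp: \<Phi>_def)
    then show ?thesis using BC[OF r] by blast
  qed
  then show "C \<subseteq> Range T" by blast
  show "T\<inverse> `` C \<subseteq> C"
  proof
    fix x assume "x \<in> T\<inverse> `` C"
    then obtain y where y: "y \<in> C" "(x, y) \<in> T" by blast
    then show "x \<in> C" using all[OF y(1)] piso_inj[OF P] by blast
  qed
qed

lemma finite_forward_closed:
  assumes P: "piso T" and C: "C \<subseteq> Domain T" "T `` C \<subseteq> C" and fin: "finite C"
  shows "C \<subseteq> Range T" "T\<inverse> `` C \<subseteq> C"
proof -
  have "\<forall>x\<in>C. \<exists>y. (x, y) \<in> T" using C(1) by blast
  from bchoice[OF this] obtain \<tau> where \<tau>: "\<forall>x\<in>C. (x, \<tau> x) \<in> T" by blast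
  have "inj_on \<tau> C" using \<tau> piso_inj[OF P] by (metis inj_onI)
  moreover have "\<tau> ` C \<subseteq> C" using \<tau> C(2) by blast
  ultimately have e: "\<tau> ` C = C" using endo_inj_surj[OF fin] by blast
  have "\<tau> ` C \<subseteq> Range T" using \<tau> by blast
  then show "C \<subseteq> Range T" using e by simp
  show "T\<inverse> `` C \<subseteq> C"
  proof
    fix x assume "x \<in> T\<inverse> `` C"
    then obtain y where y: "y \<in> C" "(x, y) \<in> T" by blast
    then obtain z where "z \<in> C" "y = \<tau> z" using e by blast
    then show "x \<in> C" using \<tau> y piso_inj[OF P] by blast
  qed
qed

lemma dom_unsat:
  assumes T: "cond T" and S: "0 \<notin> S \<or> S = {0} \<and> \<bar>m\<bar> \<le> \<bar>n\<bar>"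
    and C: "C \<noteq> {}" "\<forall>x\<in>C. orb x \<subseteq> C" "C \<subseteq> Domain T" "T `` C \<subseteq> C"
  shows False
proof -
  have P: "piso T" using T by (simp add: cond_def)
  obtain F where F: "finite F" "Field T \<subseteq> (\<Union>f\<in>F. orb f)" using P by (auto simp: piso_def)
  then have F': "C \<subseteq> (\<Union>f\<in>F. orb f)" using C(3) by (auto simp: Field_def)
  have "C \<subseteq> Range T \<and> T\<inverse> `` C \<subseteq> C"
  proof (cases "0 \<in> S")
    case True
    then have "S = {0}" "\<bar>m\<bar> \<le> \<bar>n\<bar>" using S by auto
    then have "\<forall>x\<in>C. sz x = 0" using sz_in by blast
    then show ?thesis using free_class_count[OF P C(2-4) F(1) F' _ C(1) \<open>\<bar>m\<bar> \<le> \<bar>n\<bar>\<close>] by blast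
  next
    case False
    then have "finite (orb x)" for x using finite_orb sz_in by (metis bot_nat_0.not_eq_extremum)
    then have "finite C" using F' F(1) by (meson finite_UN finite_subset)
    then show ?thesis using finite_forward_closed[OF P C(3,4)] by blast
  qed
  then show False using T C unfolding cond_def unsat_def by blast
qed

end

context orbit_system
begin

text \<open>
  Once inside \<open>F\<close>, a point stays there under positive words, and each \<open>b\<close>-orbit in \<open>F\<close> is entered
  through one \<open>b\<^sup>m\<close>-orbit only: this leaves room to turn around.
\<close>

definition funnel :: "('x \<times> 'x) set \<Rightarrow> 'x set \<Rightarrow> bool" where
  "funnel T F \<longleftrightarrow> (\<forall>x\<in>F. orb x \<subseteq> F) \<and> T `` F \<subseteq> F \<and> (\<forall>x\<in>F \<inter> Range T. B 1 x \<notin> Range T)"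

lemma S_edge_size: "\<forall>N\<in>S. edge_compat n m N (edge_size m n N)" using edge_compat_edge_size[OF m0 n0] by blast

lemma S_edge_size': "\<forall>N\<in>S. edge_compat m n N (edge_size n m N)" using edge_compat_edge_size[OF n0 m0] by blast

lemma funnel_move:
  assumes T: "cond T" and F: "funnel T F" and I: "finite I"
  shows "\<exists>T' F' g. T \<subseteq> T' \<and> cond T' \<and> F \<subseteq> F' \<and> funnel T' F' \<and> (\<forall>i\<in>I. (f i, g i) \<in> T') \<and>
    (\<forall>x y. (x, y) \<in> T' \<longrightarrow> (x, y) \<in> T \<or> y \<in> F')"
proof -
  define J where "J = {i \<in> I. f i \<notin> Domain T}"
  have J: "finite J" "\<forall>i\<in>J. f i \<notin> Domain T" using I by (auto simp: J_def)
  from out_ext[OF T J(1) finite.emptyI J(2) S_edge_size] obtain h where C: "cond (ext T J f h)"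
    and h: "\<forall>i\<in>J. sz (h i) = edge_size m n (sz (f i)) \<and> (\<forall>k. B k (h i) \<notin> Field T) \<and> (\<forall>h'\<in>{}. h i \<notin> orb h') \<and>
        (\<forall>k. B k (h i) \<notin> Domain (ext T J f h)) \<and>
        (m dvd int (edge_size m n (sz (f i))) \<longrightarrow> (\<forall>k. B k (h i) \<in> Range (ext T J f h) \<longrightarrow> m dvd k))"
    by (elim exE conjE) (assumption | simp)+
  let ?T = "ext T J f h"
  have hD: "B k (h i) \<notin> Domain ?T" if "i \<in> J" for i k using h that by blast
  have hR: "m dvd k" if "i \<in> J" "B k (h i) \<in> Range ?T" for i k using h that dvd_edge_size by blast
  define F' where "F' = F \<union> (\<Union>i\<in>J. orb (h i))"
  have new: "(x, y) \<in> T \<or> (\<exists>i\<in>J. y \<in> orb (h i))" if "(x, y) \<in> ?T" for x y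
    using that B_in_orb unfolding ext_iff by blast
  have F1: "\<And>x. x \<in> F \<Longrightarrow> orb x \<subseteq> F" and F2: "T `` F \<subseteq> F"
    and F3: "\<And>x. x \<in> F \<Longrightarrow> x \<in> Range T \<Longrightarrow> B 1 x \<notin> Range T"
    using F by (auto simp: funnel_def)
  have fwd: "?T `` F' \<subseteq> F'"
  proof
    fix y assume "y \<in> ?T `` F'"
    then obtain x where x: "x \<in> F'" "(x, y) \<in> ?T" by blast
    show "y \<in> F'"
    proof (cases "x \<in> F")
      case True then show ?thesis using new[OF x(2)] F2 by (auto simp: F'_def)
    next
      case False
      then obtain i k where "i \<in> J" "x = B k (h i)" using x(1) by (auto simp: F'_def orb_iff)
      then show ?thesis using hD x(2) by blast
    qed
  qed
  have "B 1 x \<notin> Range ?T" if x: "x \<in> F'" "x \<in> Range ?T" for x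
  proof
    assume r: "B 1 x \<in> Range ?T"
    show False
    proof (cases "\<exists>i\<in>J. x \<in> orb (h i)")
      case True
      then obtain i k where i: "i \<in> J" "x = B k (h i)" by (auto simp: orb_iff)
      then have "m dvd k" using hR x(2) by blast
      moreover have "m dvd 1 + k" using hR[OF i(1), of "1 + k"] r i(2) by (simp add: B_B)
      ultimately show False using m_not_dvd_1 by (simp add: dvd_add_left_iff)
    next
      case False
      then have "x \<in> F" using x(1) by (auto simp: F'_def)
      moreover have "x \<in> Range T" using x(2) new False by blast
      moreover have "\<forall>i\<in>J. B 1 x \<notin> orb (h i)" using False by simp
      then have "B 1 x \<in> Range T" using r new by blast
      ultimately show False using F3 by blast
    qed
  qed
  moreover have "\<forall>x\<in>F'. orb x \<subseteq> F'" using F1 orb_eq unfolding F'_def by blast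
  ultimately have "funnel ?T F'" using fwd unfolding funnel_def by blast
  moreover have "\<forall>i\<in>I. \<exists>y. (f i, y) \<in> ?T"
  proof
    fix i assume i: "i \<in> I"
    show "\<exists>y. (f i, y) \<in> ?T"
    proof (cases "i \<in> J")
      case True then show ?thesis unfolding ext_iff by (metis B_zero mult_zero_right)
    next
      case False then show ?thesis using i by (auto simp: J_def ext_iff)
    qed
  qed
  from bchoice[OF this] obtain g where g: "\<forall>i\<in>I. (f i, g i) \<in> ?T" by blast
  moreover have "\<forall>x y. (x, y) \<in> ?T \<longrightarrow> (x, y) \<in> T \<or> y \<in> F'" using new by (auto simp: F'_def)
  moreover have "F \<subseteq> F'" by (auto simp: F'_def)
  ultimately show ?thesis using C sub_ext[of T J f h] by (intro exI[of _ ?T] exI[of _ F'] exI[of _ g] conjI)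
qed

fun exits :: "('x \<times> 'x) set \<Rightarrow> 'x \<Rightarrow> int list \<Rightarrow> bool" where
  "exits T y [] \<longleftrightarrow> False"
| "exits T y (j # js) \<longleftrightarrow> B j y \<notin> Domain T \<or> (\<exists>z. (B j y, z) \<in> T \<and> exits T z js)"

lemma exits_ex:
  assumes T: "cond T" and S: "0 \<notin> S \<or> S = {0} \<and> \<bar>m\<bar> \<le> \<bar>n\<bar>"
  shows "\<exists>js. exits T y js"
proof (rule ccontr)
  define C where "C = {z. \<forall>js. \<not> exits T z js}"
  assume "\<not> ?thesis"
  then have 1: "C \<noteq> {}" by (auto simp: C_def)
  have 2: "\<forall>x\<in>C. orb x \<subseteq> C"
  proof (intro ballI subsetI)
    fix x y assume x: "x \<in> C" and "y \<in> orb x"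
    then obtain k where y: "y = B k x" by (auto simp: orb_iff)
    show "y \<in> C" unfolding C_def
    proof (intro CollectI allI)
      fix js show "\<not> exits T y js"
      proof (cases js)
        case (Cons j js')
        have "exits T y js \<longleftrightarrow> exits T x ((j + k) # js')" by (simp add: Cons y B_B)
        then show ?thesis using x unfolding C_def by blast
      qed simp
    qed
  qed
  have 3: "C \<subseteq> Domain T"
  proof
    fix x assume "x \<in> C"
    then have "\<not> exits T x [0]" unfolding C_def by blast
    then show "x \<in> Domain T" by (auto simp: B_zero)
  qed
  have 4: "T `` C \<subseteq> C"
  proof
    fix y assume "y \<in> T `` C"
    then obtain x where x: "x \<in> C" "(x, y) \<in> T" by blast
    have "\<not> exits T y js" for js
    proof
      assume "exits T y js"
      then have "exits T x (0 # js)" using x by (auto simp: B_zero)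
      then show False using x(1) unfolding C_def by blast
    qed
    then show "y \<in> C" by (simp add: C_def)
  qed
  show False using dom_unsat[OF T S 1 2 3 4] .
qed

lemma funnel_word:
  assumes I: "finite I"
  shows "cond T \<Longrightarrow> funnel T F \<Longrightarrow> T0 \<subseteq> T \<Longrightarrow> (\<forall>x y. (x, y) \<in> T \<longrightarrow> (x, y) \<in> T0 \<or> y \<in> F) \<Longrightarrow>
    \<exists>T' F' g. reach I T f T' g \<and> F \<subseteq> F' \<and> funnel T' F' \<and> (\<forall>i\<in>I. f i \<in> F \<longrightarrow> g i \<in> F') \<and>
      (\<forall>i\<in>I. exits T0 (f i) js \<longrightarrow> g i \<in> F')"
proof (induction js arbitrary: T F f)
  case Nil
  then show ?case using reach_refl by (intro exI[of _ T] exI[of _ F] exI[of _ f]) auto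
next
  case (Cons j js)
  from funnel_move[OF Cons.prems(1,2) I, of "\<lambda>i. B j (f i)"]
  obtain T1 F1 g1 where 1: "T \<subseteq> T1" "cond T1" "F \<subseteq> F1" "funnel T1 F1" "\<forall>i\<in>I. (B j (f i), g1 i) \<in> T1"
    "\<forall>x y. (x, y) \<in> T1 \<longrightarrow> (x, y) \<in> T \<or> y \<in> F1" by (elim exE conjE) (assumption | simp)+
  have new: "\<forall>x y. (x, y) \<in> T1 \<longrightarrow> (x, y) \<in> T0 \<or> y \<in> F1" using 1(3,6) Cons.prems(4) by blast
  have sub: "T0 \<subseteq> T1" using 1(1) Cons.prems(3) by blast
  from Cons.IH[OF 1(2,4) sub new, of g1] obtain T' F' g where 2: "reach I T1 g1 T' g" "F1 \<subseteq> F'" "funnel T' F'"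
    "\<forall>i\<in>I. g1 i \<in> F1 \<longrightarrow> g i \<in> F'" "\<forall>i\<in>I. exits T0 (g1 i) js \<longrightarrow> g i \<in> F'"
    by (elim exE conjE) (assumption | simp)+
  have "reach I T f T (\<lambda>i. B j (f i))" using reach_shift Cons.prems(1) .
  moreover have "reach I T (\<lambda>i. B j (f i)) T1 g1" using reach_t[OF 1(1,2,5)] .
  ultimately have r: "reach I T f T' g" using 2(1) reach_trans by blast
  have F1: "\<forall>x\<in>F1. orb x \<subseteq> F1" "T1 `` F1 \<subseteq> F1" using 1(4) by (auto simp: funnel_def)
  have a: "\<forall>i\<in>I. f i \<in> F \<longrightarrow> g i \<in> F'"
  proof (intro ballI impI)
    fix i assume i: "i \<in> I" "f i \<in> F"
    then have "B j (f i) \<in> F1" using F1(1) 1(3) B_in_orb by blast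
    then have "g1 i \<in> F1" using F1(2) 1(5) i by blast
    then show "g i \<in> F'" using 2(4) i by blast
  qed
  have b: "\<forall>i\<in>I. exits T0 (f i) (j # js) \<longrightarrow> g i \<in> F'"
  proof (intro ballI impI)
    fix i assume i: "i \<in> I" "exits T0 (f i) (j # js)"
    then consider "B j (f i) \<notin> Domain T0" | z where "(B j (f i), z) \<in> T0" "exits T0 z js" by auto
    then show "g i \<in> F'"
    proof cases
      case 1
      then have "g1 i \<in> F1" using new \<open>\<forall>i\<in>I. (B j (f i), g1 i) \<in> T1\<close> i by blast
      then show ?thesis using 2(4) i by blast
    next
      case z: 2
      have "z = g1 i" using piso_sv[OF cond_piso[OF 1(2)]] 1(5) i z(1) sub by blast
      then show ?thesis using 2(5) i z by blast
    qed
  qed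
  show ?case using r 1(3) 2(2,3) a b by (intro exI[of _ T'] exI[of _ F'] exI[of _ g]) blast
qed

lemma funnel_all:
  assumes T: "cond T" and S: "0 \<notin> S \<or> S = {0} \<and> \<bar>m\<bar> \<le> \<bar>n\<bar>" and I: "finite I" and J: "finite J" "J \<subseteq> I"
  shows "\<exists>T' F g. reach I T f T' g \<and> funnel T' F \<and> (\<forall>j\<in>J. g j \<in> F)"
  using J
proof (induction J rule: finite_induct)
  case empty
  have "funnel T {}" by (simp add: funnel_def)
  then show ?case using reach_refl[OF T] by blast
next
  case (insert j J)
  then obtain T1 F1 g1 where 1: "reach I T f T1 g1" "funnel T1 F1" "\<forall>j\<in>J. g1 j \<in> F1" by auto
  have c: "cond T1" using 1(1) by (rule reach_cond)
  obtain js where js: "exits T1 (g1 j) js" using exits_ex[OF c S] by blast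
  from funnel_word[OF I c 1(2) subset_refl, of g1 js] obtain T' F' g where 2: "reach I T1 g1 T' g" "funnel T' F'"
    "\<forall>i\<in>I. g1 i \<in> F1 \<longrightarrow> g i \<in> F'" "\<forall>i\<in>I. exits T1 (g1 i) js \<longrightarrow> g i \<in> F'"
    by (auto simp del: exits.simps)
  have "\<forall>i\<in>insert j J. g i \<in> F'" using 2(3,4) js 1(3) insert.prems by blast
  then show ?case using reach_trans[OF 1(1) 2(1)] 2(2) by blast
qed

lemma exit_all:
  assumes T: "cond T" and S: "0 \<notin> S \<or> S = {0} \<and> \<bar>m\<bar> \<le> \<bar>n\<bar>" and I: "finite I"
  shows "\<exists>T' g. reach I T f T' g \<and> (\<forall>i\<in>I. B 1 (g i) \<notin> Range T')"
proof -
  obtain T1 F1 g1 where 1: "reach I T f T1 g1" "funnel T1 F1" "\<forall>j\<in>I. g1 j \<in> F1"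
    using funnel_all[OF T S I I subset_refl, of f] by auto
  from funnel_move[OF reach_cond[OF 1(1)] 1(2) I, of g1]
  obtain T' F' g where 2: "T1 \<subseteq> T'" "cond T'" "F1 \<subseteq> F'" "funnel T' F'" "\<forall>i\<in>I. (g1 i, g i) \<in> T'"
    by (elim exE conjE) (assumption | simp)+
  have "B 1 (g i) \<notin> Range T'" if i: "i \<in> I" for i
  proof -
    have gi: "(g1 i, g i) \<in> T'" using 2(5) i by blast
    have "g1 i \<in> F'" using 1(3) 2(3) i by blast
    then have "g i \<in> F'" using 2(4) gi unfolding funnel_def by blast
    then show ?thesis using 2(4) gi unfolding funnel_def by blast
  qed
  then show ?thesis using reach_trans[OF 1(1) reach_t[OF 2(1,2,5)]] by blast
qed

definition leaves :: "'i set \<Rightarrow> ('x \<times> 'x) set \<Rightarrow> ('i \<Rightarrow> 'x) \<Rightarrow> bool" where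
  "leaves I T f \<longleftrightarrow> (\<forall>i\<in>I. (\<forall>k. B k (f i) \<notin> Domain T) \<and> B 1 (f i) \<notin> Range T)"

lemma leaves_notin: "leaves I T f \<Longrightarrow> \<forall>i\<in>I. f i \<notin> Domain T"
  unfolding leaves_def by (metis B_zero)

lemma out_default:
  assumes T: "cond T" and I: "finite I" and f: "\<forall>i\<in>I. f i \<notin> Domain T"
  shows "\<exists>T' g. reach I T f T' g \<and> finer I f g \<and> leaves I T' g \<and> (\<forall>i\<in>I. sz (g i) = edge_size m n (sz (f i))) \<and>
    (\<forall>i\<in>I. \<forall>j\<in>I. g j \<in> orb (g i) \<longrightarrow> (\<exists>a. f j = B (n * a) (f i) \<and> g j = B (m * a) (g i)))"
proof -
  from out_step[OF T I finite.emptyI f S_edge_size] obtain T' g where 1: "reach I T f T' g" "finer I f g"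
    "\<forall>i\<in>I. sz (g i) = edge_size m n (sz (f i))" "\<forall>i\<in>I. \<forall>k. B k (g i) \<notin> Domain T'"
    "\<forall>i\<in>I. m dvd int (edge_size m n (sz (f i))) \<longrightarrow> (\<forall>k. B k (g i) \<in> Range T' \<longrightarrow> m dvd k)"
    "\<forall>i\<in>I. \<forall>j\<in>I. g j \<in> orb (g i) \<longrightarrow> (\<exists>a. f j = B (n * a) (f i) \<and> g j = B (m * a) (g i))"
    by (elim exE conjE) (assumption | simp)+
  have "leaves I T' g" unfolding leaves_def using 1(4,5) dvd_edge_size m_not_dvd_1 by blast
  then show ?thesis using 1 by blast
qed

lemma in_default:
  assumes T: "cond T" and I: "finite I" and f: "\<forall>i\<in>I. f i \<notin> Range T"
  shows "\<exists>T' g. reach I T f T' g \<and> finer I f g \<and> leaves I (T'\<inverse>) g \<and> (\<forall>i\<in>I. sz (g i) = edge_size n m (sz (f i))) \<and>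
    (\<forall>i\<in>I. \<forall>j\<in>I. g j \<in> orb (g i) \<longrightarrow> (\<exists>a. f j = B (m * a) (f i) \<and> g j = B (n * a) (g i)))"
proof -
  have T': "orbit_system.cond B n m (T\<inverse>)" using T by (simp add: cond_dual)
  have f': "\<forall>i\<in>I. f i \<notin> Domain (T\<inverse>)" using f by simp
  from orbit_system.out_default[OF dual T' I f'] obtain U g where U:
    "orbit_system.reach B n m I (T\<inverse>) f U g" "finer I f g" "leaves I U g" "\<forall>i\<in>I. sz (g i) = edge_size n m (sz (f i))"
    "\<forall>i\<in>I. \<forall>j\<in>I. g j \<in> orb (g i) \<longrightarrow> (\<exists>a. f j = B (m * a) (f i) \<and> g j = B (n * a) (g i))"
    by (elim exE conjE) (assumption | simp)+
  have "reach I T f (U\<inverse>) g" using U(1) reach_dual[of I T f "U\<inverse>" g] by simp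
  then show ?thesis using U(2-) by (intro exI[of _ "U\<inverse>"] exI[of _ g]) simp
qed

lemma turn_in:
  assumes T: "cond T" and I: "finite I" and f: "\<forall>i\<in>I. B 1 (f i) \<notin> Range T"
  shows "\<exists>T' g. reach I T f T' g \<and> finer I f g \<and> leaves I (T'\<inverse>) g \<and> (\<forall>i\<in>I. sz (g i) = edge_size n m (sz (f i)))"
proof -
  from in_default[OF T I f] obtain T' g where 1: "reach I T (\<lambda>i. B 1 (f i)) T' g" "finer I (\<lambda>i. B 1 (f i)) g"
    "leaves I (T'\<inverse>) g" "\<forall>i\<in>I. sz (g i) = edge_size n m (sz (f i))"
    by auto
  show ?thesis using reach_trans[OF reach_shift[OF T] 1(1)] finer_trans[OF finer_shift 1(2)] 1(3,4) by blast
qed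

lemma turn_out:
  assumes T: "cond T" and I: "finite I" and f: "\<forall>i\<in>I. B 1 (f i) \<notin> Domain T"
  shows "\<exists>T' g. reach I T f T' g \<and> finer I f g \<and> leaves I T' g \<and> (\<forall>i\<in>I. sz (g i) = edge_size m n (sz (f i)))"
proof -
  from out_default[OF T I f] obtain T' g where 1: "reach I T (\<lambda>i. B 1 (f i)) T' g" "finer I (\<lambda>i. B 1 (f i)) g"
    "leaves I T' g" "\<forall>i\<in>I. sz (g i) = edge_size m n (sz (f i))"
    by auto
  show ?thesis using reach_trans[OF reach_shift[OF T] 1(1)] finer_trans[OF finer_shift 1(2)] 1(3,4) by blast
qed

lemma leaves_ex:
  assumes T: "cond T" and S: "0 \<notin> S \<or> S = {0} \<and> \<bar>m\<bar> \<le> \<bar>n\<bar>" and I: "finite I"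
  shows "\<exists>T' g. reach I T f T' g \<and> leaves I T' g"
proof -
  obtain T1 g1 where 1: "reach I T f T1 g1" "\<forall>i\<in>I. B 1 (g1 i) \<notin> Range T1" using exit_all[OF T S I] by blast
  obtain T2 g2 where 2: "reach I T1 g1 T2 g2" "leaves I (T2\<inverse>) g2" using turn_in[OF reach_cond[OF 1(1)] I 1(2)] by blast
  have "\<forall>i\<in>I. B 1 (g2 i) \<notin> Domain T2" using 2(2) by (auto simp: leaves_def)
  then obtain T3 g3 where 3: "reach I T2 g2 T3 g3" "leaves I T3 g3" using turn_out[OF reach_cond[OF 2(1)] I] by blast
  show ?thesis using reach_trans[OF reach_trans[OF 1(1) 2(1)] 3(1)] 3(2) by blast
qed

end

lemma sep_arith:
  fixes P n m k a :: int and N s u v :: nat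
  assumes P: "prime P" and n: "n = P ^ u * n'" "\<not> P dvd n'" and m: "m = P ^ v * m'" "\<not> P dvd m'" "n \<noteq> 0"
    and N: "P ^ s dvd int N" and k: "\<not> P ^ s dvd k" and a: "int N dvd k - n * a" and uv: "v < u \<or> s \<le> u"
  shows "v < u \<and> s > u \<and> P ^ (s - (u - v)) dvd int (edge_size m n N) \<and> \<not> P ^ (s - (u - v)) dvd m * a"
proof -
  have na: "\<not> P ^ s dvd n * a"
  proof
    assume "P ^ s dvd n * a"
    moreover have "P ^ s dvd k - n * a" using N a dvd_trans by blast
    ultimately have "P ^ s dvd (k - n * a) + n * a" by (rule dvd_add[rotated])
    then show False using k by simp
  qed
  have su: "u < s"
  proof (rule ccontr)
    assume "\<not> u < s"
    then have "P ^ s dvd P ^ u" by (simp add: le_imp_power_dvd)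
    then show False using na n(1) by (simp add: dvd_mult2)
  qed
  then have vu: "v < u" using uv by auto
  define K where "K = int (N div gcd N (nat \<bar>n\<bar>))"
  have s: "s = u + (s - u)" "s - (u - v) = v + (s - u)" using su vu by auto
  have P0: "P \<noteq> 0" using P by auto
  have cop: "coprime (P ^ (s - u)) n'" "coprime (P ^ (s - u)) m'"
    using P n(2) m(2) prime_imp_coprime coprime_power_left_iff by blast+
  have "int N dvd n * K" unfolding K_def dvd_mult_iff_div_gcd[OF m(3)] by simp
  then have "P ^ u * P ^ (s - u) dvd P ^ u * (n' * K)"
    using N dvd_trans s(1) by (metis mult.assoc n(1) power_add)
  then have "P ^ (s - u) dvd n' * K" using P0 by simp
  then have K: "P ^ (s - u) dvd K" using cop(1) by (simp add: coprime_dvd_mult_right_iff)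
  have c: "int (edge_size m n N) = \<bar>m\<bar> * K" by (simp add: edge_size_def K_def)
  have "P ^ v dvd \<bar>m\<bar>" using m(1) by simp
  then have 1: "P ^ (s - (u - v)) dvd int (edge_size m n N)" unfolding s(2) c power_add using K by (rule mult_dvd_mono)
  have 2: "\<not> P ^ (s - (u - v)) dvd m * a"
  proof
    assume "P ^ (s - (u - v)) dvd m * a"
    then have "P ^ v * P ^ (s - u) dvd P ^ v * (m' * a)" unfolding s(2) power_add m(1) by (simp add: mult.assoc)
    then have "P ^ (s - u) dvd m' * a" using P0 by simp
    then have "P ^ (s - u) dvd a" using cop(2) by (simp add: coprime_dvd_mult_right_iff)
    then have "P ^ u * P ^ (s - u) dvd P ^ u * (n' * a)" by (intro mult_dvd_mono) auto
    then have "P ^ s dvd n * a" using s(1) by (metis mult.assoc n(1) power_add)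
    then show False using na by blast
  qed
  show ?thesis using 1 2 su vu by blast
qed

definition separable :: "int \<Rightarrow> int \<Rightarrow> nat set \<Rightarrow> bool" where
  "separable m n S \<longleftrightarrow> (\<forall>N\<in>S. \<forall>k. \<not> int N dvd k \<longrightarrow>
     (\<exists>P s u v n' m'. prime P \<and> P ^ s dvd int N \<and> \<not> P ^ s dvd k \<and>
        n = P ^ u * n' \<and> \<not> P dvd n' \<and> m = P ^ v * m' \<and> \<not> P dvd m' \<and> (u = v \<longrightarrow> s \<le> u)))"

context orbit_system
begin

lemma pact_inj: "single_valued T \<Longrightarrow> single_valued (T\<inverse>) \<Longrightarrow> pact B T w x z \<Longrightarrow> pact B T w y z \<Longrightarrow> x = y"
proof (induction w arbitrary: x y)
  case (Cons a w)
  then obtain x' y' where 1: "lstep B T a x x'" "pact B T w x' z" "lstep B T a y y'" "pact B T w y' z" by auto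
  then have e: "x' = y'" using Cons by blast
  obtain g s where a: "a = (g, s)" by force
  show ?case
  proof (cases g)
    case Bg
    then have "B (if s then - 1 else 1) x = B (if s then - 1 else 1) y" using 1 e a by simp
    then show ?thesis by (metis B_swap)
  next
    case Tg
    then show ?thesis using 1(1,3) e a Cons.prems(1,2)
      by (auto split: if_splits simp: single_valued_def)
  qed
qed simp

lemma pact_sv: "single_valued T \<Longrightarrow> single_valued (T\<inverse>) \<Longrightarrow> pact B T w x y \<Longrightarrow> pact B T w x z \<Longrightarrow> y = z"
proof (induction w arbitrary: x)
  case (Cons a w)
  then obtain y' z' where 1: "lstep B T a x y'" "pact B T w y' y" "lstep B T a x z'" "pact B T w z' z" by auto
  obtain g s where a: "a = (g, s)" by force
  have "y' = z'"
  proof (cases g)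
    case Bg then show ?thesis using 1 a by simp
  next
    case Tg
    then show ?thesis using 1(1,3) a Cons.prems(1,2)
      by (auto split: if_splits simp: single_valued_def)
  qed
  then show ?case using Cons 1 by blast
qed simp

lemma reach_inj: "reach I T f T' g \<Longrightarrow> inj_on f I \<Longrightarrow> inj_on g I"
proof (rule inj_onI)
  fix i j assume r: "reach I T f T' g" and f: "inj_on f I" and ij: "i \<in> I" "j \<in> I" "g i = g j"
  obtain w where w: "\<forall>i\<in>I. pact B T' w (f i) (g i)" using r by (auto simp: reach_def)
  have "piso T'" using cond_piso[OF reach_cond[OF r]] .
  then have sv: "single_valued T'" "single_valued (T'\<inverse>)" by (auto simp: piso_def)
  have "pact B T' w (f i) (g i)" "pact B T' w (f j) (g i)" using bspec[OF w ij(1)] bspec[OF w ij(2)] ij(3) by simp_all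
  then have "f i = f j" using pact_inj[OF sv] by blast
  then show "i = j" using f ij by (meson inj_onD)
qed

lemma sep_out:
  assumes I: "finite I" and ij: "i \<in> I" "j \<in> I" and P: "prime (P :: int)"
    and n: "n = P ^ u * n'" "\<not> P dvd n'" and m: "m = P ^ v * m'" "\<not> P dvd m'"
  shows "cond T \<Longrightarrow> \<forall>i\<in>I. f i \<notin> Domain T \<Longrightarrow> f j = B k (f i) \<Longrightarrow> P ^ s dvd int (sz (f i)) \<Longrightarrow> \<not> P ^ s dvd k \<Longrightarrow>
    v < u \<or> s \<le> u \<Longrightarrow> \<exists>T' g. reach I T f T' g \<and> finer I f g \<and> leaves I T' g \<and> g j \<notin> orb (g i)"
proof (induction s arbitrary: T f k rule: less_induct)
  case (less s)
  from out_default[OF less.prems(1) I less.prems(2)] obtain T1 g1 where 1: "reach I T f T1 g1" "finer I f g1" "leaves I T1 g1"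
    "\<forall>i\<in>I. sz (g1 i) = edge_size m n (sz (f i))"
    "\<forall>i\<in>I. \<forall>j\<in>I. g1 j \<in> orb (g1 i) \<longrightarrow> (\<exists>a. f j = B (n * a) (f i) \<and> g1 j = B (m * a) (g1 i))"
    by (elim exE conjE) (assumption | simp)+
  show ?case
  proof (cases "g1 j \<in> orb (g1 i)")
    case False then show ?thesis using 1 by blast
  next
    case True
    then obtain a where a: "f j = B (n * a) (f i)" "g1 j = B (m * a) (g1 i)" using 1(5) ij by blast
    then have "int (sz (f i)) dvd k - n * a" using less.prems(3) by (simp add: B_eq)
    from sep_arith[OF P n m n0 less.prems(4,5) this less.prems(6)]
    have A: "v < u" "s > u" "P ^ (s - (u - v)) dvd int (edge_size m n (sz (f i)))" "\<not> P ^ (s - (u - v)) dvd m * a" by auto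
    have "s - (u - v) < s" using A by simp
    moreover have "\<forall>i\<in>I. g1 i \<notin> Domain T1" using leaves_notin[OF 1(3)] .
    moreover have "P ^ (s - (u - v)) dvd int (sz (g1 i))" using A(3) 1(4) ij by simp
    ultimately obtain T' g where "reach I T1 g1 T' g" "finer I g1 g" "leaves I T' g" "g j \<notin> orb (g i)"
      using less.IH[of "s - (u - v)" T1 g1 "m * a"] reach_cond[OF 1(1)] a(2) A(1,4) by blast
    then show ?thesis using reach_trans[OF 1(1)] finer_trans[OF 1(2)] by blast
  qed
qed

lemma separate_pair:
  assumes T: "cond T" and I: "finite I" and ij: "i \<in> I" "j \<in> I" and f: "leaves I T f" "f i \<noteq> f j"
    and S: "separable m n S"
  shows "\<exists>T' g. reach I T f T' g \<and> finer I f g \<and> leaves I T' g \<and> g j \<notin> orb (g i)"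
proof (cases "f j \<in> orb (f i)")
  case False
  then show ?thesis using reach_refl[OF T] finer_refl f by blast
next
  case True
  then obtain k where k: "f j = B k (f i)" by (auto simp: orb_iff)
  have "\<not> int (sz (f i)) dvd k" using f(2) k B_fix by metis
  then obtain P s u v n' m' where P: "prime P" "P ^ s dvd int (sz (f i))" "\<not> P ^ s dvd k"
    "n = P ^ u * n'" "\<not> P dvd n'" "m = P ^ v * m'" "\<not> P dvd m'" "u = v \<longrightarrow> s \<le> u"
    using S sz_in[of "f i"] unfolding separable_def by blast
  show ?thesis
  proof (cases "v < u \<or> s \<le> u")
    case True
    then show ?thesis using sep_out[OF I ij P(1,4,5,6,7) T leaves_notin[OF f(1)] k P(2,3)] by blast
  next
    case False
    then have uv: "u < v \<or> s \<le> v" using P(8) by auto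
    let ?f = "\<lambda>i. B 1 (f i)"
    have c: "orbit_system.cond B n m (T\<inverse>)" using T by (simp add: cond_dual)
    have d: "\<forall>i\<in>I. ?f i \<notin> Domain (T\<inverse>)" using f(1) by (auto simp: leaves_def)
    have e: "?f j = B k (?f i)" by (simp add: k B_B add.commute)
    have g: "P ^ s dvd int (sz (?f i))" using P(2) by simp
    from orbit_system.sep_out[OF dual I ij P(1,6,7,4,5) c d e g P(3) uv]
    obtain U g where U: "orbit_system.reach B n m I (T\<inverse>) ?f U g" "finer I ?f g" "leaves I U g" "g j \<notin> orb (g i)"
      by blast
    have r: "reach I T ?f (U\<inverse>) g" using U(1) reach_dual[of I T ?f "U\<inverse>" g] by simp
    have "\<forall>i\<in>I. B 1 (g i) \<notin> Domain (U\<inverse>)" using U(3) by (auto simp: leaves_def)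
    then obtain T2 g2 where 2: "reach I (U\<inverse>) g T2 g2" "finer I g g2" "leaves I T2 g2"
      using turn_out[OF reach_cond[OF r] I] by blast
    have "g2 j \<notin> orb (g2 i)" using 2(2) U(4) ij by (auto simp: finer_def)
    then show ?thesis
      using reach_trans[OF reach_shift[OF T] reach_trans[OF r 2(1)]] 2(3)
        finer_trans[OF finer_shift finer_trans[OF U(2) 2(2)]] by blast
  qed
qed

lemma separate_all:
  assumes I: "finite I" and S: "separable m n S"
  shows "cond T \<Longrightarrow> leaves I T f \<Longrightarrow> inj_on f I \<Longrightarrow>
    \<exists>T' g. reach I T f T' g \<and> leaves I T' g \<and> (\<forall>i\<in>I. \<forall>j\<in>I. i \<noteq> j \<longrightarrow> g j \<notin> orb (g i))"
proof (induction "card {(i, j). i \<in> I \<and> j \<in> I \<and> i \<noteq> j \<and> f j \<in> orb (f i)}" arbitrary: T f rule: less_induct)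
  case less
  let ?D = "\<lambda>f. {(i, j). i \<in> I \<and> j \<in> I \<and> i \<noteq> j \<and> f j \<in> orb (f i)}"
  show ?case
  proof (cases "?D f = {}")
    case True
    then show ?thesis using reach_refl[OF less.prems(1)] less.prems(2) by blast
  next
    case False
    then obtain i j where ij: "i \<in> I" "j \<in> I" "i \<noteq> j" "f j \<in> orb (f i)" by blast
    have "f i \<noteq> f j" using ij less.prems(3) by (meson inj_onD)
    then obtain T1 g1 where 1: "reach I T f T1 g1" "finer I f g1" "leaves I T1 g1" "g1 j \<notin> orb (g1 i)"
      using separate_pair[OF less.prems(1) I ij(1,2) less.prems(2) _ S] by blast
    have "?D g1 \<subset> ?D f"
    proof
      show "?D g1 \<subseteq> ?D f" using 1(2) unfolding finer_def by blast
      show "?D g1 \<noteq> ?D f" using ij 1(4) by blast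
    qed
    moreover have "finite (?D f)" by (rule finite_subset[of _ "I \<times> I"]) (use I in auto)
    ultimately have "card (?D g1) < card (?D f)" by (rule psubset_card_mono[rotated])
    from less.hyps[OF this reach_cond[OF 1(1)] 1(3) reach_inj[OF 1(1) less.prems(3)]]
    show ?thesis using reach_trans[OF 1(1)] by blast
  qed
qed

end

section \<open>Making orbit lengths equal\<close>

definition winv :: "word \<Rightarrow> word" where
  "winv w = rev (map (\<lambda>(g, s). (g, \<not> s)) w)"

lemma gcd_mult_cancel_div:
  fixes K a g :: nat assumes "g > 0"
  shows "K * g div gcd (K * g) (a * g) = K div gcd K a"
  using assms by (simp add: gcd_mult_distrib_nat[symmetric] mult.commute[of _ g])

lemma power_part_bound:
  fixes K a :: nat assumes "K > 0"
  shows "\<exists>r. coprime r a \<and> K dvd r * a ^ K"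
  using assms
proof (induction K rule: less_induct)
  case (less K)
  show ?case
  proof (cases "coprime K a")
    case True then show ?thesis by (intro exI[of _ K]) simp
  next
    case False
    define d where "d = gcd K a"
    define K0 where "K0 = K div d"
    have d: "d \<noteq> 1" "d dvd K" "d dvd a" using False by (auto simp: d_def coprime_iff_gcd_eq_1)
    have K: "K = d * K0" using d(2) by (simp add: K0_def)
    then have K0: "K0 > 0" "d > 0" using less.prems by auto
    then have lt: "K0 < K" using d(1) K by simp
    obtain r where r: "coprime r a" "K0 dvd r * a ^ K0" using less.IH[OF lt K0(1)] by blast
    have "d * K0 dvd a * (r * a ^ K0)" using d(3) r(2) by (rule mult_dvd_mono)
    also have "a * (r * a ^ K0) = r * a ^ Suc K0" by simp
    also have "r * a ^ Suc K0 dvd r * a ^ K" using lt by (intro mult_dvd_mono le_imp_power_dvd) auto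
    finally show ?thesis using r(1) K by blast
  qed
qed

lemma power_part_step:
  fixes K a c r s :: nat
  assumes "K > 0" "coprime r a" "coprime c a" "K dvd r * a ^ Suc s"
  shows "c * (K div gcd K a) dvd (c * r) * a ^ s" "coprime (c * r) a"
proof -
  define d where "d = gcd K a"
  define K0 where "K0 = K div d"
  define a0 where "a0 = a div d"
  have d0: "d > 0" using assms(1) by (simp add: d_def)
  have K: "K = d * K0" and a: "a = d * a0" by (simp_all add: K0_def a0_def d_def)
  have cop: "coprime K0 a0" unfolding K0_def a0_def d_def using assms(1) by (intro div_gcd_coprime) auto
  have "d * K0 dvd d * (a0 * (r * a ^ s))" using assms(4) K a by (metis mult.assoc mult.left_commute power_Suc)
  then have "K0 dvd a0 * (r * a ^ s)" using d0 by simp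
  then have "K0 dvd r * a ^ s" using cop by (simp add: coprime_dvd_mult_right_iff)
  then show "c * (K div gcd K a) dvd (c * r) * a ^ s"
    by (simp add: K0_def d_def mult.assoc)
  show "coprime (c * r) a" using assms by simp
qed

context orbit_system
begin

definition mm :: nat where "mm = nat \<bar>m\<bar>"
definition nn :: nat where "nn = nat \<bar>n\<bar>"
definition mc :: nat where "mc = mm div gcd mm nn"
definition na :: nat where "na = nn div gcd mm nn"
definition kn :: "nat \<Rightarrow> nat" where "kn N = N div gcd N nn"
definition km :: "nat \<Rightarrow> nat" where "km N = N div gcd N mm"

lemma mm0: "mm > 0" and nn0: "nn > 0" using m2 n2 by (auto simp: mm_def nn_def)

lemma mn_gcd: "mm = mc * gcd mm nn" "nn = na * gcd mm nn" "coprime mc na"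
  unfolding mc_def na_def using mm0 by (simp_all add: div_gcd_coprime)

lemma g0: "gcd mm nn > 0" using mm0 by simp

lemma edge_size_kn: "edge_size m n N = mm * kn N" by (simp only: edge_size_def mm_def kn_def nn_def)
lemma edge_size_km: "edge_size n m N = nn * km N" by (simp only: edge_size_def mm_def km_def nn_def)

lemma kn_mm: "kn (mm * K) = mc * (K div gcd K na)"
proof -
  have "mm * K = (mc * K) * gcd mm nn" using mn_gcd(1) by (metis mult.assoc mult.commute)
  then have "kn (mm * K) = (mc * K) div gcd (mc * K) na"
    unfolding kn_def using gcd_mult_cancel_div[OF g0, of "mc * K" na] mn_gcd(2) by metis
  also have "gcd (mc * K) na = gcd K na" using mn_gcd(3) by (simp add: gcd_mult_left_left_cancel coprime_commute)
  finally show ?thesis by (simp add: div_mult_swap)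
qed

lemma km_mm: "km (mm * K) = K" unfolding km_def using mm0 by (simp add: gcd_mult_left)

lemma kn_nn: "kn (nn * K) = K" unfolding kn_def using nn0 by (simp add: gcd_mult_left)

lemma km_g: "km (K * gcd mm nn) = K div gcd K mc"
  unfolding km_def using gcd_mult_cancel_div[OF g0, of K mc] mn_gcd(1) by metis

lemma kn_g: "kn (K * gcd mm nn) = K div gcd K na"
  unfolding kn_def using gcd_mult_cancel_div[OF g0, of K na] mn_gcd(2) by metis

lemma kn_pos: "N > 0 \<Longrightarrow> kn N > 0" unfolding kn_def by (simp add: div_greater_zero_iff dvd_imp_le)
lemma km_pos: "N > 0 \<Longrightarrow> km N > 0" unfolding km_def by (simp add: div_greater_zero_iff dvd_imp_le)

lemma norm_out:
  assumes I: "finite I" and S: "0 \<notin> S"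
  shows "cond T \<Longrightarrow> leaves I T f \<Longrightarrow> \<forall>i\<in>I. \<exists>r. coprime r na \<and> kn (sz (f i)) dvd r * na ^ s \<Longrightarrow>
    \<exists>T' g. reach I T f T' g \<and> finer I f g \<and> leaves I T' g \<and> (\<forall>i\<in>I. coprime (kn (sz (g i))) na)"
proof (induction s arbitrary: T f)
  case 0
  have "coprime (kn (sz (f i))) na" if "i \<in> I" for i
  proof -
    obtain r where "coprime r na" "kn (sz (f i)) dvd r" using 0(3) \<open>i \<in> I\<close> by auto
    then show ?thesis by (meson coprime_divisors dvd_refl)
  qed
  then show ?case using reach_refl[OF 0(1)] finer_refl 0(2) by blast
next
  case (Suc s)
  from out_default[OF Suc.prems(1) I leaves_notin[OF Suc.prems(2)]] obtain T1 g1 where 1: "reach I T f T1 g1"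
    "finer I f g1" "leaves I T1 g1" "\<forall>i\<in>I. sz (g1 i) = edge_size m n (sz (f i))" by blast
  have "\<forall>i\<in>I. \<exists>r. coprime r na \<and> kn (sz (g1 i)) dvd r * na ^ s"
  proof
    fix i assume i: "i \<in> I"
    obtain r where r: "coprime r na" "kn (sz (f i)) dvd r * na ^ Suc s" using Suc.prems(3) i by blast
    have "sz (f i) > 0" using S sz_in by (metis bot_nat_0.not_eq_extremum)
    from power_part_step[OF kn_pos[OF this] r(1) mn_gcd(3) r(2)]
    have "kn (sz (g1 i)) dvd (mc * r) * na ^ s" "coprime (mc * r) na"
      using 1(4) i by (simp_all add: edge_size_kn kn_mm)
    then show "\<exists>r. coprime r na \<and> kn (sz (g1 i)) dvd r * na ^ s" by blast
  qed
  from Suc.IH[OF reach_cond[OF 1(1)] 1(3) this] show ?case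
    using reach_trans[OF 1(1)] finer_trans[OF 1(2)] by blast
qed

lemma norm_in:
  assumes I: "finite I" and S: "0 \<notin> S"
    and ph: "\<forall>N\<in>S. \<forall>p. prime p \<longrightarrow> p dvd km N \<longrightarrow> p dvd na \<or> p dvd mc"
  shows "cond T \<Longrightarrow> \<forall>i\<in>I. f i \<notin> Range T \<Longrightarrow> \<forall>i\<in>I. coprime (km (sz (f i))) na \<Longrightarrow> \<forall>i\<in>I. km (sz (f i)) \<le> Suc s \<Longrightarrow>
    \<exists>T' g. reach I T f T' g \<and> finer I f g \<and> (\<forall>i\<in>I. g i \<notin> Range T') \<and> (\<forall>i\<in>I. km (sz (g i)) = 1)"
proof (induction s arbitrary: T f)
  case 0
  have "km (sz (f i)) = 1" if "i \<in> I" for i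
    using 0(4) that km_pos[of "sz (f i)"] S sz_in[of "f i"] by (metis One_nat_def le_antisym Suc_leI bot_nat_0.not_eq_extremum)
  then show ?case using reach_refl[OF 0(1)] finer_refl 0(2) by blast
next
  case (Suc s)
  \<comment> \<open>The length \<open>K * gcd mm nn\<close> instead of \<open>K * nn\<close> keeps the primes of \<open>na\<close> out of the next length.\<close>
  define c where "c = (\<lambda>M. if coprime (km M) na then km M * gcd mm nn else edge_size n m M)"
  have c: "\<forall>M\<in>S. edge_compat m n M (c M)"
  proof
    fix M assume "M \<in> S"
    show "edge_compat m n M (c M)"
    proof (cases "coprime (km M) na")
      case True
      then have "kn (c M) = km M" by (simp add: c_def kn_g)
      then show ?thesis unfolding edge_compat_iff[OF n0 m0] by (simp only: kn_def km_def mm_def nn_def)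
    next
      case False
      then show ?thesis using S_edge_size' \<open>M \<in> S\<close> by (simp add: c_def)
    qed
  qed
  from in_step[OF Suc.prems(1) I finite.emptyI Suc.prems(2) c] obtain T1 g1 where 1: "reach I T f T1 g1"
    "finer I f g1" "\<forall>i\<in>I. sz (g1 i) = c (sz (f i))" "\<forall>i\<in>I. \<forall>k. B k (g1 i) \<notin> Range T1"
    by (elim exE conjE) (assumption | simp)+
  have r: "\<forall>i\<in>I. g1 i \<notin> Range T1" using 1(4) by (metis B_zero)
  have K: "km (sz (g1 i)) = km (sz (f i)) div gcd (km (sz (f i))) mc" if "i \<in> I" for i
    using 1(3) Suc.prems(3) that by (simp add: c_def km_g)
  have cop: "\<forall>i\<in>I. coprime (km (sz (g1 i))) na"
  proof
    fix i assume i: "i \<in> I"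
    have "km (sz (g1 i)) dvd km (sz (f i))" unfolding K[OF i] by (metis dvd_div_mult_self dvd_triv_left gcd_dvd1)
    then show "coprime (km (sz (g1 i))) na" using Suc.prems(3) i by (meson coprime_divisors dvd_refl)
  qed
  have le: "\<forall>i\<in>I. km (sz (g1 i)) \<le> Suc s"
  proof
    fix i assume i: "i \<in> I"
    let ?K = "km (sz (f i))"
    have K0: "?K > 0" using km_pos[of "sz (f i)"] S sz_in[of "f i"] by (metis bot_nat_0.not_eq_extremum)
    show "km (sz (g1 i)) \<le> Suc s"
    proof (cases "?K = 1")
      case True then show ?thesis using K[OF i] by simp
    next
      case False
      then obtain p where p: "prime p" "p dvd ?K" using prime_factor_nat by blast
      have "\<not> p dvd na" using p Suc.prems(3) i by (metis coprime_common_divisor not_prime_unit)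
      then have "p dvd mc" using ph sz_in p by blast
      then have "p dvd gcd ?K mc" using p by simp
      moreover have "gcd ?K mc > 0" using K0 by simp
      ultimately have "gcd ?K mc > 1" using p(1) by (meson dvd_imp_le order_less_le_trans prime_gt_1_nat)
      then have "km (sz (g1 i)) < ?K" unfolding K[OF i] using K0 by (simp add: div_less_dividend)
      then show ?thesis using Suc.prems(4) i by fastforce
    qed
  qed
  from Suc.IH[OF reach_cond[OF 1(1)] r cop le] show ?case
    using reach_trans[OF 1(1)] finer_trans[OF 1(2)] by blast
qed

lemma normalise:
  assumes T: "cond T" and I: "finite I" and f: "leaves I T f"
    and S: "S = {0} \<or> 0 \<notin> S \<and> (\<forall>N\<in>S. \<forall>p. prime p \<longrightarrow> p dvd km N \<longrightarrow> p dvd na \<or> p dvd mc)"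
  shows "\<exists>T' g L. reach I T f T' g \<and> finer I f g \<and> leaves I T' g \<and> (\<forall>i\<in>I. sz (g i) = L) \<and> nn dvd L"
proof (cases "S = {0}")
  case True
  then have "\<forall>i\<in>I. sz (f i) = 0" using sz_in by blast
  then show ?thesis using reach_refl[OF T] finer_refl f by (metis dvd_0_right)
next
  case False
  then have S0: "0 \<notin> S" and ph: "\<forall>N\<in>S. \<forall>p. prime p \<longrightarrow> p dvd km N \<longrightarrow> p dvd na \<or> p dvd mc" using S by auto
  define s where "s = (\<Sum>i\<in>I. kn (sz (f i)))"
  have "\<forall>i\<in>I. \<exists>r. coprime r na \<and> kn (sz (f i)) dvd r * na ^ s"
  proof
    fix i assume i: "i \<in> I"
    have "sz (f i) > 0" using S0 sz_in by (metis bot_nat_0.not_eq_extremum)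
    then obtain r where r: "coprime r na" "kn (sz (f i)) dvd r * na ^ kn (sz (f i))"
      using power_part_bound[OF kn_pos] by blast
    have "kn (sz (f i)) \<le> s" unfolding s_def using i I by (intro member_le_sum) auto
    then have "r * na ^ kn (sz (f i)) dvd r * na ^ s" by (intro mult_dvd_mono le_imp_power_dvd) auto
    then show "\<exists>r. coprime r na \<and> kn (sz (f i)) dvd r * na ^ s" using r dvd_trans by blast
  qed
  from norm_out[OF I S0 T f this] obtain T1 g1 where 1: "reach I T f T1 g1" "finer I f g1" "leaves I T1 g1"
    "\<forall>i\<in>I. coprime (kn (sz (g1 i))) na" by blast
  from out_default[OF reach_cond[OF 1(1)] I leaves_notin[OF 1(3)]] obtain T2 g2 where 2: "reach I T1 g1 T2 g2"
    "finer I g1 g2" "leaves I T2 g2" "\<forall>i\<in>I. sz (g2 i) = edge_size m n (sz (g1 i))" by blast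
  define f2 where "f2 = (\<lambda>i. B 1 (g2 i))"
  have r2: "\<forall>i\<in>I. f2 i \<notin> Range T2" using 2(3) by (auto simp: leaves_def f2_def)
  have c2: "\<forall>i\<in>I. coprime (km (sz (f2 i))) na" using 1(4) 2(4) by (simp add: f2_def edge_size_kn km_mm)
  define s2 where "s2 = (\<Sum>i\<in>I. km (sz (f2 i)))"
  have l2: "\<forall>i\<in>I. km (sz (f2 i)) \<le> Suc s2"
  proof
    fix i assume "i \<in> I"
    then have "km (sz (f2 i)) \<le> s2" unfolding s2_def using I by (intro member_le_sum) auto
    then show "km (sz (f2 i)) \<le> Suc s2" by simp
  qed
  from norm_in[OF I S0 ph reach_cond[OF 2(1)] r2 c2 l2] obtain T3 g3 where 3: "reach I T2 f2 T3 g3" "finer I f2 g3"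
    "\<forall>i\<in>I. g3 i \<notin> Range T3" "\<forall>i\<in>I. km (sz (g3 i)) = 1" by blast
  from in_default[OF reach_cond[OF 3(1)] I 3(3)] obtain T4 g4 where 4: "reach I T3 g3 T4 g4" "finer I g3 g4"
    "leaves I (T4\<inverse>) g4" "\<forall>i\<in>I. sz (g4 i) = edge_size n m (sz (g3 i))" by blast
  have "\<forall>i\<in>I. g4 i \<notin> Range T4" using leaves_notin[OF 4(3)] by simp
  from in_default[OF reach_cond[OF 4(1)] I this] obtain T5 g5 where 5: "reach I T4 g4 T5 g5" "finer I g4 g5"
    "leaves I (T5\<inverse>) g5" "\<forall>i\<in>I. sz (g5 i) = edge_size n m (sz (g4 i))" by blast
  have "\<forall>i\<in>I. B 1 (g5 i) \<notin> Domain T5" using 5(3) by (auto simp: leaves_def)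
  from turn_out[OF reach_cond[OF 5(1)] I this] obtain T6 g6 where 6: "reach I T5 g5 T6 g6" "finer I g5 g6"
    "leaves I T6 g6" "\<forall>i\<in>I. sz (g6 i) = edge_size m n (sz (g5 i))" by blast
  have sz6: "\<forall>i\<in>I. sz (g6 i) = mm * km nn"
    using 6(4) 5(4) 4(4) 3(4) by (simp add: edge_size_kn edge_size_km kn_nn)
  have "mm * km nn = nn * mc"
  proof -
    have "km nn = na" unfolding km_def na_def by (simp add: gcd.commute)
    then show ?thesis using mn_gcd(1,2) by (metis mult.assoc mult.commute)
  qed
  then have "nn dvd mm * km nn" by simp
  moreover have "reach I T2 g2 T2 f2" unfolding f2_def using reach_shift reach_cond[OF 2(1)] .
  then have "reach I T f T6 g6"
    using reach_trans[OF reach_trans[OF reach_trans[OF reach_trans[OF reach_trans[OF reach_trans[OF 1(1) 2(1)]] 3(1)] 4(1)] 5(1)] 6(1)] by blast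
  moreover have "finer I g2 f2" unfolding f2_def by (rule finer_shift)
  then have "finer I f g6"
    using finer_trans[OF finer_trans[OF finer_trans[OF finer_trans[OF finer_trans[OF finer_trans[OF 1(2) 2(2)]] 3(2)] 4(2)] 5(2)] 6(2)] by blast
  ultimately show ?thesis using 6(3) sz6 by blast
qed

lemma nn_dvd: "nn dvd L \<Longrightarrow> int L dvd k \<Longrightarrow> n dvd k"
proof -
  assume "nn dvd L" "int L dvd k"
  then have "int nn dvd k" using dvd_trans int_dvd_int_iff by blast
  then show ?thesis by (simp add: nn_def)
qed

lemma loops:
  assumes T: "cond T" and I: "finite I" and f: "leaves I T f"
    and d: "\<forall>i\<in>I. \<forall>j\<in>I. i \<noteq> j \<longrightarrow> f j \<notin> orb (f i)"
    and L: "\<forall>i\<in>I. sz (f i) = L" "nn dvd L"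
    and X: "X \<subseteq> I" "inj_on \<pi> X" "\<pi> ` X \<subseteq> I"
  shows "\<exists>T' u. T \<subseteq> T' \<and> cond T' \<and> (\<forall>x\<in>X. pact B T' u (f x) (f (\<pi> x)))"
proof -
  have finX: "finite X" using I X(1) finite_subset by blast
  have fX: "\<forall>i\<in>X. f i \<notin> Domain T" using leaves_notin[OF f] X(1) by blast
  have finG: "finite (f ` I)" using I by simp
  from out_step[OF T finX finG fX S_edge_size] obtain T1 h where 1: "reach X T f T1 h"
    "\<forall>x\<in>X. (f x, h x) \<in> T1" "\<forall>i\<in>X. \<forall>k. B k (h i) \<notin> Domain T1" "\<forall>i\<in>X. \<forall>z\<in>f ` I. h i \<notin> orb z"
    "\<forall>i\<in>X. m dvd int (edge_size m n (sz (f i))) \<longrightarrow> (\<forall>k. B k (h i) \<in> Range T1 \<longrightarrow> m dvd k)"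
    "\<forall>i\<in>X. \<forall>j\<in>X. h j \<in> orb (h i) \<longrightarrow> (\<exists>a. f j = B (n * a) (f i) \<and> h j = B (m * a) (h i))"
    "Domain T1 \<subseteq> Domain T \<union> {B (n * k) (f i) | i k. i \<in> X}"
    by (elim exE conjE) (assumption | simp)+
  have c1: "cond T1" using reach_cond[OF 1(1)] .
  have same: "i = j" if "i \<in> I" "j \<in> I" "f j \<in> orb (f i)" for i j using d that by blast
  have hsame: "x = y" if xy: "x \<in> X" "y \<in> X" "h y \<in> orb (h x)" for x y
  proof -
    obtain a where "f y = B (n * a) (f x)" using 1(6) xy by blast
    then show ?thesis using same[of x y] xy X(1) by auto
  qed
  define F where "F = (\<lambda>x. B 1 (f (\<pi> x)))"
  define H where "H = (\<lambda>x. B 1 (h x))"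
  have piI: "\<pi> x \<in> I" if "x \<in> X" for x using X(3) that by blast
  have C: "cond (ext T1 X F H)"
  proof (rule ext_cond[OF c1 finX])
    fix x assume x: "x \<in> X"
    show "F x \<notin> Domain T1"
    proof
      assume "F x \<in> Domain T1"
      moreover have "F x \<notin> Domain T" using f piI[OF x] by (auto simp: leaves_def F_def)
      ultimately obtain y k where y: "y \<in> X" "B 1 (f (\<pi> x)) = B (n * k) (f y)" using 1(7) by (auto simp: F_def)
      then have "f (\<pi> x) \<in> orb (f y)" by (metis B_in_orb B_in_orb_iff)
      then have "y = \<pi> x" using same y(1) X(1) piI[OF x] by blast
      then have "int L dvd 1 - n * k" using y L(1) piI[OF x] by (simp add: B_eq)
      then have "n dvd 1 - n * k" using nn_dvd L(2) by blast
      then show False using n_not_dvd_1 by (simp add: dvd_diff_left_iff)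
    qed
    show "H x \<notin> Range T1" using 1(5) x dvd_edge_size m_not_dvd_1 unfolding H_def by blast
    show "B k (H x) \<notin> Domain T1" for k using 1(3) x by (simp add: H_def B_B)
    fix y assume y: "y \<in> X"
    show "B k (H x) \<noteq> F y" for k
    proof
      assume "B k (H x) = F y"
      then have "h x \<in> orb (f (\<pi> y))" unfolding H_def F_def by (metis B_in_orb B_in_orb_iff)
      then show False using 1(4) x piI[OF y] by blast
    qed
    show "H y = B (m * k) (H x) \<longleftrightarrow> F y = B (n * k) (F x)" for k
    proof (cases "x = y")
      case True
      have "edge_compat n m (sz (f x)) (sz (h x))" using piso_compat[OF cond_piso[OF c1]] 1(2) x by blast
      moreover have "sz (f x) = sz (f (\<pi> x))" using L(1) x X(1) piI[OF x] by auto
      ultimately have "int (sz (F x)) dvd n * k \<longleftrightarrow> int (sz (H x)) dvd m * k" by (simp add: edge_compat_def F_def H_def)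
      then show ?thesis using True by (metis B_fix)
    next
      case False
      then have "h y \<notin> orb (h x)" using hsame x y by blast
      then have "H y \<notin> orb (H x)" by (simp add: H_def)
      moreover have "\<pi> x \<noteq> \<pi> y" using False X(2) x y by (meson inj_onD)
      then have "f (\<pi> y) \<notin> orb (f (\<pi> x))" using same piI x y by blast
      then have "F y \<notin> orb (F x)" by (simp add: F_def)
      ultimately show ?thesis by (metis B_in_orb)
    qed
  qed
  let ?T = "ext T1 X F H"
  have sub: "T1 \<subseteq> ?T" by (rule sub_ext)
  have "pact B ?T [(Tg, False), (Bg, False), (Tg, True), (Bg, True)] (f x) (f (\<pi> x))" if x: "x \<in> X" for x
  proof -
    have "(f x, h x) \<in> ?T" using 1(2) x sub by blast
    moreover have "(F x, H x) \<in> ?T" unfolding ext_iff using x by (metis B_zero mult_zero_right)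
    then have "(B 1 (f (\<pi> x)), B 1 (h x)) \<in> ?T" by (simp add: F_def H_def)
    moreover have "B (- 1) (B 1 (f (\<pi> x))) = f (\<pi> x)" by (simp add: B_B B_zero)
    ultimately have "\<exists>z. (f x, z) \<in> ?T \<and> (\<exists>za. (za, B 1 z) \<in> ?T \<and> B (- 1) za = f (\<pi> x))" by blast
    then show ?thesis by simp
  qed
  then show ?thesis using C sub reach_sub[OF 1(1)] by blast
qed

lemma pact_winv: "pact B T (winv w) x y \<longleftrightarrow> pact B T w y x"
proof (induction w arbitrary: y)
  case Nil then show ?case by (auto simp: winv_def)
next
  case (Cons a w)
  obtain g s where a: "a = (g, s)" by force
  have inv: "lstep B T (g, \<not> s) z y \<longleftrightarrow> lstep B T (g, s) y z" for z
  proof (cases g)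
    case Bg
    then show ?thesis using B_swap[of y "if \<not> s then - 1 else 1" z] by auto
  qed simp
  have "winv (a # w) = winv w @ [(g, \<not> s)]" by (simp add: winv_def a)
  then have "pact B T (winv (a # w)) x y \<longleftrightarrow> (\<exists>z. pact B T (winv w) x z \<and> lstep B T (g, \<not> s) z y)"
    by (simp add: pact_append)
  also have "\<dots> \<longleftrightarrow> pact B T (a # w) y x" unfolding Cons.IH inv a by auto
  finally show ?case .
qed

lemma ht_dense:
  assumes T: "cond T" and S1: "0 \<notin> S \<or> S = {0} \<and> \<bar>m\<bar> \<le> \<bar>n\<bar>" and S2: "separable m n S"
    and S3: "S = {0} \<or> 0 \<notin> S \<and> (\<forall>N\<in>S. \<forall>p. prime p \<longrightarrow> p dvd km N \<longrightarrow> p dvd na \<or> p dvd mc)"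
    and xy: "length xs = length ys" "distinct xs" "distinct ys"
  shows "\<exists>T'. T \<subseteq> T' \<and> cond T' \<and> (\<exists>w. \<forall>i<length xs. pact B T' w (xs ! i) (ys ! i))"
proof -
  define I where "I = set xs \<union> set ys"
  have I: "finite I" by (simp add: I_def)
  obtain T1 f1 where 1: "reach I T id T1 f1" "leaves I T1 f1" using leaves_ex[OF T S1 I] by blast
  have "inj_on f1 I" using reach_inj[OF 1(1)] by simp
  from separate_all[OF I S2 reach_cond[OF 1(1)] 1(2) this] obtain T2 f2 where 2: "reach I T1 f1 T2 f2" "leaves I T2 f2"
    "\<forall>i\<in>I. \<forall>j\<in>I. i \<noteq> j \<longrightarrow> f2 j \<notin> orb (f2 i)" by blast
  from normalise[OF reach_cond[OF 2(1)] I 2(2) S3] obtain T3 f3 L where 3: "reach I T2 f2 T3 f3" "finer I f2 f3"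
    "leaves I T3 f3" "\<forall>i\<in>I. sz (f3 i) = L" "nn dvd L" by blast
  have d3: "\<forall>i\<in>I. \<forall>j\<in>I. i \<noteq> j \<longrightarrow> f3 j \<notin> orb (f3 i)" using 2(3) 3(2) unfolding finer_def by blast
  define \<pi> where "\<pi> = (\<lambda>x. the (map_of (zip xs ys) x))"
  have pi: "\<pi> (xs ! i) = ys ! i" if "i < length xs" for i
    using that xy by (simp add: \<pi>_def map_of_zip_nth)
  have X2: "inj_on \<pi> (set xs)"
  proof (rule inj_onI)
    fix x y assume "x \<in> set xs" "y \<in> set xs" and e: "\<pi> x = \<pi> y"
    then obtain i j where ij: "i < length xs" "j < length xs" "x = xs ! i" "y = xs ! j"
      unfolding in_set_conv_nth by blast
    then have "ys ! i = ys ! j" using e pi by simp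
    then have "i = j" using xy ij by (simp add: nth_eq_iff_index_eq)
    then show "x = y" using ij by simp
  qed
  have X3: "\<pi> ` set xs \<subseteq> I"
  proof (rule image_subsetI)
    fix x assume "x \<in> set xs"
    then obtain i where i: "i < length xs" "x = xs ! i" unfolding in_set_conv_nth by blast
    then have "\<pi> x = ys ! i" "i < length ys" using pi xy(1) by simp_all
    then show "\<pi> x \<in> I" by (simp add: I_def)
  qed
  have X1: "set xs \<subseteq> I" by (simp add: I_def)
  from loops[OF reach_cond[OF 3(1)] I 3(3) d3 3(4,5) X1 X2 X3]
  obtain T4 u where 4: "T3 \<subseteq> T4" "cond T4" "\<forall>x\<in>set xs. pact B T4 u (f3 x) (f3 (\<pi> x))"
    by (elim exE conjE)
  have r: "reach I T id T3 f3" using reach_trans[OF reach_trans[OF 1(1) 2(1)] 3(1)] .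
  then obtain w where w: "\<forall>x\<in>I. pact B T3 w x (f3 x)" by (auto simp: reach_def)
  have w4: "pact B T4 w x (f3 x)" if "x \<in> I" for x using pact_mono[OF _ 4(1)] w that by blast
  have "pact B T4 (w @ u @ winv w) (xs ! i) (ys ! i)" if i: "i < length xs" for i
  proof -
    have mem: "xs ! i \<in> set xs" "xs ! i \<in> I" "ys ! i \<in> I" using i xy(1) by (auto simp: I_def)
    have "pact B T4 u (f3 (xs ! i)) (f3 (ys ! i))" using bspec[OF 4(3) mem(1)] unfolding pi[OF i] .
    moreover have "pact B T4 (winv w) (f3 (ys ! i)) (ys ! i)" unfolding pact_winv using w4[OF mem(3)] .
    ultimately show ?thesis unfolding pact_append using w4[OF mem(2)] by blast
  qed
  then show ?thesis using 4(1,2) reach_sub[OF r] by blast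
qed

end

section \<open>Generic actions\<close>

lemma separable_dual: "separable m n S \<longleftrightarrow> separable n m S"
proof -
  have *: "separable m n S \<Longrightarrow> separable n m S" for m n
    unfolding separable_def
  proof (intro ballI allI impI)
    fix N k
    assume S: "\<forall>N\<in>S. \<forall>k. \<not> int N dvd k \<longrightarrow>
     (\<exists>P s u v n' m'. prime P \<and> P ^ s dvd int N \<and> \<not> P ^ s dvd k \<and>
        n = P ^ u * n' \<and> \<not> P dvd n' \<and> m = P ^ v * m' \<and> \<not> P dvd m' \<and> (u = v \<longrightarrow> s \<le> u))"
      and N: "N \<in> S" "\<not> int N dvd k"
    then obtain P s u v n' m' where "prime P" "P ^ s dvd int N" "\<not> P ^ s dvd k"
        "n = P ^ u * n'" "\<not> P dvd n'" "m = P ^ v * m'" "\<not> P dvd m'" "u = v \<longrightarrow> s \<le> u" by blast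
    then show "\<exists>P s u v n' m'. prime P \<and> P ^ s dvd int N \<and> \<not> P ^ s dvd k \<and>
        m = P ^ u * n' \<and> \<not> P dvd n' \<and> n = P ^ v * m' \<and> \<not> P dvd m' \<and> (u = v \<longrightarrow> s \<le> u)"
      by (intro exI[of _ P] exI[of _ s] exI[of _ v] exI[of _ u] exI[of _ m'] exI[of _ n']) auto
  qed
  show ?thesis using *[of m n] *[of n m] by blast
qed

context orbit_system
begin

definition full :: "('x \<times> 'x) set \<Rightarrow> bool" where
  "full T \<longleftrightarrow> single_valued T \<and> single_valued (T\<inverse>) \<and>
     (\<forall>x y k. (x, y) \<in> T \<longrightarrow> (B (n * k) x, B (m * k) y) \<in> T) \<and> Domain T = UNIV \<and> Range T = UNIV"

definition nofin :: "('x \<times> 'x) set \<Rightarrow> bool" where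
  "nofin T \<longleftrightarrow> (\<forall>C F. C \<noteq> {} \<longrightarrow> (\<forall>x\<in>C. orb x \<subseteq> C) \<longrightarrow> finite F \<longrightarrow> C \<subseteq> (\<Union>f\<in>F. orb f) \<longrightarrow>
     T `` C \<subseteq> C \<longrightarrow> T\<inverse> `` C \<subseteq> C \<longrightarrow> False)"

lemma full_dual: "orbit_system.full B n m (T\<inverse>) \<longleftrightarrow> full T"
  unfolding orbit_system.full_def[OF dual] full_def converse_converse converse_iff Domain_converse Range_converse
  by blast

lemma nofin_dual: "nofin (T\<inverse>) \<longleftrightarrow> nofin T"
  unfolding nofin_def converse_converse by (intro iff_allI) argo

lemma out_point:
  assumes T: "cond T" and x: "x \<notin> Domain T" and G: "finite G"
  shows "\<exists>T' y. T \<subseteq> T' \<and> cond T' \<and> (x, y) \<in> T' \<and> (\<forall>k. B k y \<notin> Domain T') \<and> (\<forall>h\<in>G. y \<notin> orb h) \<and>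
    (\<forall>k. B k y \<in> Range T' \<longrightarrow> m dvd k) \<and> Domain T' \<subseteq> Domain T \<union> range (\<lambda>k. B (n * k) x)"
proof -
  define f where "f = (\<lambda>_ :: unit. x)"
  have f: "\<forall>i\<in>{()}. f i \<notin> Domain T" using x by (simp add: f_def)
  have I: "finite {()}" by simp
  from out_step[OF T I G f S_edge_size] obtain T' g where 1: "reach {()} T f T' g" "\<forall>i\<in>{()}. (f i, g i) \<in> T'"
    "\<forall>i\<in>{()}. \<forall>k. B k (g i) \<notin> Domain T'" "\<forall>i\<in>{()}. \<forall>h\<in>G. g i \<notin> orb h"
    "\<forall>i\<in>{()}. m dvd int (edge_size m n (sz (f i))) \<longrightarrow> (\<forall>k. B k (g i) \<in> Range T' \<longrightarrow> m dvd k)"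
    "Domain T' \<subseteq> Domain T \<union> {B (n * k) (f i) | i k. i \<in> {()}}"
    by (elim exE conjE) (assumption | simp)+
  have "Domain T' \<subseteq> Domain T \<union> range (\<lambda>k. B (n * k) x)" using 1(6) by (auto simp: f_def)
  then show ?thesis using 1(2-5) reach_sub[OF 1(1)] reach_cond[OF 1(1)] dvd_edge_size
    by (intro exI[of _ T'] exI[of _ "g ()"]) (simp add: f_def)
qed

lemma dense_point:
  assumes T: "cond T"
  shows "\<exists>T'. T \<subseteq> T' \<and> cond T' \<and> x \<in> Domain T' \<and> x \<in> Range T'"
proof -
  have "\<exists>T'. T \<subseteq> T' \<and> cond T' \<and> x \<in> Domain T'"
  proof (cases "x \<in> Domain T")
    case True then show ?thesis using T by blast
  next
    case False
    from out_point[OF T this finite.emptyI] show ?thesis by blast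
  qed
  then obtain T1 where T1: "T \<subseteq> T1" "cond T1" "x \<in> Domain T1" by blast
  show ?thesis
  proof (cases "x \<in> Range T1")
    case True then show ?thesis using T1 by blast
  next
    case False
    then have x: "x \<notin> Domain (T1\<inverse>)" by simp
    have c: "orbit_system.cond B n m (T1\<inverse>)" using T1 by (simp add: cond_dual)
    from orbit_system.out_point[OF dual c x finite.emptyI]
    obtain U y where U: "T1\<inverse> \<subseteq> U" "orbit_system.cond B n m U" "(x, y) \<in> U" by (elim exE conjE)
    have "cond (U\<inverse>)" using U(2) cond_dual[of "U\<inverse>"] by simp
    moreover have "T1 \<subseteq> U\<inverse>" using U(1) by auto
    moreover have "x \<in> Range (U\<inverse>)" using U(3) by auto
    ultimately show ?thesis using T1 by blast
  qed
qed

lemma chain_bound: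
  assumes mono: "\<And>i j. i \<le> j \<Longrightarrow> Ts i \<subseteq> (Ts j :: 'a set)" and X: "finite X" "X \<subseteq> (\<Union>i. Ts i)"
  shows "\<exists>i. X \<subseteq> Ts (i :: nat)"
  using X
proof (induction X rule: finite_induct)
  case (insert x X)
  then obtain i j where "X \<subseteq> Ts i" "x \<in> Ts j" by auto
  then have "insert x X \<subseteq> Ts (max i j)" using mono[of i "max i j"] mono[of j "max i j"] by auto
  then show ?case by blast
qed simp

lemma generic:
  assumes T0: "cond T0" and e: "surj (e :: nat \<Rightarrow> 'x)"
    and D: "\<forall>i T. cond T \<longrightarrow> (\<exists>T'. T \<subseteq> T' \<and> cond T' \<and> Q i T')"
  shows "\<exists>T. T0 \<subseteq> T \<and> full T \<and> nofin T \<and> (\<forall>i :: nat. \<exists>T'. T' \<subseteq> T \<and> Q i T')"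
proof -
  let ?P = "\<lambda>i :: nat. \<lambda>T. cond T \<and> T0 \<subseteq> T"
  let ?R = "\<lambda>i T T'. T \<subseteq> T' \<and> e i \<in> Domain T' \<and> e i \<in> Range T' \<and> (\<exists>T''. T'' \<subseteq> T' \<and> Q i T'')"
  have "\<exists>Ts. \<forall>i. ?P i (Ts i) \<and> ?R i (Ts i) (Ts (Suc i))"
  proof (rule dependent_nat_choice)
    show "\<exists>T. cond T \<and> T0 \<subseteq> T" using T0 by blast
    fix T i assume T: "cond T \<and> T0 \<subseteq> T"
    then obtain T1 where T1: "T \<subseteq> T1" "cond T1" "Q i T1" using D by blast
    obtain T2 where "T1 \<subseteq> T2" "cond T2" "e i \<in> Domain T2" "e i \<in> Range T2" using dense_point[OF T1(2)] by blast
    then show "\<exists>T'. (cond T' \<and> T0 \<subseteq> T') \<and> ?R i T T'" using T1 T by (intro exI[of _ T2]) blast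
  qed
  then obtain Ts where Ts: "\<And>i. cond (Ts i)" "\<And>i. T0 \<subseteq> Ts i" "\<And>i. Ts i \<subseteq> Ts (Suc i)"
    "\<And>i. e i \<in> Domain (Ts (Suc i))" "\<And>i. e i \<in> Range (Ts (Suc i))" "\<And>i. \<exists>T''. T'' \<subseteq> Ts (Suc i) \<and> Q i T''"
    by blast
  define T where "T = (\<Union>i. Ts i)"
  have mono: "Ts i \<subseteq> Ts j" if "i \<le> j" for i j using lift_Suc_mono_le[of Ts, OF Ts(3) that] .
  have sub: "Ts i \<subseteq> T" for i by (auto simp: T_def)
  have two: "\<exists>i. p \<in> Ts i \<and> q \<in> Ts i" if "p \<in> T" "q \<in> T" for p q
    using chain_bound[of Ts "{p, q}"] mono that unfolding T_def by auto
  have sv: "single_valued T"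
  proof (rule single_valuedI)
    fix x y z assume "(x, y) \<in> T" "(x, z) \<in> T"
    then obtain i where "(x, y) \<in> Ts i" "(x, z) \<in> Ts i" using two by blast
    then show "y = z" using piso_sv[OF cond_piso[OF Ts(1)]] by blast
  qed
  have inj: "single_valued (T\<inverse>)"
  proof (rule single_valuedI, unfold converse_iff)
    fix x y z assume "(y, x) \<in> T" "(z, x) \<in> T"
    then obtain i where "(y, x) \<in> Ts i" "(z, x) \<in> Ts i" using two by blast
    then show "y = z" using piso_inj[OF cond_piso[OF Ts(1)]] by blast
  qed
  have eqv: "\<forall>x y k. (x, y) \<in> T \<longrightarrow> (B (n * k) x, B (m * k) y) \<in> T"
    using piso_eqv[OF cond_piso[OF Ts(1)]] unfolding T_def by blast
  have dom: "Domain T = UNIV" and ran: "Range T = UNIV"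
  proof -
    have "x \<in> Domain T \<and> x \<in> Range T" for x
    proof -
      obtain i where "x = e i" using e by (metis surjD)
      then show ?thesis using Ts(4,5)[of i] sub[of "Suc i"] by blast
    qed
    then show "Domain T = UNIV" "Range T = UNIV" by blast+
  qed
  have "nofin T" unfolding nofin_def
  proof (intro allI impI)
    fix C F assume C: "C \<noteq> {}" "\<forall>x\<in>C. orb x \<subseteq> C" "finite F" "C \<subseteq> (\<Union>f\<in>F. orb f)" "T `` C \<subseteq> C" "T\<inverse> `` C \<subseteq> C"
    define X where "X = (\<lambda>(f, j). B j f) ` (F \<times> {0..<\<bar>m\<bar> * \<bar>n\<bar>})"
    have X: "finite X" using C(3) by (simp add: X_def)
    have monoD: "Domain (Ts i) \<subseteq> Domain (Ts j)" and monoR: "Range (Ts i) \<subseteq> Range (Ts j)" if "i \<le> j" for i j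
      using mono[OF that] by blast+
    have "X \<subseteq> (\<Union>i. Domain (Ts i))" using dom unfolding T_def by blast
    then obtain i where i: "X \<subseteq> Domain (Ts i)" using chain_bound[of "\<lambda>i. Domain (Ts i)" X] monoD X by blast
    have "X \<subseteq> (\<Union>i. Range (Ts i))" using ran unfolding T_def by blast
    then obtain j where j: "X \<subseteq> Range (Ts j)" using chain_bound[of "\<lambda>i. Range (Ts i)" X] monoR X by blast
    define U where "U = Ts (max i j)"
    have U: "cond U" "U \<subseteq> T" using Ts(1) sub by (auto simp: U_def)
    have XU: "X \<subseteq> Domain U" "X \<subseteq> Range U" using i j monoD[of i "max i j"] monoR[of j "max i j"] by (auto simp: U_def)
    have mod: "\<exists>y\<in>X. \<exists>k. x = B (m * n * k) y" if x: "x \<in> C" for x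
    proof -
      obtain f where "f \<in> F" "x \<in> orb f" using C(4) x by blast
      then obtain l where f: "f \<in> F" "x = B l f" unfolding orb_iff by blast
      define r where "r = l mod (\<bar>m\<bar> * \<bar>n\<bar>)"
      have "0 < \<bar>m\<bar> * \<bar>n\<bar>" using m0 n0 by simp
      then have r: "r \<in> {0..<\<bar>m\<bar> * \<bar>n\<bar>}" by (simp add: r_def)
      have "\<bar>m * n\<bar> dvd l - r" unfolding r_def abs_mult by (simp add: minus_mod_eq_mult_div)
      then have "m * n dvd l - r" by (simp only: abs_dvd_iff)
      then obtain k where "l - r = m * n * k" by (rule dvdE)
      then have "l = m * n * k + r" by simp
      then have "x = B (m * n * k) (B r f)" using f(2) by (simp add: B_B)
      moreover have "B r f \<in> X" using f(1) r by (auto simp: X_def)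
      ultimately show ?thesis by blast
    qed
    have "C \<subseteq> Domain U"
    proof
      fix x assume "x \<in> C"
      then obtain y k where "y \<in> X" "x = B (n * (m * k)) y" using mod by (metis mult.assoc mult.commute)
      then show "x \<in> Domain U" using XU(1) piso_Domain[OF cond_piso[OF U(1)]] by blast
    qed
    moreover have "C \<subseteq> Range U"
    proof
      fix x assume "x \<in> C"
      then obtain y k where "y \<in> X" "x = B (m * (n * k)) y" using mod by (metis mult.assoc)
      then show "x \<in> Range U" using XU(2) piso_Range[OF cond_piso[OF U(1)]] by blast
    qed
    moreover have "U `` C \<subseteq> C" "U\<inverse> `` C \<subseteq> C" using C(5,6) U(2) by blast+
    moreover have "unsat U" using U(1) by (simp add: cond_def)
    ultimately show False using C(1,2) unfolding unsat_def by meson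
  qed
  moreover have "full T" unfolding full_def using sv inj eqv dom ran by blast
  moreover have "T0 \<subseteq> T" using Ts(2) sub by blast
  moreover have "\<exists>T'. T' \<subseteq> T \<and> Q i T'" for i
  proof -
    from Ts(6)[of i] obtain U where "U \<subseteq> Ts (Suc i)" "Q i U" by (elim exE conjE)
    then show ?thesis using sub[of "Suc i"] by (intro exI[of _ U] conjI) (rule subset_trans)
  qed
  then have "\<forall>i. \<exists>T'. T' \<subseteq> T \<and> Q i T'" ..
  ultimately show ?thesis by (intro exI[of _ T] conjI)
qed

definition htrans :: "('x \<times> 'x) set \<Rightarrow> bool" where
  "htrans T \<longleftrightarrow> (\<forall>xs ys. length xs = length ys \<longrightarrow> distinct xs \<longrightarrow> distinct ys \<longrightarrow>
     (\<exists>w. \<forall>i<length xs. pact B T w (xs ! i) (ys ! i)))"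

lemma htrans_dual: "htrans (T\<inverse>) \<longleftrightarrow> htrans T"
proof -
  have "(\<exists>w. \<forall>i<k. pact B (T\<inverse>) w (xs ! i) (ys ! i)) \<longleftrightarrow> (\<exists>w. \<forall>i<k. pact B T w (xs ! i) (ys ! i))"
    for k and xs ys :: "'x list"
    by (metis flipt_flipt pact_flipt)
  then show ?thesis unfolding htrans_def by simp
qed

lemma generic_ht_aux:
  assumes T: "cond T" and e: "surj (e :: nat \<Rightarrow> 'x)" and S1: "0 \<notin> S \<or> S = {0} \<and> \<bar>m\<bar> \<le> \<bar>n\<bar>" and S2: "separable m n S"
    and S3: "S = {0} \<or> 0 \<notin> S \<and> (\<forall>N\<in>S. \<forall>p. prime p \<longrightarrow> p dvd km N \<longrightarrow> p dvd na \<or> p dvd mc)"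
  shows "\<exists>T'. T \<subseteq> T' \<and> full T' \<and> nofin T' \<and> htrans T'"
proof -
  define Q where "Q = (\<lambda>i T. \<forall>as bs. from_nat i = (as, bs) \<longrightarrow>
     length (map e as) = length (map e bs) \<longrightarrow> distinct (map e as) \<longrightarrow> distinct (map e bs) \<longrightarrow>
     (\<exists>w. \<forall>i<length (map e as). pact B T w (map e as ! i) (map e bs ! i)))"
  have "\<exists>T'. U \<subseteq> T' \<and> cond T' \<and> Q i T'" if U: "cond U" for i U
  proof -
    obtain as bs where ab: "from_nat i = (as :: nat list, bs :: nat list)" by force
    show ?thesis
    proof (cases "length (map e as) = length (map e bs) \<and> distinct (map e as) \<and> distinct (map e bs)")
      case True
      then obtain T' where "U \<subseteq> T'" "cond T'" "\<exists>w. \<forall>i<length (map e as). pact B T' w (map e as ! i) (map e bs ! i)"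
        using ht_dense[OF U S1 S2 S3, of "map e as" "map e bs"] by blast
      then show ?thesis unfolding Q_def ab by blast
    next
      case False
      then show ?thesis using U unfolding Q_def ab by blast
    qed
  qed
  then have "\<forall>i U. cond U \<longrightarrow> (\<exists>T'. U \<subseteq> T' \<and> cond T' \<and> Q i T')" by (intro allI impI)
  from generic[OF T e this] obtain T' where T': "T \<subseteq> T'" "full T'" "nofin T'" "\<forall>i. \<exists>U. U \<subseteq> T' \<and> Q i U"
    by (elim exE conjE)
  have "htrans T'" unfolding htrans_def
  proof (intro allI impI)
    fix xs ys :: "'x list" assume xy: "length xs = length ys" "distinct xs" "distinct ys"
    define as where "as = map (inv_into UNIV e) xs"
    define bs where "bs = map (inv_into UNIV e) ys"
    have ab: "map e as = xs" "map e bs = ys"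
      by (simp_all add: as_def bs_def o_def surj_f_inv_f[OF e])
    from T'(4)[rule_format, of "to_nat (as, bs)"] obtain U where U: "U \<subseteq> T'" "Q (to_nat (as, bs)) U" by (elim exE conjE)
    then obtain w where "\<forall>i<length xs. pact B U w (xs ! i) (ys ! i)"
      unfolding Q_def from_nat_to_nat using xy ab by auto
    then show "\<exists>w. \<forall>i<length xs. pact B T' w (xs ! i) (ys ! i)" using pact_mono[OF _ U(1)] by blast
  qed
  then show ?thesis using T' by blast
qed

lemma generic_ht:
  assumes T: "cond T" and e: "surj (e :: nat \<Rightarrow> 'x)" and S2: "separable m n S"
    and S3: "S = {0} \<or> 0 \<notin> S \<and> (\<forall>N\<in>S. \<forall>p. prime p \<longrightarrow> p dvd km N \<longrightarrow> p dvd na \<or> p dvd mc)"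
  shows "\<exists>T'. T \<subseteq> T' \<and> full T' \<and> nofin T' \<and> htrans T'"
proof (cases "S = {0} \<and> \<bar>n\<bar> < \<bar>m\<bar>")
  case False
  then show ?thesis using S3 by (intro generic_ht_aux[OF T e _ S2 S3]) auto
next
  case True
  have c: "orbit_system.cond B n m (T\<inverse>)" using T by (simp add: cond_dual)
  have s: "separable n m S" using S2 separable_dual by blast
  obtain U where "T\<inverse> \<subseteq> U" "orbit_system.full B n m U" "nofin U" "htrans U"
    using orbit_system.generic_ht_aux[OF dual c e _ s] True by auto
  then show ?thesis
    by (intro exI[of _ "U\<inverse>"]) (use full_dual[of "U\<inverse>"] nofin_dual htrans_dual in auto)
qed

text \<open>
  The two extensions differ in whether \<open>x t b = x b t\<close> at a point \<open>x\<close> reached from \<open>x0\<close>. Going back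
  twice before turning ensures that \<open>n\<close> divides the length of the \<open>b\<close>-orbit of \<open>x\<close>, so that \<open>x\<close> and
  \<open>x b\<close> lie in different \<open>b\<^sup>n\<close>-orbits.
\<close>

lemma two_ext:
  assumes T: "cond T" and S: "0 \<notin> S \<or> S = {0} \<and> \<bar>m\<bar> \<le> \<bar>n\<bar>"
  shows "\<exists>TA TB w. T \<subseteq> TA \<and> cond TA \<and> T \<subseteq> TB \<and> cond TB \<and> pact B TA w x0 x0 \<and>
    (\<forall>U. TB \<subseteq> U \<longrightarrow> full U \<longrightarrow> \<not> pact B U w x0 x0)"
proof -
  let ?I = "{()}"
  have I: "finite ?I" by simp
  obtain T1 g1 where 1: "reach ?I T (\<lambda>_. x0) T1 g1" "\<forall>i\<in>?I. B 1 (g1 i) \<notin> Range T1"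
    using exit_all[OF T S I] by blast
  obtain T2 g2 where 2: "reach ?I T1 g1 T2 g2" "leaves ?I (T2\<inverse>) g2" "\<forall>i\<in>?I. sz (g2 i) = edge_size n m (sz (g1 i))"
    using turn_in[OF reach_cond[OF 1(1)] I 1(2)] by blast
  have "\<forall>i\<in>?I. g2 i \<notin> Range T2" using leaves_notin[OF 2(2)] by simp
  then obtain T3 g3 where 3: "reach ?I T2 g2 T3 g3" "leaves ?I (T3\<inverse>) g3" "\<forall>i\<in>?I. sz (g3 i) = edge_size n m (sz (g2 i))"
    using in_default[OF reach_cond[OF 2(1)] I] by blast
  have "\<forall>i\<in>?I. B 1 (g3 i) \<notin> Domain T3" using 3(2) by (auto simp: leaves_def)
  then obtain T4 g4 where 4: "reach ?I T3 g3 T4 g4" "leaves ?I T4 g4" "\<forall>i\<in>?I. sz (g4 i) = edge_size m n (sz (g3 i))"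
    using turn_out[OF reach_cond[OF 3(1)] I] by blast
  define x where "x = g4 ()"
  have r: "reach ?I T (\<lambda>_. x0) T4 g4"
    using reach_trans[OF reach_trans[OF reach_trans[OF 1(1) 2(1)] 3(1)] 4(1)] .
  have c4: "cond T4" using reach_cond[OF r] .
  obtain w where w: "pact B T4 w x0 x" using r by (auto simp: reach_def x_def)
  have xD: "B k x \<notin> Domain T4" for k using 4(2) by (auto simp: leaves_def x_def)
  have nx: "nn dvd sz x"
  proof -
    define N where "N = nn * km (sz (g1 ()))"
    have "sz x = mm * km N" using 4(3) 3(3) 2(3) by (simp add: x_def edge_size_kn edge_size_km kn_nn N_def)
    also have "\<dots> = N * (mm div gcd N mm)"
      unfolding km_def by (metis div_mult_swap dvd_div_mult gcd_dvd1 gcd_dvd2 mult.commute)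
    finally show ?thesis by (simp add: N_def)
  qed
  have n1: "B 1 x \<noteq> B (n * a) x" for a
  proof
    assume "B 1 x = B (n * a) x"
    then have "n dvd 1 - n * a" using nn_dvd[OF nx] by (simp add: B_eq)
    then show False using n_not_dvd_1 by (simp add: dvd_diff_left_iff)
  qed
  define v where "v = w @ [(Tg, False), (Bg, False), (Tg, True), (Bg, True)] @ winv w"
  have "\<exists>TA. T4 \<subseteq> TA \<and> cond TA \<and> pact B TA v x0 x0"
  proof -
    have "x \<notin> Domain T4" using xD[of 0] by (simp add: B_zero)
    from out_point[OF c4 this, of "{x}"] obtain U y where U: "T4 \<subseteq> U" "cond U" "(x, y) \<in> U"
      "\<forall>k. B k y \<notin> Domain U" "y \<notin> orb x" "\<forall>k. B k y \<in> Range U \<longrightarrow> m dvd k"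
      "Domain U \<subseteq> Domain T4 \<union> range (\<lambda>k. B (n * k) x)"
      by auto
    define F where "F = (\<lambda>_ :: unit. B 1 x)"
    define H where "H = (\<lambda>_ :: unit. B 1 y)"
    have C: "cond (ext U ?I F H)"
    proof (rule ext_cond[OF U(2) I])
      fix i j :: unit
      show "F i \<notin> Domain U" using U(7) xD n1 by (auto simp: F_def)
      show "H i \<notin> Range U" using U(6) m_not_dvd_1 by (auto simp: H_def)
      show "B k (H i) \<notin> Domain U" for k using U(4) by (simp add: H_def B_B)
      show "B k (H i) \<noteq> F j" for k
      proof
        assume "B k (H i) = F j"
        then have "y \<in> orb x" unfolding H_def F_def by (metis B_in_orb B_in_orb_iff)
        then show False using U(5) by blast
      qed
      have "edge_compat n m (sz x) (sz y)" using piso_compat[OF cond_piso[OF U(2)] U(3)] .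
      then have "int (sz (F i)) dvd n * k \<longleftrightarrow> int (sz (H i)) dvd m * k" for k by (simp add: edge_compat_def F_def H_def)
      then show "H j = B (m * k) (H i) \<longleftrightarrow> F j = B (n * k) (F i)" for k by (metis B_fix old.unit.exhaust)
    qed
    let ?T = "ext U ?I F H"
    have sub: "U \<subseteq> ?T" by (rule sub_ext)
    have sub4: "T4 \<subseteq> ?T" using sub U(1) by blast
    have "(F (), H ()) \<in> ?T" unfolding ext_iff by (metis B_zero mult_zero_right singletonI)
    then have "(B 1 x, B 1 y) \<in> ?T" by (simp add: F_def H_def)
    moreover have "(x, y) \<in> ?T" using U(3) sub by blast
    moreover have "B (- 1) (B 1 x) = x" by (simp add: B_B B_zero)
    ultimately have "\<exists>z. (x, z) \<in> ?T \<and> (\<exists>za. (za, B 1 z) \<in> ?T \<and> B (- 1) za = x)" by blast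
    then have "pact B ?T [(Tg, False), (Bg, False), (Tg, True), (Bg, True)] x x" by simp
    moreover have "pact B ?T w x0 x" using pact_mono[OF w sub4] .
    ultimately have "pact B ?T v x0 x0" unfolding v_def pact_append pact_winv by blast
    then show ?thesis using C sub4 by blast
  qed
  then obtain TA where A: "T4 \<subseteq> TA" "cond TA" "pact B TA v x0 x0" by blast
  have "\<exists>TB. T4 \<subseteq> TB \<and> cond TB \<and> (\<forall>U. TB \<subseteq> U \<longrightarrow> full U \<longrightarrow> \<not> pact B U v x0 x0)"
  proof -
    define f where "f = (\<lambda>i. B i x)"
    have fD: "\<forall>i\<in>{0, 1}. f i \<notin> Domain T4" using xD by (simp add: f_def)
    have fin: "finite {0, 1 :: int}" by simp
    from out_step[OF c4 fin finite.emptyI fD S_edge_size] obtain TB g where TB: "reach {0, 1} T4 f TB g"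
      "\<forall>i\<in>{0, 1}. (f i, g i) \<in> TB"
      "\<forall>i\<in>{0, 1}. \<forall>j\<in>{0, 1}. g j \<in> orb (g i) \<longrightarrow> (\<exists>a. f j = B (n * a) (f i) \<and> g j = B (m * a) (g i))"
      by (elim exE conjE) (assumption | simp)+
    have g1: "g 1 \<noteq> B 1 (g 0)"
    proof
      assume "g 1 = B 1 (g 0)"
      then have "g 1 \<in> orb (g 0)" by simp
      then obtain a where "f 1 = B (n * a) (f 0)" using TB(3) by blast
      then show False using n1 by (simp add: f_def B_zero)
    qed
    have "\<not> pact B U v x0 x0" if U: "TB \<subseteq> U" "full U" for U
    proof
      assume "pact B U v x0 x0"
      then obtain z1 z2 where z: "pact B U w x0 z1" "pact B U [(Tg, False), (Bg, False), (Tg, True), (Bg, True)] z1 z2"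
        "pact B U w x0 z2" unfolding v_def pact_append pact_winv by blast
      have sv: "single_valued U" "single_valued (U\<inverse>)" using U(2) by (auto simp: full_def)
      have "pact B U w x0 x" using pact_mono[OF w] reach_sub[OF TB(1)] U(1) by blast
      then have "z1 = x" "z2 = x" using pact_sv[OF sv] z by blast+
      then obtain u za where u: "(x, u) \<in> U" "(za, B 1 u) \<in> U" "B (- 1) za = x" using z(2) by auto
      have "(x, g 0) \<in> U" "(B 1 x, g 1) \<in> U" using TB(2) U(1) by (auto simp: f_def B_zero)
      moreover have "za = B 1 x" using u(3) by (auto simp: B_B B_zero)
      ultimately have "u = g 0" "B 1 u = g 1" using u sv(1) by (auto simp: single_valued_def)
      then show False using g1 by simp
    qed
    then show ?thesis using reach_sub[OF TB(1)] reach_cond[OF TB(1)] by blast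
  qed
  then obtain TB where Bb: "T4 \<subseteq> TB" "cond TB" "\<forall>U. TB \<subseteq> U \<longrightarrow> full U \<longrightarrow> \<not> pact B U v x0 x0" by blast
  have "T \<subseteq> TA" "T \<subseteq> TB" using A(1) Bb(1) reach_sub[OF r] by blast+
  then show ?thesis using A(2,3) Bb(2,3) by blast
qed

lemma generic_two:
  assumes T: "cond T" and e: "surj (e :: nat \<Rightarrow> 'x)" and S: "0 \<notin> S \<or> S = {0}"
  shows "\<exists>TA TB w. T \<subseteq> TA \<and> full TA \<and> nofin TA \<and> T \<subseteq> TB \<and> full TB \<and> nofin TB \<and>
    pact B TA w x0 x0 \<and> \<not> pact B TB w x0 x0"
proof -
  have *: "\<exists>TA TB w. T \<subseteq> TA \<and> cond TA \<and> T \<subseteq> TB \<and> cond TB \<and> pact B TA w x0 x0 \<and>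
    (\<forall>U. TB \<subseteq> U \<longrightarrow> full U \<longrightarrow> \<not> pact B U w x0 x0)"
  proof (cases "S = {0} \<and> \<bar>n\<bar> < \<bar>m\<bar>")
    case False
    then show ?thesis using S by (intro two_ext[OF T]) auto
  next
    case True
    have c: "orbit_system.cond B n m (T\<inverse>)" using T by (simp add: cond_dual)
    have s: "0 \<notin> S \<or> S = {0} \<and> \<bar>n\<bar> \<le> \<bar>m\<bar>" using True by simp
    from orbit_system.two_ext[OF dual c s, of x0] obtain TA TB w where AB: "T\<inverse> \<subseteq> TA" "orbit_system.cond B n m TA"
      "T\<inverse> \<subseteq> TB" "orbit_system.cond B n m TB" "pact B TA w x0 x0"
      "\<forall>U. TB \<subseteq> U \<longrightarrow> orbit_system.full B n m U \<longrightarrow> \<not> pact B U w x0 x0"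
      by (elim exE conjE)
    have "cond (TA\<inverse>)" "cond (TB\<inverse>)" using AB(2,4) cond_dual[of "TA\<inverse>"] cond_dual[of "TB\<inverse>"] by simp_all
    moreover have "pact B (TA\<inverse>) (flipt w) x0 x0" using AB(5) by (simp add: pact_flipt)
    moreover have "\<not> pact B U (flipt w) x0 x0" if "TB\<inverse> \<subseteq> U" "full U" for U
    proof -
      have "TB \<subseteq> U\<inverse>" "orbit_system.full B n m (U\<inverse>)" using that full_dual by auto
      then have "\<not> pact B (U\<inverse>) w x0 x0" using AB(6) by blast
      then show ?thesis using pact_flipt[of B "U\<inverse>" w] by simp
    qed
    moreover have "T \<subseteq> TA\<inverse>" "T \<subseteq> TB\<inverse>" using AB(1,3) by auto
    ultimately show ?thesis by blast
  qed
  then obtain TA TB w where AB: "T \<subseteq> TA" "cond TA" "T \<subseteq> TB" "cond TB" "pact B TA w x0 x0"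
      "\<forall>U. TB \<subseteq> U \<longrightarrow> full U \<longrightarrow> \<not> pact B U w x0 x0"
      by (elim exE conjE)
  obtain UA where UA: "TA \<subseteq> UA" "full UA" "nofin UA" using generic[OF AB(2) e, of "\<lambda>_ _. True"] by blast
  obtain UB where UB: "TB \<subseteq> UB" "full UB" "nofin UB" using generic[OF AB(4) e, of "\<lambda>_ _. True"] by blast
  have "T \<subseteq> UA" "T \<subseteq> UB" using AB UA UB by blast+
  moreover have "pact B UA w x0 x0" using pact_mono[OF AB(5) UA(1)] .
  ultimately show ?thesis using UA UB AB(6) by (intro exI[of _ UA] exI[of _ UB] exI[of _ w]) simp
qed

end

section \<open>The group and its point stabilisers\<close>

definition bcls :: "int \<Rightarrow> int \<Rightarrow> word \<Rightarrow> word set" where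
  "bcls m n w = bsR m n `` {w}"

lemma bs_rel_context: "bs_rel m n u v \<Longrightarrow> bs_rel m n (x @ u @ y) (x @ v @ y)"
proof (induction rule: bs_rel.induct)
  case (bs_cancel u g s v)
  show ?case using bs_rel.bs_cancel[of m n "x @ u" g s "v @ y"] by simp
next
  case (bs_relator u v)
  show ?case using bs_rel.bs_relator[of m n "x @ u" "v @ y"] by simp
qed (auto intro: bs_rel.intros)

lemma bs_rel_append: "bs_rel m n u u' \<Longrightarrow> bs_rel m n v v' \<Longrightarrow> bs_rel m n (u @ v) (u' @ v')"
  using bs_rel_context[of m n u u' "[]" v] bs_rel_context[of m n v v' u' "[]"] by (auto intro: bs_trans)

lemma equiv_bsR: "equiv UNIV (bsR m n)"
  by (rule equivI) (auto simp: bsR_def refl_on_def sym_def trans_def intro: bs_rel.intros)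

lemma bcls_eq: "bcls m n u = bcls m n v \<longleftrightarrow> bs_rel m n u v"
  unfolding bcls_def using eq_equiv_class_iff[OF equiv_bsR] by (simp add: bsR_def)

lemma mem_bcls: "v \<in> bcls m n u \<longleftrightarrow> bs_rel m n u v"
  by (simp add: bcls_def bsR_def)

lemma carrier_BS: "carrier (BS m n) = range (bcls m n)"
  by (auto simp: BS_def bcls_def quotient_def)

lemma bcls_carrier [simp]: "bcls m n w \<in> carrier (BS m n)"
  by (simp add: carrier_BS)

lemma bgen_carrier: "bgen m n \<in> carrier (BS m n)"
  using bcls_carrier[of m n "[(Bg, False)]"] by (simp add: bgen_def bcls_def)

lemma one_BS: "\<one>\<^bsub>BS m n\<^esub> = bcls m n []"
  by (simp add: BS_def bcls_def)

lemma mult_BS [simp]: "bcls m n u \<otimes>\<^bsub>BS m n\<^esub> bcls m n v = bcls m n (u @ v)"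
proof -
  have "bcls m n u \<otimes>\<^bsub>BS m n\<^esub> bcls m n v = bsR m n `` {a @ b | a b. a \<in> bcls m n u \<and> b \<in> bcls m n v}"
    by (simp add: BS_def)
  also have "\<dots> = bcls m n (u @ v)"
  proof (rule equalityI; rule subsetI)
    fix w assume "w \<in> bsR m n `` {a @ b | a b. a \<in> bcls m n u \<and> b \<in> bcls m n v}"
    then obtain a b where "bs_rel m n u a" "bs_rel m n v b" "bs_rel m n (a @ b) w"
      by (auto simp: mem_bcls bsR_def)
    then show "w \<in> bcls m n (u @ v)" unfolding mem_bcls using bs_rel_append bs_trans by blast
  next
    fix w assume "w \<in> bcls m n (u @ v)"
    then have "(u @ v, w) \<in> bsR m n" by (simp add: mem_bcls bsR_def)
    moreover have "u \<in> bcls m n u" "v \<in> bcls m n v" by (simp_all add: mem_bcls bs_refl)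
    ultimately show "w \<in> bsR m n `` {a @ b | a b. a \<in> bcls m n u \<and> b \<in> bcls m n v}" by blast
  qed
  finally show ?thesis .
qed

lemma winv_left: "bs_rel m n (winv w @ w) []"
proof (induction w)
  case Nil then show ?case by (simp add: winv_def bs_refl)
next
  case (Cons a w)
  obtain g s where a: "a = (g, s)" by force
  have e: "winv (a # w) @ a # w = winv w @ [(g, \<not> s), (g, \<not> (\<not> s))] @ w" by (simp add: winv_def a)
  have "bs_rel m n (winv (a # w) @ a # w) (winv w @ w)" unfolding e by (rule bs_cancel)
  then show ?case using Cons bs_trans by blast
qed

lemma group_BS: "group (BS m n)"
proof (rule groupI)
  show "x \<otimes>\<^bsub>BS m n\<^esub> y \<in> carrier (BS m n)" if "x \<in> carrier (BS m n)" "y \<in> carrier (BS m n)" for x y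
    using that by (auto simp: carrier_BS)
  show "\<one>\<^bsub>BS m n\<^esub> \<in> carrier (BS m n)" by (simp add: one_BS)
  show "x \<otimes>\<^bsub>BS m n\<^esub> y \<otimes>\<^bsub>BS m n\<^esub> z = x \<otimes>\<^bsub>BS m n\<^esub> (y \<otimes>\<^bsub>BS m n\<^esub> z)"
    if "x \<in> carrier (BS m n)" "y \<in> carrier (BS m n)" "z \<in> carrier (BS m n)" for x y z
    using that by (auto simp: carrier_BS)
  show "\<one>\<^bsub>BS m n\<^esub> \<otimes>\<^bsub>BS m n\<^esub> x = x" if "x \<in> carrier (BS m n)" for x
    using that by (auto simp: carrier_BS one_BS)
  show "\<exists>y\<in>carrier (BS m n). y \<otimes>\<^bsub>BS m n\<^esub> x = \<one>\<^bsub>BS m n\<^esub>" if x: "x \<in> carrier (BS m n)" for x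
  proof -
    obtain w where "x = bcls m n w" using x by (auto simp: carrier_BS)
    then have "bcls m n (winv w) \<otimes>\<^bsub>BS m n\<^esub> x = \<one>\<^bsub>BS m n\<^esub>" by (simp add: one_BS bcls_eq winv_left)
    then show ?thesis by (intro bexI[of _ "bcls m n (winv w)"]) simp_all
  qed
qed

lemma inv_BS [simp]: "inv\<^bsub>BS m n\<^esub> bcls m n w = bcls m n (winv w)"
proof -
  interpret group "BS m n" by (rule group_BS)
  have "bcls m n (winv w) \<otimes>\<^bsub>BS m n\<^esub> bcls m n w = \<one>\<^bsub>BS m n\<^esub>" by (simp add: one_BS bcls_eq winv_left)
  then show ?thesis using inv_equality by simp
qed

lemma winv_bpow: "winv (bpow k) = bpow (- k)"
  by (simp add: winv_def bpow_def map_replicate_const) (auto simp: map_replicate_const)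

lemma bcls_bpow: "bcls m n (bpow k) = bgen m n [^]\<^bsub>BS m n\<^esub> k"
proof -
  interpret group "BS m n" by (rule group_BS)
  have b: "bgen m n = bcls m n [(Bg, False)]" by (simp add: bgen_def bcls_def)
  have nat: "bcls m n (replicate j (Bg, False)) = bgen m n [^]\<^bsub>BS m n\<^esub> j" for j
  proof (induction j)
    case (Suc j)
    have "bcls m n (replicate (Suc j) (Bg, False)) = bcls m n (replicate j (Bg, False) @ [(Bg, False)])"
      by (simp add: replicate_append_same)
    also have "\<dots> = bgen m n [^]\<^bsub>BS m n\<^esub> j \<otimes>\<^bsub>BS m n\<^esub> bgen m n" using Suc by (simp add: b flip: mult_BS)
    finally show ?case by simp
  qed (simp add: one_BS)
  have pos: "bcls m n (bpow (int j)) = bgen m n [^]\<^bsub>BS m n\<^esub> int j" for j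
    by (simp add: bpow_def nat int_pow_int)
  show ?thesis
  proof (cases "k \<ge> 0")
    case True then show ?thesis using pos[of "nat k"] by simp
  next
    case False
    then obtain j where k: "k = - int j" by (metis int_cases2 nle_le of_nat_0_le_iff)
    have "bcls m n (bpow k) = inv\<^bsub>BS m n\<^esub> bcls m n (bpow (int j))" by (simp add: winv_bpow k)
    also have "\<dots> = bgen m n [^]\<^bsub>BS m n\<^esub> k" unfolding pos k using int_pow_neg[of "bgen m n"] by (simp add: b)
    finally show ?thesis .
  qed
qed

lemma bcls_bpow_add: "bcls m n (bpow j @ bpow k) = bcls m n (bpow (j + k))"
proof -
  interpret group "BS m n" by (rule group_BS)
  have "bgen m n \<in> carrier (BS m n)" by (rule bgen_carrier)
  then show ?thesis by (simp add: bcls_bpow int_pow_mult flip: mult_BS)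
qed

lemma bcls_cong: "bcls m n u = bcls m n u' \<Longrightarrow> bcls m n v = bcls m n v' \<Longrightarrow> bcls m n (u @ v) = bcls m n (u' @ v')"
  by (simp flip: mult_BS)

lemma bcls_relator: "bcls m n (bpow n @ [(Tg, False)]) = bcls m n ([(Tg, False)] @ bpow m)"
proof -
  have 1: "bs_rel m n ([(Tg, False)] @ bpow m @ [(Tg, True), (Tg, False)]) (bpow n @ [(Tg, False)])"
    using bs_relator[of m n "[]" "[(Tg, False)]"] by simp
  have 2: "bs_rel m n ([(Tg, False)] @ bpow m @ [(Tg, True), (Tg, False)]) ([(Tg, False)] @ bpow m)"
    using bs_cancel[of m n "[(Tg, False)] @ bpow m" Tg True "[]"] by simp
  show ?thesis unfolding bcls_eq using bs_trans[OF bs_sym[OF 1] 2] .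
qed

lemma bcls_relator_pow: "bcls m n (bpow (n * k) @ [(Tg, False)]) = bcls m n ([(Tg, False)] @ bpow (m * k))"
proof -
  interpret group "BS m n" by (rule group_BS)
  let ?t = "bcls m n [(Tg, False)]"
  let ?x = "bcls m n (bpow n)" and ?y = "bcls m n (bpow m)"
  have b: "bgen m n \<in> carrier (BS m n)" by (rule bgen_carrier)
  have rel: "?x \<otimes>\<^bsub>BS m n\<^esub> ?t = ?t \<otimes>\<^bsub>BS m n\<^esub> ?y" using bcls_relator[of m n] by simp
  have nat: "?x [^]\<^bsub>BS m n\<^esub> j \<otimes>\<^bsub>BS m n\<^esub> ?t = ?t \<otimes>\<^bsub>BS m n\<^esub> ?y [^]\<^bsub>BS m n\<^esub> j" for j :: nat
  proof (induction j)
    case 0 show ?case by simp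
  next
    case (Suc j)
    have "?x [^]\<^bsub>BS m n\<^esub> Suc j \<otimes>\<^bsub>BS m n\<^esub> ?t = ?x [^]\<^bsub>BS m n\<^esub> j \<otimes>\<^bsub>BS m n\<^esub> (?x \<otimes>\<^bsub>BS m n\<^esub> ?t)"
      by (simp add: m_assoc del: mult_BS)
    also have "\<dots> = (?x [^]\<^bsub>BS m n\<^esub> j \<otimes>\<^bsub>BS m n\<^esub> ?t) \<otimes>\<^bsub>BS m n\<^esub> ?y" unfolding rel by (simp add: m_assoc del: mult_BS)
    also have "\<dots> = ?t \<otimes>\<^bsub>BS m n\<^esub> ?y [^]\<^bsub>BS m n\<^esub> Suc j" unfolding Suc by (simp add: m_assoc del: mult_BS)
    finally show ?case .
  qed
  have pow: "bcls m n (bpow (c * k)) = bcls m n (bpow c) [^]\<^bsub>BS m n\<^esub> k" for c k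
    unfolding bcls_bpow using int_pow_pow[OF b] by simp
  have "?x [^]\<^bsub>BS m n\<^esub> k \<otimes>\<^bsub>BS m n\<^esub> ?t = ?t \<otimes>\<^bsub>BS m n\<^esub> ?y [^]\<^bsub>BS m n\<^esub> k"
  proof (cases "k \<ge> 0")
    case True
    then show ?thesis using nat[of "nat k"] by (simp add: pow_nat)
  next
    case False
    define j where "j = nat (- k)"
    have k: "k = - int j" using False by (simp add: j_def)
    have "?t = inv\<^bsub>BS m n\<^esub> (?x [^]\<^bsub>BS m n\<^esub> j) \<otimes>\<^bsub>BS m n\<^esub> (?x [^]\<^bsub>BS m n\<^esub> j \<otimes>\<^bsub>BS m n\<^esub> ?t)"
      by (simp add: m_assoc[symmetric] del: mult_BS inv_BS)
    also have "\<dots> = inv\<^bsub>BS m n\<^esub> (?x [^]\<^bsub>BS m n\<^esub> j) \<otimes>\<^bsub>BS m n\<^esub> ?t \<otimes>\<^bsub>BS m n\<^esub> ?y [^]\<^bsub>BS m n\<^esub> j"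
      unfolding nat by (simp add: m_assoc del: mult_BS inv_BS)
    finally have "?t \<otimes>\<^bsub>BS m n\<^esub> inv\<^bsub>BS m n\<^esub> (?y [^]\<^bsub>BS m n\<^esub> j) =
       inv\<^bsub>BS m n\<^esub> (?x [^]\<^bsub>BS m n\<^esub> j) \<otimes>\<^bsub>BS m n\<^esub> ?t \<otimes>\<^bsub>BS m n\<^esub> ?y [^]\<^bsub>BS m n\<^esub> j \<otimes>\<^bsub>BS m n\<^esub> inv\<^bsub>BS m n\<^esub> (?y [^]\<^bsub>BS m n\<^esub> j)"
      by simp
    also have "\<dots> = inv\<^bsub>BS m n\<^esub> (?x [^]\<^bsub>BS m n\<^esub> j) \<otimes>\<^bsub>BS m n\<^esub> ?t" by (simp add: m_assoc del: mult_BS inv_BS)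
    finally show ?thesis unfolding k by (simp add: int_pow_neg int_pow_int del: mult_BS inv_BS)
  qed
  then show ?thesis unfolding mult_BS[symmetric] pow .
qed

lemma rcos_eq_iff:
  fixes G (structure)
  assumes "group G" "subgroup H G" "a \<in> carrier G" "b \<in> carrier G"
  shows "H #>\<^bsub>G\<^esub> a = H #>\<^bsub>G\<^esub> b \<longleftrightarrow> a \<otimes>\<^bsub>G\<^esub> inv\<^bsub>G\<^esub> b \<in> H"
proof -
  interpret group G by fact
  have H: "H \<subseteq> carrier G" using assms(2) subgroup.subset by blast
  show ?thesis
  proof
    assume "H #> a = H #> b"
    then have "H #> (a \<otimes> inv b) = H" using coset_mult_inv2[OF _ assms(3,4) H] by simp
    then show "a \<otimes> inv b \<in> H" using coset_join1[OF _ _ assms(2)] assms by simp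
  next
    assume "a \<otimes> inv b \<in> H"
    then have "H #> (a \<otimes> inv b) = H" using coset_join2[OF _ assms(2)] assms by simp
    then show "H #> a = H #> b" using coset_mult_inv1[OF _ assms(3,4) H] by simp
  qed
qed

lemma bcyc_eq: "bcyc m n = range (\<lambda>k. bcls m n (bpow k))"
proof -
  interpret group "BS m n" by (rule group_BS)
  have "bgen m n \<in> carrier (BS m n)" by (rule bgen_carrier)
  then show ?thesis unfolding bcyc_def bcls_bpow using generate_pow by auto
qed

lemma b_index_eq:
  assumes L: "subgroup \<Lambda> (BS m n)" and N: "\<And>k. bcls m n (bpow k) \<in> \<Lambda> \<longleftrightarrow> int N dvd k"
  shows "b_index m n \<Lambda> = (if N = 0 then \<infinity> else enat N)"
proof -
  interpret group "BS m n" by (rule group_BS)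
  have b: "bgen m n \<in> carrier (BS m n)" by (rule bgen_carrier)
  define H where "H = bcyc m n \<inter> \<Lambda>"
  have "subgroup (bcyc m n) (BS m n)" unfolding bcyc_def using generate_is_subgroup b by simp
  then have H: "subgroup H (BS m n)" unfolding H_def using L subgroups_Inter_pair by blast
  define \<phi> where "\<phi> = (\<lambda>k. H #>\<^bsub>BS m n\<^esub> bcls m n (bpow k))"
  have phi: "\<phi> j = \<phi> k \<longleftrightarrow> int N dvd j - k" for j k
  proof -
    have "\<phi> j = \<phi> k \<longleftrightarrow> bcls m n (bpow (j - k)) \<in> H"
      unfolding \<phi>_def using rcos_eq_iff[OF group_BS H bcls_carrier bcls_carrier]
      by (simp add: winv_bpow bcls_bpow_add)
    also have "\<dots> \<longleftrightarrow> int N dvd j - k" using N by (auto simp: H_def bcyc_eq)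
    finally show ?thesis .
  qed
  have C: "rcosets\<^bsub>(BS m n)\<lparr>carrier := bcyc m n\<rparr>\<^esub> (bcyc m n \<inter> \<Lambda>) = range \<phi>"
    by (auto simp: RCOSETS_def r_coset_def \<phi>_def H_def bcyc_eq)
  show ?thesis
  proof (cases "N = 0")
    case True
    then have "inj \<phi>" using phi by (auto simp: inj_def)
    then have "infinite (range \<phi>)" using finite_imageD infinite_UNIV_int by blast
    then show ?thesis unfolding b_index_def C Let_def using True by simp
  next
    case False
    have "range \<phi> = \<phi> ` {0..<int N}"
    proof
      show "range \<phi> \<subseteq> \<phi> ` {0..<int N}"
      proof (rule image_subsetI)
        fix k
        have "\<phi> k = \<phi> (k mod int N)" unfolding phi by (simp add: minus_mod_eq_mult_div)
        then show "\<phi> k \<in> \<phi> ` {0..<int N}" using False by simp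
      qed
    qed auto
    moreover have "inj_on \<phi> {0..<int N}"
    proof (rule inj_onI)
      fix j k assume jk: "j \<in> {0..<int N}" "k \<in> {0..<int N}" "\<phi> j = \<phi> k"
      then have "int N dvd j - k" using phi by blast
      then have "j mod int N = k mod int N" by (rule mod_eq_dvd_iff[THEN iffD2])
      then show "j = k" using jk by simp
    qed
    ultimately have "finite (range \<phi>)" "card (range \<phi>) = N" by (simp_all add: card_image)
    then show ?thesis unfolding b_index_def C Let_def using False by simp
  qed
qed

lemma rcosets_BS: "rcosets\<^bsub>BS m n\<^esub> \<Lambda> = range (\<lambda>w. \<Lambda> #>\<^bsub>BS m n\<^esub> bcls m n w)"
  by (auto simp: RCOSETS_def carrier_BS)

lemma rcos_bcls_eq:
  assumes "subgroup \<Lambda> (BS m n)"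
  shows "\<Lambda> #>\<^bsub>BS m n\<^esub> bcls m n u = \<Lambda> #>\<^bsub>BS m n\<^esub> bcls m n v \<longleftrightarrow> bcls m n (u @ winv v) \<in> \<Lambda>"
  using rcos_eq_iff[OF group_BS assms bcls_carrier bcls_carrier] by simp

lemma rcos_bcls_mult:
  assumes "subgroup \<Lambda> (BS m n)"
  shows "\<Lambda> #>\<^bsub>BS m n\<^esub> bcls m n u #>\<^bsub>BS m n\<^esub> bcls m n v = \<Lambda> #>\<^bsub>BS m n\<^esub> bcls m n (u @ v)"
proof -
  interpret group "BS m n" by (rule group_BS)
  show ?thesis using coset_mult_assoc[OF subgroup.subset[OF assms] bcls_carrier bcls_carrier] by simp
qed

definition inf_bcosets :: "int \<Rightarrow> int \<Rightarrow> word set set \<Rightarrow> bool" where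
  "inf_bcosets m n \<Lambda> \<longleftrightarrow> (\<forall>F. finite F \<longrightarrow> (\<exists>w. \<forall>f\<in>F. \<forall>k. \<Lambda> #>\<^bsub>BS m n\<^esub> bcls m n w \<noteq> \<Lambda> #>\<^bsub>BS m n\<^esub> bcls m n (f @ bpow k)))"

context orbit_system
begin

lemma full_sv: "full T \<Longrightarrow> single_valued T" and full_inj: "full T \<Longrightarrow> single_valued (T\<inverse>)"
  by (auto simp: full_def)

lemma lstep_total:
  assumes "full T" shows "\<exists>y. lstep B T a x y"
proof -
  obtain g s where a: "a = (g, s)" by force
  have "x \<in> Domain T" "x \<in> Range T" using assms by (auto simp: full_def)
  then show ?thesis by (cases g; cases s) (auto simp: a)
qed

lemma pact_total:
  assumes "full T" shows "\<exists>y. pact B T w x y"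
proof (induction w arbitrary: x)
  case (Cons a w)
  obtain z where "lstep B T a x z" using lstep_total[OF assms] by blast
  moreover obtain y where "pact B T w z y" using Cons by blast
  ultimately show ?case by auto
qed auto

lemma pact_bs_rel:
  assumes T: "full T" and r: "bs_rel m n u v"
  shows "pact B T u x y \<longleftrightarrow> pact B T v x y"
  using r
proof (induction arbitrary: x y rule: bs_rel.induct)
  case (bs_cancel u g s v)
  have "pact B T [(g, s), (g, \<not> s)] p q \<longleftrightarrow> p = q" for p q
  proof -
    have "winv [(g, s)] = [(g, \<not> s)]" by (simp add: winv_def)
    then have "pact B T ([(g, s)] @ [(g, \<not> s)]) p q \<longleftrightarrow> (\<exists>z. pact B T [(g, s)] p z \<and> pact B T [(g, s)] q z)"
      unfolding pact_append by (metis pact_winv)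
    also have "\<dots> \<longleftrightarrow> p = q" using pact_total[OF T] pact_inj[OF full_sv[OF T] full_inj[OF T]] by blast
    finally show ?thesis by simp
  qed
  then show ?case unfolding pact_append by simp
next
  case (bs_relator u v)
  have "pact B T ([(Tg, False)] @ bpow m @ [(Tg, True)]) p q \<longleftrightarrow> pact B T (bpow n) p q" for p q
  proof -
    obtain z where z: "(p, z) \<in> T" using T unfolding full_def by blast
    have nz: "(B n p, B m z) \<in> T" using T z unfolding full_def by (metis mult.right_neutral)
    have "pact B T ([(Tg, False)] @ bpow m @ [(Tg, True)]) p q \<longleftrightarrow> (\<exists>z'. (p, z') \<in> T \<and> (q, B m z') \<in> T)"
      unfolding pact_append pact_bpow by auto
    also have "\<dots> \<longleftrightarrow> (q, B m z) \<in> T" using z full_sv[OF T] unfolding single_valued_def by blast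
    also have "\<dots> \<longleftrightarrow> q = B n p" using nz full_inj[OF T] unfolding single_valued_def by blast
    finally show ?thesis by (simp add: pact_bpow)
  qed
  then show ?case unfolding pact_append[of B T u] pact_append[of B T _ v] by simp
qed auto

definition stab :: "('x \<times> 'x) set \<Rightarrow> 'x \<Rightarrow> word set set" where
  "stab T x0 = bcls m n ` {w. pact B T w x0 x0}"

lemma mem_stab: "full T \<Longrightarrow> bcls m n w \<in> stab T x0 \<longleftrightarrow> pact B T w x0 x0"
  unfolding stab_def using pact_bs_rel by (auto simp: bcls_eq)

lemma subgroup_stab:
  assumes T: "full T" shows "subgroup (stab T x0) (BS m n)"
proof -
  interpret group "BS m n" by (rule group_BS)
  show ?thesis
  proof (rule subgroupI)
    show "stab T x0 \<subseteq> carrier (BS m n)" by (auto simp: stab_def)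
    show "stab T x0 \<noteq> {}" unfolding stab_def by (auto intro: exI[of _ "[]"])
    show "inv\<^bsub>BS m n\<^esub> a \<in> stab T x0" if "a \<in> stab T x0" for a
      using that by (auto simp: stab_def pact_winv)
    show "a \<otimes>\<^bsub>BS m n\<^esub> b \<in> stab T x0" if ab: "a \<in> stab T x0" "b \<in> stab T x0" for a b
    proof -
      obtain u v where "a = bcls m n u" "b = bcls m n v" "pact B T u x0 x0" "pact B T v x0 x0"
        using ab by (auto simp: stab_def)
      then show ?thesis unfolding stab_def by (auto simp: pact_append intro!: imageI)
    qed
  qed
qed

lemma rcos_stab_eq:
  assumes T: "full T"
  shows "stab T x0 #>\<^bsub>BS m n\<^esub> bcls m n u = stab T x0 #>\<^bsub>BS m n\<^esub> bcls m n v \<longleftrightarrow> (\<exists>y. pact B T u x0 y \<and> pact B T v x0 y)"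
  unfolding rcos_bcls_eq[OF subgroup_stab[OF T]] mem_stab[OF T] pact_append pact_winv ..

lemma b_index_stab:
  assumes T: "full T" shows "b_index m n (stab T x0) = (if sz x0 = 0 then \<infinity> else enat (sz x0))"
proof (rule b_index_eq[OF subgroup_stab[OF T]])
  fix k
  have "bcls m n (bpow k) \<in> stab T x0 \<longleftrightarrow> x0 = B k x0" by (simp add: mem_stab[OF T] pact_bpow)
  also have "\<dots> \<longleftrightarrow> B k x0 = x0" by auto
  finally show "bcls m n (bpow k) \<in> stab T x0 \<longleftrightarrow> int (sz x0) dvd k" by (simp add: B_fix)
qed

lemma inf_bcosets_stab:
  assumes T: "full T" and nf: "nofin T" shows "inf_bcosets m n (stab T x0)"
  unfolding inf_bcosets_def
proof (intro allI impI, rule ccontr)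
  fix W :: "word set" assume W: "finite W"
  assume "\<nexists>w. \<forall>f\<in>W. \<forall>k. stab T x0 #>\<^bsub>BS m n\<^esub> bcls m n w \<noteq> stab T x0 #>\<^bsub>BS m n\<^esub> bcls m n (f @ bpow k)"
  then have cov: "\<exists>f\<in>W. \<exists>k y. pact B T w x0 y \<and> pact B T (f @ bpow k) x0 y" for w
    using rcos_stab_eq[OF T] by metis
  note sv = pact_sv[OF full_sv[OF T] full_inj[OF T]]
  define C where "C = {y. \<exists>w. pact B T w x0 y}"
  have "\<forall>f. \<exists>y. pact B T f x0 y" using pact_total[OF T] by blast
  then obtain ev where ev: "\<And>f. pact B T f x0 (ev f)" by metis
  have step: "z \<in> C" if y: "y \<in> C" "pact B T v y z" for y z v
  proof -
    obtain w where "pact B T w x0 y" using y(1) by (auto simp: C_def)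
    then have "pact B T (w @ v) x0 z" using y(2) unfolding pact_append by blast
    then show ?thesis by (auto simp: C_def)
  qed
  have "x0 \<in> C" unfolding C_def by (auto intro: exI[of _ "[]"])
  then have 1: "C \<noteq> {}" by blast
  have 2: "\<forall>x\<in>C. orb x \<subseteq> C"
  proof (intro ballI subsetI)
    fix x y assume "x \<in> C" "y \<in> orb x"
    then show "y \<in> C" using step[of x "bpow _" y] by (auto simp: orb_iff pact_bpow)
  qed
  have 3: "C \<subseteq> (\<Union>f\<in>ev ` W. orb f)"
  proof
    fix y assume "y \<in> C"
    then obtain w where w: "pact B T w x0 y" by (auto simp: C_def)
    obtain f k y' where f: "f \<in> W" "pact B T w x0 y'" "pact B T (f @ bpow k) x0 y'" using cov[of w] by blast
    then have "y' = y" using sv w by blast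
    then obtain z where "pact B T f x0 z" "y = B k z" using f(3) by (auto simp: pact_append pact_bpow)
    moreover have "z = ev f" using sv[OF calculation(1) ev] .
    ultimately have "y \<in> orb (ev f)" by simp
    then show "y \<in> (\<Union>f\<in>ev ` W. orb f)" using f(1) by blast
  qed
  have 4: "T `` C \<subseteq> C"
  proof
    fix y assume "y \<in> T `` C"
    then obtain x where "x \<in> C" "(x, y) \<in> T" by blast
    then show "y \<in> C" using step[of x "[(Tg, False)]" y] by simp
  qed
  have 5: "T\<inverse> `` C \<subseteq> C"
  proof
    fix y assume "y \<in> T\<inverse> `` C"
    then obtain x where "x \<in> C" "(y, x) \<in> T" by blast
    then show "y \<in> C" using step[of x "[(Tg, True)]" y] by simp
  qed
  have "finite (ev ` W)" using W by simp
  from nf[unfolded nofin_def, rule_format, OF 1 bspec[OF 2] this 3 4 5] show False .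
qed

lemma highly_transitive_stab:
  assumes T: "full T" and ht: "htrans T" and inf: "infinite (UNIV :: 'x set)"
  shows "highly_transitive m n (stab T x0)"
proof -
  let ?L = "stab T x0"
  note sub = subgroup_stab[OF T, of x0]
  note sv = pact_sv[OF full_sv[OF T] full_inj[OF T]]
  have "\<exists>w. pact B T w x0 y" for y
  proof -
    have "\<exists>w. \<forall>i<length [x0]. pact B T w ([x0] ! i) ([y] ! i)"
      by (rule ht[unfolded htrans_def, rule_format]) simp_all
    then show ?thesis by simp
  qed
  then have "\<forall>y. \<exists>w. pact B T w x0 y" by blast
  then obtain wd where wd: "\<And>y. pact B T (wd y) x0 y" by metis
  define c where "c = (\<lambda>y. ?L #>\<^bsub>BS m n\<^esub> bcls m n (wd y))"
  have c_eq: "?L #>\<^bsub>BS m n\<^esub> bcls m n u = c y \<longleftrightarrow> pact B T u x0 y" for u y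
    unfolding c_def rcos_stab_eq[OF T] using wd[of y] sv[of "wd y" x0 y] by blast
  have inj: "inj c"
  proof (rule injI)
    fix y z assume "c y = c z"
    then have "pact B T (wd y) x0 z" using c_eq[of "wd y" z] by (simp add: c_def)
    then show "y = z" using sv wd by blast
  qed
  have surj: "rcosets\<^bsub>BS m n\<^esub> ?L = range c"
  proof
    show "rcosets\<^bsub>BS m n\<^esub> ?L \<subseteq> range c" unfolding rcosets_BS
    proof (rule image_subsetI)
      fix w
      obtain y where "pact B T w x0 y" using pact_total[OF T] by blast
      then have "?L #>\<^bsub>BS m n\<^esub> bcls m n w = c y" using c_eq by blast
      then show "?L #>\<^bsub>BS m n\<^esub> bcls m n w \<in> range c" by simp
    qed
    show "range c \<subseteq> rcosets\<^bsub>BS m n\<^esub> ?L" unfolding rcosets_BS c_def by auto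
  qed
  show ?thesis unfolding highly_transitive_def
  proof (intro conjI allI impI)
    show "infinite (rcosets\<^bsub>BS m n\<^esub> ?L)" unfolding surj using inj inf finite_imageD by blast
    fix xs ys
    assume A: "length xs = length ys \<and> distinct xs \<and> distinct ys \<and> set xs \<subseteq> rcosets\<^bsub>BS m n\<^esub> ?L \<and> set ys \<subseteq> rcosets\<^bsub>BS m n\<^esub> ?L"
    have "\<forall>x\<in>set xs. \<exists>a. x = c a" "\<forall>x\<in>set ys. \<exists>a. x = c a" using A unfolding surj by blast+
    then obtain as bs where as: "xs = map c as" and bs: "ys = map c bs" unfolding ex_map_conv[symmetric] by blast
    have "length as = length bs" "distinct as" "distinct bs" using A as bs by (auto simp: distinct_map)
    then obtain w where w: "\<forall>i<length as. pact B T w (as ! i) (bs ! i)" using ht unfolding htrans_def by blast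
    have "xs ! i #>\<^bsub>BS m n\<^esub> bcls m n w = ys ! i" if i: "i < length xs" for i
    proof -
      have "xs ! i = c (as ! i)" "ys ! i = c (bs ! i)" using i as bs \<open>length as = length bs\<close> by simp_all
      moreover have "c (as ! i) #>\<^bsub>BS m n\<^esub> bcls m n w = ?L #>\<^bsub>BS m n\<^esub> bcls m n (wd (as ! i) @ w)"
        unfolding c_def by (rule rcos_bcls_mult[OF sub])
      moreover have "pact B T (wd (as ! i) @ w) x0 (bs ! i)" using wd w i as by (auto simp: pact_append)
      ultimately show ?thesis using c_eq by simp
    qed
    then show "\<exists>\<gamma>\<in>carrier (BS m n). \<forall>i<length xs. xs ! i #>\<^bsub>BS m n\<^esub> \<gamma> = ys ! i"
      by (intro bexI[of _ "bcls m n w"]) auto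
  qed
qed

end

section \<open>Orbit lengths and phenotypes\<close>

lemma multiplicity_gcd_nat:
  fixes a b p :: nat assumes "prime p" "a > 0" "b > 0"
  shows "multiplicity p (gcd a b) = min (multiplicity p a) (multiplicity p b)"
proof -
  have p: "\<not> is_unit p" using assms(1) not_prime_unit by blast
  have "i \<le> multiplicity p (gcd a b) \<longleftrightarrow> i \<le> min (multiplicity p a) (multiplicity p b)" for i
    using assms p by (simp flip: power_dvd_iff_le_multiplicity)
  then show ?thesis by (metis nle_le)
qed

lemma multiplicity_div_gcd_nat:
  fixes a b p :: nat assumes "prime p" "a > 0" "b > 0"
  shows "multiplicity p (a div gcd a b) = multiplicity p a - multiplicity p b"
proof -
  have "a = gcd a b * (a div gcd a b)" by simp
  moreover have "gcd a b \<noteq> 0" "a div gcd a b \<noteq> 0" using assms by (auto simp: dvd_div_eq_0_iff)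
  ultimately have "multiplicity p a = multiplicity p (gcd a b) + multiplicity p (a div gcd a b)"
    using prime_elem_multiplicity_mult_distrib[of p "gcd a b" "a div gcd a b"] assms(1) by simp
  then show ?thesis using multiplicity_gcd_nat[OF assms] by simp
qed

definition orbit_sizes :: "int \<Rightarrow> int \<Rightarrow> enat \<Rightarrow> nat set" where
  "orbit_sizes m n q = (if q = \<infinity> then {0} else {N. N > 0 \<and> Ph m n (enat N) = q})"

lemma Ph_infinity: "Ph m n \<infinity> = \<infinity>" by (simp add: Ph_def)

lemma Ph_enat: "Ph m n (enat l) = enat (\<Prod>p\<in>ph_primes m n l. p ^ multiplicity p l)" by (simp add: Ph_def)

lemma mem_orbit_sizes_iff: "N \<in> orbit_sizes m n q \<longleftrightarrow> Ph m n (if N = 0 then \<infinity> else enat N) = q"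
  by (auto simp: orbit_sizes_def Ph_infinity Ph_enat)

lemma edge_compat_zero: "m \<noteq> 0 \<Longrightarrow> n \<noteq> 0 \<Longrightarrow> edge_compat n m N M \<Longrightarrow> N = 0 \<longleftrightarrow> M = 0"
proof -
  assume mn: "m \<noteq> 0" "n \<noteq> 0" and c: "edge_compat n m N M"
  have "int N dvd n * int M" "int M dvd m * int N"
    using c[unfolded edge_compat_def, rule_format, of "int M"] c[unfolded edge_compat_def, rule_format, of "int N"] by simp_all
  then show ?thesis using mn by auto
qed

lemma edge_compat_multiplicity:
  assumes mn: "m \<noteq> 0" "n \<noteq> 0" and c: "edge_compat n m N M" and p: "prime p" and N: "N > 0"
    and e: "multiplicity p (nat \<bar>m\<bar>) = multiplicity p (nat \<bar>n\<bar>)" "multiplicity p N > multiplicity p (nat \<bar>n\<bar>)"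
  shows "multiplicity p M = multiplicity p N"
proof -
  have M: "M > 0" using edge_compat_zero[OF mn c] N by simp
  have "N div gcd N (nat \<bar>n\<bar>) = M div gcd M (nat \<bar>m\<bar>)" using c unfolding edge_compat_iff[OF mn] .
  then have "multiplicity p (N div gcd N (nat \<bar>n\<bar>)) = multiplicity p (M div gcd M (nat \<bar>m\<bar>))" by (rule arg_cong)
  moreover have "multiplicity p (N div gcd N (nat \<bar>n\<bar>)) = multiplicity p N - multiplicity p (nat \<bar>n\<bar>)"
    using mn N p by (intro multiplicity_div_gcd_nat) auto
  moreover have "multiplicity p (M div gcd M (nat \<bar>m\<bar>)) = multiplicity p M - multiplicity p (nat \<bar>m\<bar>)"
    using mn M p by (intro multiplicity_div_gcd_nat) auto
  ultimately have "multiplicity p N - multiplicity p (nat \<bar>n\<bar>) = multiplicity p M - multiplicity p (nat \<bar>n\<bar>)"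
    using e(1) by metis
  then show ?thesis using e(2) by linarith
qed

lemma edge_compat_Ph:
  assumes mn: "m \<noteq> 0" "n \<noteq> 0" and c: "edge_compat n m N M" and N: "N > 0"
  shows "Ph m n (enat N) = Ph m n (enat M)"
proof -
  have M: "M > 0" using edge_compat_zero[OF mn c] N by simp
  have c': "edge_compat m n M N" using c edge_compat_sym by blast
  have 1: "p \<in> ph_primes m n M \<and> multiplicity p M = multiplicity p N" if "p \<in> ph_primes m n N" for p
    using edge_compat_multiplicity[OF mn c _ N] that by (auto simp: ph_primes_def)
  have 2: "p \<in> ph_primes m n N" if "p \<in> ph_primes m n M" for p
    using edge_compat_multiplicity[OF mn(2,1) c' _ M] that by (auto simp: ph_primes_def)
  have "ph_primes m n N = ph_primes m n M" using 1 2 by blast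
  then show ?thesis unfolding Ph_enat using 1 by (metis (mono_tags, lifting) prod.cong)
qed

lemma orbit_sizes_compat:
  assumes mn: "m \<noteq> 0" "n \<noteq> 0" and c: "edge_compat n m N M"
  shows "N \<in> orbit_sizes m n q \<longleftrightarrow> M \<in> orbit_sizes m n q"
proof (cases "N = 0")
  case True
  then have "M = 0" using edge_compat_zero[OF mn c] by simp
  then show ?thesis using True by simp
next
  case False
  then have "M \<noteq> 0" using edge_compat_zero[OF mn c] by simp
  then show ?thesis using False edge_compat_Ph[OF mn c] by (simp add: mem_orbit_sizes_iff)
qed

lemma finite_ph_primes: "N > 0 \<Longrightarrow> finite (ph_primes m n N)"
proof (rule finite_subset[of _ "{p. prime p \<and> p dvd N}"])
  show "ph_primes m n N \<subseteq> {p. prime p \<and> p dvd N}"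
  proof
    fix p assume p: "p \<in> ph_primes m n N"
    then have "multiplicity p N \<noteq> 0" by (simp add: ph_primes_def)
    then have "p dvd N" by (rule contrapos_np) (rule not_dvd_imp_multiplicity_0)
    then show "p \<in> {p. prime p \<and> p dvd N}" using p by (simp add: ph_primes_def)
  qed
  show "N > 0 \<Longrightarrow> finite {p. prime p \<and> p dvd N}" by (intro finite_prime_divisors) simp
qed

lemma Ph_one:
  assumes N: "N > 0" and Ph: "Ph m n (enat N) = 1" and p: "prime p"
    and e: "multiplicity p (nat \<bar>m\<bar>) = multiplicity p (nat \<bar>n\<bar>)"
  shows "multiplicity p N \<le> multiplicity p (nat \<bar>n\<bar>)"
proof (rule ccontr)
  assume A: "\<not> ?thesis"
  then have pp: "p \<in> ph_primes m n N" using p e by (simp add: ph_primes_def)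
  have "(\<Prod>p\<in>ph_primes m n N. p ^ multiplicity p N) = 1" using Ph unfolding Ph_enat by (simp add: one_enat_def)
  then have "\<forall>p\<in>ph_primes m n N. p ^ multiplicity p N = 1" by (simp only: prod_eq_1_iff[OF finite_ph_primes[OF N]])
  then have "p ^ multiplicity p N = 1" using pp by blast
  then show False using A p by (auto simp: prime_gt_Suc_0_nat)
qed

lemma Ph_not_one:
  assumes Ph: "Ph m n (enat N) \<noteq> 1"
  shows "\<exists>p. prime p \<and> multiplicity p (nat \<bar>m\<bar>) = multiplicity p (nat \<bar>n\<bar>) \<and> multiplicity p N > multiplicity p (nat \<bar>n\<bar>)"
proof -
  have "ph_primes m n N \<noteq> {}" using Ph unfolding Ph_enat by (auto simp: one_enat_def)
  then show ?thesis by (auto simp: ph_primes_def)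
qed

lemma int_multiplicity_decompose:
  fixes n :: int and p :: nat assumes n: "n \<noteq> 0" and p: "prime p"
  shows "\<exists>n'. n = int p ^ multiplicity p (nat \<bar>n\<bar>) * n' \<and> \<not> int p dvd n'"
proof -
  have "nat \<bar>n\<bar> \<noteq> 0" "\<not> is_unit p" using n p not_prime_unit by auto
  then obtain y where y: "nat \<bar>n\<bar> = p ^ multiplicity p (nat \<bar>n\<bar>) * y" "\<not> p dvd y"
    using multiplicity_decompose' by blast
  have "\<bar>n\<bar> = int p ^ multiplicity p (nat \<bar>n\<bar>) * int y"
    using arg_cong[OF y(1), of int] by simp
  then have "n = int p ^ multiplicity p (nat \<bar>n\<bar>) * (sgn n * int y)"
    by (metis mult.left_commute sgn_mult_abs)
  moreover have "\<not> int p dvd sgn n * int y" using y(2) n by (cases "n > 0") (auto simp: sgn_if)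
  ultimately show ?thesis by blast
qed

lemma separable_one:
  assumes mn: "m \<noteq> 0" "n \<noteq> 0"
  shows "separable m n (orbit_sizes m n 1)"
  unfolding separable_def
proof (intro ballI allI impI)
  fix N and k :: int assume N: "N \<in> orbit_sizes m n 1" and k: "\<not> int N dvd k"
  have N0: "N > 0" "Ph m n (enat N) = 1" using N by (auto simp: orbit_sizes_def)
  have k0: "nat \<bar>k\<bar> \<noteq> 0" using k by auto
  have "\<not> N dvd nat \<bar>k\<bar>" using k by simp
  then obtain p where p: "prime p" "\<not> multiplicity p N \<le> multiplicity p (nat \<bar>k\<bar>)"
    using multiplicity_le_imp_dvd[of N "nat \<bar>k\<bar>"] N0 by blast
  define s where "s = multiplicity p N"
  have "p ^ s dvd N" unfolding s_def by (rule multiplicity_dvd)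
  then have 1: "int p ^ s dvd int N" by (metis int_dvd_int_iff of_nat_power)
  have u: "\<not> is_unit p" using p(1) not_prime_unit by blast
  have "\<not> p ^ s dvd nat \<bar>k\<bar>" using p(2) power_dvd_iff_le_multiplicity[OF k0 u] by (simp add: s_def)
  then have 2: "\<not> int p ^ s dvd k" by simp
  obtain n' where n': "n = int p ^ multiplicity p (nat \<bar>n\<bar>) * n'" "\<not> int p dvd n'" using int_multiplicity_decompose[OF mn(2) p(1)] by blast
  obtain m' where m': "m = int p ^ multiplicity p (nat \<bar>m\<bar>) * m'" "\<not> int p dvd m'" using int_multiplicity_decompose[OF mn(1) p(1)] by blast
  have 3: "multiplicity p (nat \<bar>n\<bar>) = multiplicity p (nat \<bar>m\<bar>) \<longrightarrow> s \<le> multiplicity p (nat \<bar>n\<bar>)"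
    using Ph_one[OF N0 p(1)] by (metis s_def)
  have "prime (int p)" using p(1) by simp
  then show "\<exists>P s u v n' m'. prime P \<and> P ^ s dvd int N \<and> \<not> P ^ s dvd k \<and>
        n = P ^ u * n' \<and> \<not> P dvd n' \<and> m = P ^ v * m' \<and> \<not> P dvd m' \<and> (u = v \<longrightarrow> s \<le> u)"
    using 1 2 3 n' m' by blast
qed

lemma separable_zero:
  assumes mn: "m \<noteq> 0" "n \<noteq> 0" and ne: "\<bar>m\<bar> \<noteq> \<bar>n\<bar>"
  shows "separable m n {0}"
  unfolding separable_def
proof (intro ballI allI impI)
  fix N :: nat and k :: int assume N: "N \<in> {0}" and k: "\<not> int N dvd k"
  have k0: "nat \<bar>k\<bar> \<noteq> 0" using k by auto
  have "\<exists>p. prime p \<and> multiplicity p (nat \<bar>n\<bar>) \<noteq> multiplicity p (nat \<bar>m\<bar>)"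
  proof (rule ccontr)
    assume "\<not> ?thesis"
    then have e: "\<And>p. prime p \<Longrightarrow> multiplicity p (nat \<bar>n\<bar>) = multiplicity p (nat \<bar>m\<bar>)" by blast
    have "nat \<bar>n\<bar> dvd nat \<bar>m\<bar>" "nat \<bar>m\<bar> dvd nat \<bar>n\<bar>"
      by (rule multiplicity_le_imp_dvd; use mn e in simp)+
    then have "nat \<bar>n\<bar> = nat \<bar>m\<bar>" by (rule dvd_antisym)
    then show False using ne by simp
  qed
  then obtain p where p: "prime p" "multiplicity p (nat \<bar>n\<bar>) \<noteq> multiplicity p (nat \<bar>m\<bar>)" by blast
  define s where "s = Suc (multiplicity p (nat \<bar>k\<bar>))"
  have u: "\<not> is_unit p" using p(1) not_prime_unit by blast
  have "\<not> p ^ s dvd nat \<bar>k\<bar>" unfolding power_dvd_iff_le_multiplicity[OF k0 u] by (simp add: s_def)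
  then have 2: "\<not> int p ^ s dvd k" by simp
  obtain n' where n': "n = int p ^ multiplicity p (nat \<bar>n\<bar>) * n'" "\<not> int p dvd n'" using int_multiplicity_decompose[OF mn(2) p(1)] by blast
  obtain m' where m': "m = int p ^ multiplicity p (nat \<bar>m\<bar>) * m'" "\<not> int p dvd m'" using int_multiplicity_decompose[OF mn(1) p(1)] by blast
  have "prime (int p)" "int p ^ s dvd int N" using p(1) N by simp_all
  then show "\<exists>P s u v n' m'. prime P \<and> P ^ s dvd int N \<and> \<not> P ^ s dvd k \<and>
        n = P ^ u * n' \<and> \<not> P dvd n' \<and> m = P ^ v * m' \<and> \<not> P dvd m' \<and> (u = v \<longrightarrow> s \<le> u)"
    using 2 n' m' p(2) by blast
qed

lemma phenotype_one_primes:
  assumes mn: "m \<noteq> 0" "n \<noteq> 0" and N: "N > 0" "Ph m n (enat N) = 1" and p: "prime p"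
    and d: "p dvd N div gcd N (nat \<bar>m\<bar>)"
  shows "p dvd nat \<bar>n\<bar> div gcd (nat \<bar>m\<bar>) (nat \<bar>n\<bar>) \<or> p dvd nat \<bar>m\<bar> div gcd (nat \<bar>m\<bar>) (nat \<bar>n\<bar>)"
proof -
  define a where "a = nat \<bar>m\<bar>"
  define b where "b = nat \<bar>n\<bar>"
  have ab: "a > 0" "b > 0" using mn by (auto simp: a_def b_def)
  have u: "\<not> is_unit p" using p not_prime_unit by blast
  have nz: "x div gcd x y \<noteq> 0" if "x > 0" for x y :: nat using that by (simp add: dvd_div_eq_0_iff)
  have pos: "p dvd x div gcd x y \<longleftrightarrow> multiplicity p x > multiplicity p y" if "x > 0" "y > 0" for x y :: nat
    using multiplicity_gt_zero_iff[OF nz[OF that(1)] u, of y] multiplicity_div_gcd_nat[OF p that] by simp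
  have "multiplicity p N > multiplicity p a" using d pos[OF N(1) ab(1)] by (simp only: a_def)
  then have "multiplicity p a \<noteq> multiplicity p b" using Ph_one[OF N p] unfolding a_def b_def by linarith
  then have "p dvd b div gcd b a \<or> p dvd a div gcd a b" using pos ab by (metis nat_neq_iff)
  then show ?thesis unfolding a_def b_def by (simp only: gcd.commute)
qed

lemma period_exists:
  fixes B :: "int \<Rightarrow> 'a \<Rightarrow> 'a"
  assumes z: "B 0 y = y" and add: "\<And>j k. B (j + k) y = B j (B k y)"
  shows "\<exists>N. \<forall>k. B k y = y \<longleftrightarrow> int N dvd k"
proof (cases "\<exists>i>0. B (int i) y = y")
  case False
  have neg: "B (- k) y = y" if "B k y = y" for k using add[of "- k" k] that z by simp
  have "B k y = y \<longleftrightarrow> k = 0" for k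
  proof
    assume k: "B k y = y"
    then have "B \<bar>k\<bar> y = y" using neg by (cases "k \<ge> 0") auto
    then show "k = 0" using False by (metis nat_0_le abs_ge_zero zero_less_nat_eq zero_less_abs_iff)
  qed (simp add: z)
  then show ?thesis by (intro exI[of _ 0]) simp
next
  case True
  define N where "N = (LEAST i. i > 0 \<and> B (int i) y = y)"
  have N: "N > 0" "B (int N) y = y" using LeastI_ex[OF True] by (auto simp: N_def)
  have least: "\<not> (i > 0 \<and> B (int i) y = y)" if "i < N" for i using not_less_Least that unfolding N_def by blast
  have mult: "B (int N * int j) y = y" for j
  proof (induction j)
    case (Suc j)
    have "int N * int (Suc j) = int N + int N * int j" by (simp add: algebra_simps)
    then show ?case using add[of "int N" "int N * int j"] Suc N(2) by simp
  qed (simp add: z)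
  have neg: "B (- k) y = y" if "B k y = y" for k using add[of "- k" k] that z by simp
  have mult': "B (int N * j) y = y" for j
  proof (cases "j \<ge> 0")
    case True then show ?thesis using mult[of "nat j"] by simp
  next
    case False then show ?thesis using neg[OF mult[of "nat (- j)"]] by simp
  qed
  have "B k y = y \<longleftrightarrow> int N dvd k" for k
  proof
    assume k: "B k y = y"
    have "B (k mod int N) y = B (k mod int N) (B (int N * (k div int N)) y)" using mult' by simp
    also have "\<dots> = B (k mod int N + int N * (k div int N)) y" by (rule add[symmetric])
    also have "\<dots> = B k y" by simp
    finally have r: "B (int (nat (k mod int N))) y = y" using k N(1) by simp
    have "nat (k mod int N) < N" using N(1) by (simp add: nat_less_iff)
    from least[OF this] have "\<not> nat (k mod int N) > 0" unfolding r by (simp only: simp_thms)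
    then have "nat (k mod int N) = 0" by (simp only: not_gr_zero)
    moreover have "k mod int N \<ge> 0" using N(1) by simp
    ultimately show "int N dvd k" by (simp add: dvd_eq_mod_eq_0)
  next
    assume "int N dvd k"
    then obtain j where "k = int N * j" by (rule dvdE)
    then show "B k y = y" using mult' by simp
  qed
  then show ?thesis by blast
qed

lemma universe:
  fixes Y :: "'a set" and A :: "int \<Rightarrow> 'a \<Rightarrow> 'a" and s :: "'a \<Rightarrow> nat"
  assumes mn: "2 \<le> \<bar>m\<bar>" "2 \<le> \<bar>n\<bar>" and Y: "countable Y" and S: "orbit_sizes m n q \<noteq> {}"
    and clos: "\<And>y k. y \<in> Y \<Longrightarrow> A k y \<in> Y" and zero: "\<And>y. y \<in> Y \<Longrightarrow> A 0 y = y"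
    and add: "\<And>y j k. y \<in> Y \<Longrightarrow> A (j + k) y = A j (A k y)"
    and per: "\<And>y k. y \<in> Y \<Longrightarrow> A k y = y \<longleftrightarrow> int (s y) dvd k" and sS: "\<And>y. y \<in> Y \<Longrightarrow> s y \<in> orbit_sizes m n q"
  shows "\<exists>B sz (\<iota> :: 'a \<Rightarrow> nat). orbit_system B sz (orbit_sizes m n q) m n \<and> inj_on \<iota> Y \<and>
     (\<forall>y\<in>Y. \<forall>k. B k (\<iota> y) = \<iota> (A k y)) \<and> (\<forall>y\<in>Y. sz (\<iota> y) = s y)"
proof -
  let ?S = "orbit_sizes m n q"
  define Z where "Z = Inl ` Y \<union> Inr ` {(N, i :: nat, k :: int). N \<in> ?S \<and> k mod int N = k}"
  have cZ: "countable Z" unfolding Z_def using Y by auto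
  obtain N0 where N0: "N0 \<in> ?S" using S by blast
  have "inj (\<lambda>i :: nat. Inr (N0, i, 0) :: 'a + nat \<times> nat \<times> int)" by (simp add: inj_def)
  then have "infinite (range (\<lambda>i :: nat. Inr (N0, i, 0) :: 'a + nat \<times> nat \<times> int))" using finite_imageD infinite_UNIV_nat by blast
  moreover have "range (\<lambda>i :: nat. Inr (N0, i, 0)) \<subseteq> Z" using N0 by (auto simp: Z_def)
  ultimately have "infinite Z" using finite_subset by blast
  then obtain e :: "'a + nat \<times> nat \<times> int \<Rightarrow> nat" where e: "bij_betw e Z UNIV" using cZ countableE_infinite by blast
  define g where "g = inv_into Z e"
  have gZ: "g x \<in> Z" for x unfolding g_def using e by (metis bij_betw_def inv_into_into rangeI UNIV_I)
  have eg: "e (g x) = x" for x unfolding g_def using e by (metis bij_betw_inv_into_right UNIV_I)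
  have ge: "g (e z) = z" if "z \<in> Z" for z unfolding g_def using e that by (rule bij_betw_inv_into_left)
  define A' where "A' = (\<lambda>k z. case z of Inl y \<Rightarrow> Inl (A k y) | Inr (N, i :: nat, j) \<Rightarrow> Inr (N, i, (k + j) mod int N))"
  define s' where "s' = (\<lambda>z. case z of Inl y \<Rightarrow> s y | Inr (N, i :: nat, j :: int) \<Rightarrow> N)"
  have A'Z: "A' k z \<in> Z" if "z \<in> Z" for k z
    using that clos by (auto simp: Z_def A'_def)
  have A'0: "A' 0 z = z" if "z \<in> Z" for z using that zero by (auto simp: Z_def A'_def)
  have A'add: "A' (j + k) z = A' j (A' k z)" if "z \<in> Z" for j k z
    using that add by (auto simp: Z_def A'_def mod_simps add.assoc)
  have A'fix: "A' k z = z \<longleftrightarrow> int (s' z) dvd k" if z: "z \<in> Z" for k z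
  proof (cases z)
    case (Inl y)
    then show ?thesis using z per by (auto simp: Z_def A'_def s'_def)
  next
    case (Inr p)
    obtain N i j where p: "p = (N, i, j)" by (cases p)
    have j: "j mod int N = j" using z by (auto simp: Z_def Inr p)
    have "A' k z = z \<longleftrightarrow> (k + j) mod int N = j mod int N" by (simp add: A'_def Inr p j)
    also have "\<dots> \<longleftrightarrow> int N dvd (k + j) - j" by (rule mod_eq_dvd_iff)
    finally show ?thesis by (simp add: s'_def Inr p)
  qed
  have s'S: "s' z \<in> ?S" if "z \<in> Z" for z using that sS by (auto simp: Z_def s'_def)
  define B where "B = (\<lambda>k x. e (A' k (g x)))"
  define sz where "sz = (\<lambda>x. s' (g x))"
  define \<iota> where "\<iota> = (\<lambda>y. e (Inl y))"
  have gB: "g (B k x) = A' k (g x)" for k x unfolding B_def using ge A'Z gZ by blast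
  have m0: "m \<noteq> 0" "n \<noteq> 0" using mn by auto
  have "orbit_system B sz ?S m n"
  proof
    show "2 \<le> \<bar>m\<bar>" "2 \<le> \<bar>n\<bar>" by fact+
    show "B 0 x = x" for x by (simp add: B_def A'0[OF gZ] eg)
    show "B (j + k) x = B j (B k x)" for j k x
    proof -
      have "B j (B k x) = e (A' j (A' k (g x)))" using gB[of k x] by (simp add: B_def[of] )
      then show ?thesis by (simp add: B_def A'add[OF gZ])
    qed
    show "B k x = x \<longleftrightarrow> int (sz x) dvd k" for k x
    proof -
      have "B k x = x \<longleftrightarrow> A' k (g x) = g x" using gB eg by (metis B_def)
      then show ?thesis using A'fix[OF gZ] by (simp add: sz_def)
    qed
    show "sz x \<in> ?S" for x unfolding sz_def using s'S gZ by blast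
    show "\<exists>x. sz x = N \<and> (\<forall>y\<in>F. \<forall>k. B k y \<noteq> x)" if N: "N \<in> ?S" and F: "finite F" for N F
    proof -
      define idx where "idx = (\<lambda>z :: 'a + nat \<times> nat \<times> int. case z of Inl y \<Rightarrow> 0 | Inr (N, i, j) \<Rightarrow> i)"
      have "finite ((\<lambda>y. idx (g y)) ` F)" using F by simp
      then obtain i where i: "i \<notin> (\<lambda>y. idx (g y)) ` F" using ex_new_if_finite[OF infinite_UNIV_nat] by blast
      let ?z = "Inr (N, i, 0) :: 'a + nat \<times> nat \<times> int"
      have zZ: "?z \<in> Z" using N by (auto simp: Z_def)
      have "B k y \<noteq> e ?z" if y: "y \<in> F" for y k
      proof
        assume "B k y = e ?z"
        then have "A' k (g y) = ?z" using gB ge[OF zZ] by metis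
        then have "idx (g y) = i" by (auto simp: A'_def idx_def split: sum.splits prod.splits)
        then show False using i y by blast
      qed
      moreover have "sz (e ?z) = N" unfolding sz_def ge[OF zZ] by (simp add: s'_def)
      ultimately show ?thesis by blast
    qed
    show "N \<in> ?S \<Longrightarrow> edge_compat n m N M \<Longrightarrow> M \<in> ?S" for N M using orbit_sizes_compat[OF m0] by blast
    show "M \<in> ?S \<Longrightarrow> edge_compat n m N M \<Longrightarrow> N \<in> ?S" for N M using orbit_sizes_compat[OF m0] by blast
  qed
  moreover have YZ: "Inl y \<in> Z" if "y \<in> Y" for y using that by (auto simp: Z_def)
  have "inj_on \<iota> Y"
  proof (rule inj_onI)
    fix x y assume "x \<in> Y" "y \<in> Y" "\<iota> x = \<iota> y"
    then have "g (e (Inl x)) = g (e (Inl y))" by (simp add: \<iota>_def)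
    then show "x = y" using ge YZ \<open>x \<in> Y\<close> \<open>y \<in> Y\<close> by simp
  qed
  moreover have "\<forall>y\<in>Y. \<forall>k. B k (\<iota> y) = \<iota> (A k y)"
    using ge YZ by (simp add: B_def \<iota>_def A'_def)
  moreover have "\<forall>y\<in>Y. sz (\<iota> y) = s y"
    using ge YZ by (simp add: sz_def \<iota>_def s'_def)
  ultimately show ?thesis by blast
qed

section \<open>Coset actions\<close>

definition cosw :: "int \<Rightarrow> int \<Rightarrow> word set set \<Rightarrow> word \<Rightarrow> word set set" where
  "cosw m n \<Lambda> w = \<Lambda> #>\<^bsub>BS m n\<^esub> bcls m n w"

lemma rcosets_cosw: "rcosets\<^bsub>BS m n\<^esub> \<Lambda> = range (cosw m n \<Lambda>)"
  unfolding rcosets_BS cosw_def ..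

lemma cosw_mult: "subgroup \<Lambda> (BS m n) \<Longrightarrow> cosw m n \<Lambda> u #>\<^bsub>BS m n\<^esub> bcls m n v = cosw m n \<Lambda> (u @ v)"
  unfolding cosw_def by (rule rcos_bcls_mult)

lemma cosw_eq: "subgroup \<Lambda> (BS m n) \<Longrightarrow> cosw m n \<Lambda> u = cosw m n \<Lambda> v \<longleftrightarrow> bcls m n (u @ winv v) \<in> \<Lambda>"
  unfolding cosw_def by (rule rcos_bcls_eq)

lemma cosw_cong: "bcls m n u = bcls m n v \<Longrightarrow> cosw m n \<Lambda> u = cosw m n \<Lambda> v"
  by (simp add: cosw_def)

lemma cosw_eq_Nil: "subgroup \<Lambda> (BS m n) \<Longrightarrow> cosw m n \<Lambda> w = cosw m n \<Lambda> [] \<longleftrightarrow> bcls m n w \<in> \<Lambda>"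
  by (simp add: cosw_eq winv_def)

lemma bcls_winv_right: "bcls m n (u @ w @ winv w) = bcls m n u"
proof -
  interpret group "BS m n" by (rule group_BS)
  have "bcls m n (u @ w @ winv w) = bcls m n u \<otimes>\<^bsub>BS m n\<^esub> (bcls m n w \<otimes>\<^bsub>BS m n\<^esub> inv\<^bsub>BS m n\<^esub> bcls m n w)" by simp
  also have "\<dots> = bcls m n u" by (simp del: mult_BS inv_BS)
  finally show ?thesis .
qed

lemma cosw_append_iff:
  assumes "subgroup \<Lambda> (BS m n)"
  shows "cosw m n \<Lambda> (u @ w) = cosw m n \<Lambda> (v @ w) \<longleftrightarrow> cosw m n \<Lambda> u = cosw m n \<Lambda> v"
proof
  assume "cosw m n \<Lambda> u = cosw m n \<Lambda> v"
  then show "cosw m n \<Lambda> (u @ w) = cosw m n \<Lambda> (v @ w)" by (simp flip: cosw_mult[OF assms])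
next
  assume "cosw m n \<Lambda> (u @ w) = cosw m n \<Lambda> (v @ w)"
  then have "cosw m n \<Lambda> ((u @ w) @ winv w) = cosw m n \<Lambda> ((v @ w) @ winv w)" by (simp only: flip: cosw_mult[OF assms])
  moreover have "cosw m n \<Lambda> ((x @ w) @ winv w) = cosw m n \<Lambda> x" for x
    using cosw_cong[OF bcls_winv_right[of m n x w]] by simp
  ultimately show "cosw m n \<Lambda> u = cosw m n \<Lambda> v" by simp
qed

lemma cosw_bpow_add: "cosw m n \<Lambda> (w @ bpow j @ bpow k) = cosw m n \<Lambda> (w @ bpow (j + k))"
  by (rule cosw_cong, rule bcls_cong) (simp_all add: bcls_bpow_add)

lemma cosw_relator: "cosw m n \<Lambda> (w @ bpow (n * k) @ [(Tg, False)]) = cosw m n \<Lambda> (w @ [(Tg, False)] @ bpow (m * k))"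
  by (rule cosw_cong, rule bcls_cong) (simp_all only: bcls_relator_pow)

lemma cosw_T_inv: "cosw m n \<Lambda> (w @ [(Tg, True), (Tg, False)]) = cosw m n \<Lambda> w"
  using bs_cancel[of m n w Tg True "[]"] by (intro cosw_cong) (simp add: bcls_eq)

locale coset_system = orbit_system B sz S m n
  for B :: "int \<Rightarrow> nat \<Rightarrow> nat" and sz S m n +
  fixes \<Lambda> :: "word set set" and \<iota> :: "word \<Rightarrow> nat"
  assumes sub: "subgroup \<Lambda> (BS m n)"
    and iota_eq: "\<iota> u = \<iota> v \<longleftrightarrow> cosw m n \<Lambda> u = cosw m n \<Lambda> v"
    and iota_B: "B k (\<iota> w) = \<iota> (w @ bpow k)"
begin

definition G :: "(nat \<times> nat) set" where "G = {(\<iota> w, \<iota> (w @ [(Tg, False)])) | w. True}"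

lemma G_I: "(\<iota> w, \<iota> (w @ [(Tg, False)])) \<in> G" by (auto simp: G_def)

lemma iota_T_inv: "\<iota> (w @ [(Tg, True), (Tg, False)]) = \<iota> w"
  by (simp add: iota_eq cosw_T_inv)

lemma G_I': "(\<iota> (w @ [(Tg, True)]), \<iota> w) \<in> G"
  using G_I[of "w @ [(Tg, True)]"] iota_T_inv[of w] by simp

lemma iota_append: "\<iota> (u @ w) = \<iota> (v @ w) \<longleftrightarrow> \<iota> u = \<iota> v"
  by (simp add: iota_eq cosw_append_iff[OF sub])

lemma G_sv: "(\<iota> u, y) \<in> G \<longleftrightarrow> y = \<iota> (u @ [(Tg, False)])"
proof
  assume "(\<iota> u, y) \<in> G"
  then obtain w where w: "\<iota> u = \<iota> w" "y = \<iota> (w @ [(Tg, False)])" unfolding G_def by blast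
  then show "y = \<iota> (u @ [(Tg, False)])" using iota_append[of u "[(Tg, False)]" w] by simp
qed (simp add: G_I)

lemma G_inj: "(x, \<iota> v) \<in> G \<longleftrightarrow> x = \<iota> (v @ [(Tg, True)])"
proof
  assume "(x, \<iota> v) \<in> G"
  then obtain w where w: "x = \<iota> w" "\<iota> v = \<iota> (w @ [(Tg, False)])" unfolding G_def by blast
  then have "\<iota> (v @ [(Tg, True)] @ [(Tg, False)]) = \<iota> (w @ [(Tg, False)])" using iota_T_inv[of v] by simp
  then show "x = \<iota> (v @ [(Tg, True)])" using iota_append[of "v @ [(Tg, True)]" "[(Tg, False)]" w] w by simp
qed (simp add: G_I')

lemma Domain_G: "Domain G = range \<iota>" and Range_G: "Range G = range \<iota>"
proof -
  show "Domain G = range \<iota>" by (auto simp: G_def)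
  show "Range G = range \<iota>"
  proof
    show "range \<iota> \<subseteq> Range G" using G_I' by blast
  qed (auto simp: G_def)
qed

lemma G_eqv: "(x, y) \<in> G \<Longrightarrow> (B (n * k) x, B (m * k) y) \<in> G"
proof -
  assume "(x, y) \<in> G"
  then obtain w where w: "x = \<iota> w" "y = \<iota> (w @ [(Tg, False)])" by (auto simp: G_def)
  have "B (m * k) y = \<iota> ((w @ bpow (n * k)) @ [(Tg, False)])"
    using cosw_relator[of m n \<Lambda> w k] by (simp add: w iota_B iota_eq)
  then show ?thesis using G_I[of "w @ bpow (n * k)"] by (simp add: w iota_B)
qed

lemma G_single: "single_valued G" "single_valued (G\<inverse>)"
proof -
  show "single_valued G"
  proof (rule single_valuedI)
    fix x y z assume "(x, y) \<in> G" "(x, z) \<in> G"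
    moreover obtain u where "x = \<iota> u" using calculation(1) by (auto simp: G_def)
    ultimately show "y = z" by (simp add: G_sv)
  qed
  show "single_valued (G\<inverse>)"
  proof (rule single_valuedI, unfold converse_iff)
    fix x y z assume "(y, x) \<in> G" "(z, x) \<in> G"
    moreover obtain u where "x = \<iota> u" using calculation(1) by (auto simp: G_def)
    ultimately show "y = z" by (simp add: G_inj)
  qed
qed

lemma orb_iota: "x \<in> range \<iota> \<Longrightarrow> orb x \<subseteq> range \<iota>"
  by (auto simp: orb_iff iota_B)

lemma G_image: "G `` C \<subseteq> range \<iota>" "G\<inverse> `` C \<subseteq> range \<iota>" by (auto simp: G_def)

lemma iota_induct:
  assumes base: "\<iota> u \<in> C" and orb: "\<forall>x\<in>C. orb x \<subseteq> C" and fw: "G `` C \<subseteq> C" and bw: "G\<inverse> `` C \<subseteq> C"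
  shows "\<iota> (u @ w) \<in> C"
proof (induction w rule: rev_induct)
  case Nil then show ?case using base by simp
next
  case (snoc a w)
  obtain g s where a: "a = (g, s)" by force
  show ?case
  proof (cases g)
    case Bg
    have "[a] = bpow (if s then - 1 else 1)" by (simp add: a Bg bpow_def)
    then have "\<iota> (u @ w @ [a]) = B (if s then - 1 else 1) (\<iota> (u @ w))" by (simp add: iota_B)
    then show ?thesis using snoc orb B_in_orb by (metis subsetD)
  next
    case Tg
    show ?thesis
    proof (cases s)
      case True
      have "(\<iota> ((u @ w) @ [(Tg, True)]), \<iota> (u @ w)) \<in> G" by (rule G_I')
      then show ?thesis using snoc bw by (auto simp: a Tg True)
    next
      case False
      have "(\<iota> (u @ w), \<iota> ((u @ w) @ [(Tg, False)])) \<in> G" by (rule G_I)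
      then show ?thesis using snoc fw by (auto simp: a Tg False)
    qed
  qed
qed

lemma Nil_append_winv: "\<iota> (u @ winv u @ w) = \<iota> w"
proof -
  have "bcls m n ((u @ winv u) @ w) = bcls m n ([] @ w)"
    by (rule bcls_cong) (use bcls_winv_right[of m n "[]" u] in simp_all)
  then have "bcls m n (u @ winv u @ w) = bcls m n w" by simp
  from cosw_cong[OF this] show ?thesis unfolding iota_eq .
qed

definition T0 :: "word set \<Rightarrow> (nat \<times> nat) set" where
  "T0 U = {(B (n * k) (\<iota> u), B (m * k) (\<iota> (u @ [(Tg, False)]))) | u k. u \<in> U}"

lemma T0_G: "T0 U \<subseteq> G" unfolding T0_def using G_eqv[OF G_I] by blast

lemma T0_I: "u \<in> U \<Longrightarrow> (\<iota> u, \<iota> (u @ [(Tg, False)])) \<in> T0 U"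
proof -
  assume "u \<in> U"
  then have "(B (n * 0) (\<iota> u), B (m * 0) (\<iota> (u @ [(Tg, False)]))) \<in> T0 U" unfolding T0_def by blast
  then show ?thesis by (simp add: B_zero)
qed

lemma cond_T0:
  assumes U: "finite U" and inf: "inf_bcosets m n \<Lambda>"
  shows "cond (T0 U)"
proof -
  have "single_valued (T0 U)" "single_valued ((T0 U)\<inverse>)"
    using G_single T0_G single_valued_subset by (blast, metis converse_mono single_valued_subset)
  moreover have "\<forall>x y k. (x, y) \<in> T0 U \<longrightarrow> (B (n * k) x, B (m * k) y) \<in> T0 U"
  proof (intro allI impI)
    fix x y k assume "(x, y) \<in> T0 U"
    then obtain u l where u: "u \<in> U" "x = B (n * l) (\<iota> u)" "y = B (m * l) (\<iota> (u @ [(Tg, False)]))" by (auto simp: T0_def)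
    then have "B (n * k) x = B (n * (k + l)) (\<iota> u)" "B (m * k) y = B (m * (k + l)) (\<iota> (u @ [(Tg, False)]))"
      by (simp_all add: B_B algebra_simps)
    then show "(B (n * k) x, B (m * k) y) \<in> T0 U" using u(1) unfolding T0_def by blast
  qed
  moreover have "Field (T0 U) \<subseteq> (\<Union>f\<in>\<iota> ` U \<union> (\<lambda>u. \<iota> (u @ [(Tg, False)])) ` U. orb f)"
    by (auto simp: Field_def T0_def simp del: B_in_orb_iff)
  then have "\<exists>F. finite F \<and> Field (T0 U) \<subseteq> (\<Union>f\<in>F. orb f)"
    using U by (intro exI[of _ "\<iota> ` U \<union> (\<lambda>u. \<iota> (u @ [(Tg, False)])) ` U"]) simp
  ultimately have P: "piso (T0 U)" by (simp add: piso_def)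
  have "unsat (T0 U)" unfolding unsat_def
  proof (intro allI impI)
    fix C assume C: "C \<noteq> {}" "\<forall>x\<in>C. orb x \<subseteq> C" "C \<subseteq> Domain (T0 U)" "C \<subseteq> Range (T0 U)" "T0 U `` C \<subseteq> C" "(T0 U)\<inverse> `` C \<subseteq> C"
    have fw: "G `` C \<subseteq> C"
    proof
      fix y assume "y \<in> G `` C"
      then obtain x where x: "x \<in> C" "(x, y) \<in> G" by blast
      obtain z where z: "(x, z) \<in> T0 U" using C(3) x(1) by blast
      then have "z = y" using T0_G x(2) G_single(1) by (meson single_valuedD subsetD)
      then show "y \<in> C" using z x(1) C(5) by blast
    qed
    have bw: "G\<inverse> `` C \<subseteq> C"
    proof
      fix y assume "y \<in> G\<inverse> `` C"
      then obtain x where x: "x \<in> C" "(y, x) \<in> G" by blast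
      obtain z where z: "(z, x) \<in> T0 U" using C(4) x(1) by blast
      then have "(x, z) \<in> G\<inverse>" "(x, y) \<in> G\<inverse>" using T0_G x(2) by auto
      then have "z = y" using G_single(2) by (meson single_valuedD)
      then show "y \<in> C" using z x(1) C(6) by blast
    qed
    obtain x where x: "x \<in> C" using C(1) by blast
    then obtain u where u: "x = \<iota> u" using C(3) T0_G Domain_G by blast
    have all: "\<iota> w \<in> C" for w
      using iota_induct[OF x[unfolded u] C(2) fw bw, of "winv u @ w"] Nil_append_winv[of u w] by simp
    obtain w where w: "\<forall>f\<in>U. \<forall>k. cosw m n \<Lambda> w \<noteq> cosw m n \<Lambda> (f @ bpow k)"
      using inf U unfolding inf_bcosets_def cosw_def by blast
    have "\<iota> w \<in> Domain (T0 U)" using all C(3) by blast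
    then obtain f k where "f \<in> U" "\<iota> w = B (n * k) (\<iota> f)" by (auto simp: T0_def)
    then show False using w by (simp add: iota_B iota_eq)
  qed
  then show ?thesis using P by (simp add: cond_def)
qed

definition prefs :: "word set \<Rightarrow> word set" where
  "prefs W = (\<Union>w\<in>W. (\<lambda>i. take i w) ` {..length w} \<union> (\<lambda>i. take i w @ [(Tg, True)]) ` {..length w})"

lemma pact_T0:
  assumes w: "w \<in> W"
  shows "i \<le> length w \<Longrightarrow> pact B (T0 (prefs W)) (take i w) (\<iota> []) (\<iota> (take i w))"
proof (induction i)
  case (Suc i)
  then have i: "i < length w" by simp
  have t: "take (Suc i) w = take i w @ [w ! i]" using i by (rule take_Suc_conv_app_nth)
  have IH: "pact B (T0 (prefs W)) (take i w) (\<iota> []) (\<iota> (take i w))" using Suc by simp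
  obtain g s where a: "w ! i = (g, s)" by force
  have "i \<in> {..length w}" using i by simp
  then have p: "take i w \<in> prefs W" "take i w @ [(Tg, True)] \<in> prefs W" using w unfolding prefs_def by blast+
  have "lstep B (T0 (prefs W)) (w ! i) (\<iota> (take i w)) (\<iota> (take i w @ [w ! i]))"
  proof (cases g)
    case Bg
    have "[w ! i] = bpow (if s then - 1 else 1)" by (simp add: a Bg bpow_def)
    then have "\<iota> (take i w @ [w ! i]) = B (if s then - 1 else 1) (\<iota> (take i w))" by (simp add: iota_B)
    then show ?thesis by (simp add: a Bg)
  next
    case Tg
    show ?thesis
    proof (cases s)
      case True
      then show ?thesis using T0_I[OF p(2)] iota_T_inv[of "take i w"] by (simp add: a Tg)
    next
      case False
      then show ?thesis using T0_I[OF p(1)] by (simp add: a Tg)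
    qed
  qed
  then show ?case unfolding t pact_append using IH by auto
qed simp

lemma stab_agrees:
  assumes T: "full T" "T0 (prefs W) \<subseteq> T" and w: "w \<in> W"
  shows "bcls m n w \<in> stab T (\<iota> []) \<longleftrightarrow> bcls m n w \<in> \<Lambda>"
proof -
  have "pact B (T0 (prefs W)) w (\<iota> []) (\<iota> w)" using pact_T0[OF w, of "length w"] by simp
  from pact_mono[OF this T(2)] have p: "pact B T w (\<iota> []) (\<iota> w)" .
  have "bcls m n w \<in> stab T (\<iota> []) \<longleftrightarrow> pact B T w (\<iota> []) (\<iota> [])" by (rule mem_stab[OF T(1)])
  also have "\<dots> \<longleftrightarrow> \<iota> w = \<iota> []"
  proof
    assume "pact B T w (\<iota> []) (\<iota> [])"
    from pact_sv[OF full_sv[OF T(1)] full_inj[OF T(1)] p this] show "\<iota> w = \<iota> []" .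
  qed (use p in simp)
  also have "\<dots> \<longleftrightarrow> bcls m n w \<in> \<Lambda>" by (simp add: iota_eq cosw_eq_Nil[OF sub])
  finally show ?thesis .
qed

lemma finite_prefs: "finite W \<Longrightarrow> finite (prefs W)" by (simp add: prefs_def)

lemma finite_rcosets:
  assumes "finite (range \<iota>)" shows "finite (rcosets\<^bsub>BS m n\<^esub> \<Lambda>)"
proof -
  define h where "h = (\<lambda>x. cosw m n \<Lambda> (SOME w. \<iota> w = x))"
  have "cosw m n \<Lambda> w = h (\<iota> w)" for w
  proof -
    have "\<iota> (SOME v. \<iota> v = \<iota> w) = \<iota> w" by (rule someI[of _ w]) simp
    then show ?thesis unfolding h_def iota_eq by simp
  qed
  then have "range (cosw m n \<Lambda>) \<subseteq> h ` range \<iota>" by auto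
  then show ?thesis unfolding rcosets_cosw using assms finite_surj by blast
qed

lemma G_piso:
  assumes F: "finite F" "\<forall>w. \<exists>f\<in>F. \<exists>k. cosw m n \<Lambda> w = cosw m n \<Lambda> (f @ bpow k)"
  shows "range \<iota> \<subseteq> (\<Union>f\<in>\<iota> ` F. orb f)" "piso G"
proof -
  show r: "range \<iota> \<subseteq> (\<Union>f\<in>\<iota> ` F. orb f)"
  proof (rule image_subsetI)
    fix w
    obtain f k where "f \<in> F" "\<iota> w = B k (\<iota> f)" using F(2)[rule_format, of w] by (auto simp: iota_B iota_eq)
    then have "\<iota> w \<in> orb (\<iota> f)" by simp
    then show "\<iota> w \<in> (\<Union>f\<in>\<iota> ` F. orb f)" using \<open>f \<in> F\<close> by blast
  qed
  have "Field G \<subseteq> (\<Union>f\<in>\<iota> ` F. orb f)" using r by (simp add: Field_def Domain_G Range_G)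
  then have "\<exists>F. finite F \<and> Field G \<subseteq> (\<Union>f\<in>F. orb f)" using F(1) by (intro exI[of _ "\<iota> ` F"]) simp
  then show "piso G" unfolding piso_def using G_single G_eqv by simp
qed

end

lemma finite_letters: "finite (UNIV :: (gen \<times> bool) set)"
proof -
  have "(UNIV :: gen set) = {Bg, Tg}" using gen.exhaust by blast
  then have "finite (UNIV :: gen set)" by (metis finite.emptyI finite.insertI)
  then show ?thesis by (rule finite_Prod_UNIV) simp
qed

lemma countable_words: "countable (UNIV :: word set)"
proof -
  have "countable (lists (UNIV :: (gen \<times> bool) set))"
    by (intro countable_lists countable_finite finite_letters)
  then show ?thesis by simp
qed

lemma coset_universe:
  assumes mn: "2 \<le> \<bar>m\<bar>" "2 \<le> \<bar>n\<bar>" and sub: "subgroup \<Lambda> (BS m n)" and q: "PH m n \<Lambda> = q"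
  shows "\<exists>B sz \<iota>. coset_system B sz (orbit_sizes m n q) m n \<Lambda> \<iota>"
proof -
  let ?c = "cosw m n \<Lambda>"
  have m0: "m \<noteq> 0" "n \<noteq> 0" using mn by auto
  have b0: "bpow 0 = []" by (simp add: bpow_def)
  define A where "A = (\<lambda>k y. y #>\<^bsub>BS m n\<^esub> bcls m n (bpow k))"
  have Ac: "A k (?c w) = ?c (w @ bpow k)" for k w unfolding A_def by (rule cosw_mult[OF sub])
  have A0: "A 0 y = y" if "y \<in> range ?c" for y using that Ac by (auto simp: b0)
  have Aadd: "A (j + k) y = A j (A k y)" if y: "y \<in> range ?c" for y j k
  proof -
    obtain w where w: "y = ?c w" using y by blast
    have "A j (A k y) = ?c (w @ bpow k @ bpow j)" by (simp add: w Ac)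
    also have "\<dots> = A (j + k) y" by (simp add: w Ac cosw_bpow_add add.commute)
    finally show ?thesis by simp
  qed
  have "\<forall>y\<in>range ?c. \<exists>N. \<forall>k. A k y = y \<longleftrightarrow> int N dvd k"
  proof
    fix y assume y: "y \<in> range ?c"
    show "\<exists>N. \<forall>k. A k y = y \<longleftrightarrow> int N dvd k" by (rule period_exists[of A y]) (use A0[OF y] Aadd[OF y] in simp_all)
  qed
  from bchoice[OF this] obtain s where s: "\<forall>y\<in>range ?c. \<forall>k. A k y = y \<longleftrightarrow> int (s y) dvd k" by blast
  have sc: "?c (w @ bpow k) = ?c w \<longleftrightarrow> int (s (?c w)) dvd k" for w k using s Ac by simp
  have tc: "edge_compat n m (s (?c w)) (s (?c (w @ [(Tg, False)])))" for w
    unfolding edge_compat_def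
  proof
    fix k
    have "int (s (?c w)) dvd n * k \<longleftrightarrow> ?c (w @ bpow (n * k)) = ?c w" using sc by blast
    also have "\<dots> \<longleftrightarrow> ?c ((w @ bpow (n * k)) @ [(Tg, False)]) = ?c (w @ [(Tg, False)])"
      by (rule cosw_append_iff[OF sub, symmetric])
    also have "\<dots> \<longleftrightarrow> ?c ((w @ [(Tg, False)]) @ bpow (m * k)) = ?c (w @ [(Tg, False)])"
      using cosw_relator[of m n \<Lambda> w k] by simp
    also have "\<dots> \<longleftrightarrow> int (s (?c (w @ [(Tg, False)]))) dvd m * k" by (rule sc)
    finally show "int (s (?c w)) dvd n * k \<longleftrightarrow> int (s (?c (w @ [(Tg, False)]))) dvd m * k" .
  qed
  have mem: "s (?c w) \<in> orbit_sizes m n q" for w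
  proof (induction w rule: rev_induct)
    case Nil
    have "bcls m n (bpow k) \<in> \<Lambda> \<longleftrightarrow> int (s (?c [])) dvd k" for k
      using sc[of "[]" k] cosw_eq_Nil[OF sub] by simp
    from b_index_eq[OF sub this] show ?case using q unfolding mem_orbit_sizes_iff PH_def by simp
  next
    case (snoc a w)
    obtain g e where a: "a = (g, e)" by force
    show ?case
    proof (cases g)
      case Bg
      define j :: int where "j = (if e then - 1 else 1)"
      have "[a] = bpow j" by (simp add: a Bg bpow_def j_def)
      then have wa: "?c (w @ [a]) = ?c (w @ bpow j)" by simp
      have "int (s (?c (w @ bpow j))) dvd k \<longleftrightarrow> int (s (?c w)) dvd k" for k
      proof -
        have "int (s (?c (w @ bpow j))) dvd k \<longleftrightarrow> ?c ((w @ bpow j) @ bpow k) = ?c (w @ bpow j)" using sc by blast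
        also have "?c ((w @ bpow j) @ bpow k) = ?c ((w @ bpow k) @ bpow j)"
          using cosw_bpow_add[of m n \<Lambda> w j k] cosw_bpow_add[of m n \<Lambda> w k j] by (simp add: add.commute)
        also have "(?c ((w @ bpow k) @ bpow j) = ?c (w @ bpow j)) \<longleftrightarrow> ?c (w @ bpow k) = ?c w"
          by (rule cosw_append_iff[OF sub])
        finally show ?thesis using sc by simp
      qed
      then have "s (?c (w @ bpow j)) = s (?c w)" by (metis dvd_antisym dvd_refl int_dvd_int_iff)
      then show ?thesis using snoc wa by simp
    next
      case Tg
      show ?thesis
      proof (cases e)
        case True
        have "edge_compat n m (s (?c (w @ [a]))) (s (?c w))"
          using tc[of "w @ [(Tg, True)]"] cosw_T_inv[of m n \<Lambda> w] by (simp add: a Tg True)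
        then show ?thesis using orbit_sizes_compat[OF m0] snoc by blast
      next
        case False
        have "edge_compat n m (s (?c w)) (s (?c (w @ [a])))" using tc[of w] by (simp add: a Tg False)
        then show ?thesis using orbit_sizes_compat[OF m0] snoc by blast
      qed
    qed
  qed
  have cY: "countable (range ?c)" using countable_words by (rule countable_image)
  have ne: "orbit_sizes m n q \<noteq> {}" using mem by blast
  have clos: "A k y \<in> range ?c" if "y \<in> range ?c" for k y using that Ac by auto
  have "\<exists>B sz (\<iota> :: word set set \<Rightarrow> nat). orbit_system B sz (orbit_sizes m n q) m n \<and> inj_on \<iota> (range ?c) \<and>
     (\<forall>y\<in>range ?c. \<forall>k. B k (\<iota> y) = \<iota> (A k y)) \<and> (\<forall>y\<in>range ?c. sz (\<iota> y) = s y)"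
  proof (rule universe[OF mn cY ne])
    show "s y \<in> orbit_sizes m n q" if "y \<in> range ?c" for y using that mem by blast
    show "A k y = y \<longleftrightarrow> int (s y) dvd k" if "y \<in> range ?c" for y k using s that by blast
  qed (rule clos A0 Aadd, assumption)+
  then obtain B sz \<iota> where U: "orbit_system B sz (orbit_sizes m n q) m n" "inj_on (\<iota> :: word set set \<Rightarrow> nat) (range ?c)"
    "\<forall>y\<in>range ?c. \<forall>k. B k (\<iota> y) = \<iota> (A k y)" by (elim exE conjE)
  have "coset_system B sz (orbit_sizes m n q) m n \<Lambda> (\<lambda>w. \<iota> (?c w))"
  proof (rule coset_system.intro[OF U(1)], rule coset_system_axioms.intro)
    show "\<iota> (?c u) = \<iota> (?c v) \<longleftrightarrow> ?c u = ?c v" for u v using U(2) by (simp add: inj_on_eq_iff)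
    show "B k (\<iota> (?c w)) = \<iota> (?c (w @ bpow k))" for k w using U(3) Ac by simp
  qed (rule sub)
  then show ?thesis by blast
qed

definition inf_subgroups :: "int \<Rightarrow> int \<Rightarrow> enat \<Rightarrow> word set set set" where
  "inf_subgroups m n q = {\<Lambda>. subgroup \<Lambda> (BS m n) \<and> PH m n \<Lambda> = q \<and> inf_bcosets m n \<Lambda>}"

lemma (in orbit_system) stab_inf_subgroups:
  assumes S: "S = orbit_sizes m n q" and T: "full T" "nofin T"
  shows "stab T x \<in> inf_subgroups m n q"
proof -
  have "PH m n (stab T x) = q"
    using sz_in[of x] unfolding S mem_orbit_sizes_iff PH_def b_index_stab[OF T(1)] .
  then show ?thesis using subgroup_stab[OF T(1)] inf_bcosets_stab[OF T] by (simp add: inf_subgroups_def)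
qed

lemma orbit_sizes_zero: "0 \<notin> orbit_sizes m n q \<or> orbit_sizes m n q = {0}" by (simp add: orbit_sizes_def)

lemma inf_subgroups_two:
  assumes mn: "2 \<le> \<bar>m\<bar>" "2 \<le> \<bar>n\<bar>" and L: "\<Lambda> \<in> inf_subgroups m n q" and W: "finite W"
  shows "\<exists>\<Lambda>1 \<Lambda>2. \<Lambda>1 \<in> inf_subgroups m n q \<and> \<Lambda>2 \<in> inf_subgroups m n q \<and> \<Lambda>1 \<noteq> \<Lambda>2 \<and>
    (\<forall>w\<in>W. (bcls m n w \<in> \<Lambda>1 \<longleftrightarrow> bcls m n w \<in> \<Lambda>) \<and> (bcls m n w \<in> \<Lambda>2 \<longleftrightarrow> bcls m n w \<in> \<Lambda>))"
proof -
  have L': "subgroup \<Lambda> (BS m n)" "PH m n \<Lambda> = q" "inf_bcosets m n \<Lambda>" using L by (auto simp: inf_subgroups_def)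
  obtain B sz \<iota> where "coset_system B sz (orbit_sizes m n q) m n \<Lambda> \<iota>" using coset_universe[OF mn L'(1,2)] by blast
  then interpret coset_system B sz "orbit_sizes m n q" m n \<Lambda> \<iota> .
  have c: "cond (T0 (prefs W))" using cond_T0[OF finite_prefs[OF W] L'(3)] .
  have "surj (id :: nat \<Rightarrow> nat)" by simp
  from generic_two[OF c this orbit_sizes_zero, of "\<iota> []"] obtain TA TB w where
    T: "T0 (prefs W) \<subseteq> TA" "full TA" "nofin TA" "T0 (prefs W) \<subseteq> TB" "full TB" "nofin TB"
      "pact B TA w (\<iota> []) (\<iota> [])" "\<not> pact B TB w (\<iota> []) (\<iota> [])" by (elim exE conjE)
  have "stab TA (\<iota> []) \<noteq> stab TB (\<iota> [])" using T(7,8) mem_stab[OF T(2), of w "\<iota> []"] mem_stab[OF T(5), of w "\<iota> []"] by blast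
  then show ?thesis
    using stab_inf_subgroups[OF refl T(2,3)] stab_inf_subgroups[OF refl T(5,6)] stab_agrees[OF T(2,1)] stab_agrees[OF T(5,4)]
    by (intro exI[of _ "stab TA (\<iota> [])"] exI[of _ "stab TB (\<iota> [])"]) simp
qed

lemma inf_subgroups_ht:
  assumes mn: "2 \<le> \<bar>m\<bar>" "2 \<le> \<bar>n\<bar>" and L: "\<Lambda> \<in> inf_subgroups m n q" and W: "finite W"
    and q: "q = 1 \<or> q = \<infinity> \<and> \<bar>m\<bar> \<noteq> \<bar>n\<bar>"
  shows "\<exists>\<Lambda>'. \<Lambda>' \<in> inf_subgroups m n q \<and> highly_transitive m n \<Lambda>' \<and> (\<forall>w\<in>W. bcls m n w \<in> \<Lambda>' \<longleftrightarrow> bcls m n w \<in> \<Lambda>)"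
proof -
  have L': "subgroup \<Lambda> (BS m n)" "PH m n \<Lambda> = q" "inf_bcosets m n \<Lambda>" using L by (auto simp: inf_subgroups_def)
  obtain B sz \<iota> where "coset_system B sz (orbit_sizes m n q) m n \<Lambda> \<iota>" using coset_universe[OF mn L'(1,2)] by blast
  then interpret coset_system B sz "orbit_sizes m n q" m n \<Lambda> \<iota> .
  have c: "cond (T0 (prefs W))" using cond_T0[OF finite_prefs[OF W] L'(3)] .
  have e: "surj (id :: nat \<Rightarrow> nat)" by simp
  have s: "separable m n (orbit_sizes m n q)"
    using q separable_one[OF m0 n0] separable_zero[OF m0 n0] by (auto simp: orbit_sizes_def)
  have p: "orbit_sizes m n q = {0} \<or> 0 \<notin> orbit_sizes m n q \<and> (\<forall>N\<in>orbit_sizes m n q. \<forall>p. prime p \<longrightarrow> p dvd km N \<longrightarrow> p dvd na \<or> p dvd mc)"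
  proof (cases "q = \<infinity>")
    case True then show ?thesis by (simp add: orbit_sizes_def)
  next
    case False
    then have q1: "q = 1" using q by blast
    have "p dvd na \<or> p dvd mc" if N: "N \<in> orbit_sizes m n q" and p: "prime p" "p dvd km N" for N p
    proof -
      have "N > 0" "Ph m n (enat N) = 1" using N q1 by (auto simp: orbit_sizes_def)
      from phenotype_one_primes[OF m0 n0 this p(1)] p(2) show ?thesis
        unfolding km_def na_def mc_def mm_def nn_def by blast
    qed
    then show ?thesis using False by (simp add: orbit_sizes_def)
  qed
  obtain T where T: "T0 (prefs W) \<subseteq> T" "full T" "nofin T" "htrans T" using generic_ht[OF c e s p] by (elim exE conjE)
  show ?thesis
    using stab_inf_subgroups[OF refl T(2,3)] highly_transitive_stab[OF T(2,4) infinite_UNIV_nat] stab_agrees[OF T(2,1)]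
    by (intro exI[of _ "stab T (\<iota> [])"]) simp
qed

lemma inf_subgroups_nonempty:
  assumes mn: "2 \<le> \<bar>m\<bar>" "2 \<le> \<bar>n\<bar>" and q: "q \<in> phenotypes m n"
  shows "inf_subgroups m n q \<noteq> {}"
proof -
  obtain \<Lambda> where L: "subgroup \<Lambda> (BS m n)" "PH m n \<Lambda> = q" using q by (auto simp: phenotypes_def SubG_def)
  obtain B sz \<iota> where "coset_system B sz (orbit_sizes m n q) m n \<Lambda> \<iota>" using coset_universe[OF mn L] by blast
  then interpret coset_system B sz "orbit_sizes m n q" m n \<Lambda> \<iota> .
  have c: "cond {}" by (auto simp: cond_def piso_def unsat_def)
  have e: "surj (id :: nat \<Rightarrow> nat)" by simp
  from generic_two[OF c e orbit_sizes_zero, of 0] obtain T where T: "full T" "nofin T" by (elim exE conjE)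
  from stab_inf_subgroups[OF refl T] show ?thesis by blast
qed

lemma not_inf_bcosetsE:
  assumes "\<not> inf_bcosets m n \<Lambda>"
  obtains F where "finite F" "\<forall>w. \<exists>f\<in>F. \<exists>k. cosw m n \<Lambda> w = cosw m n \<Lambda> (f @ bpow k)"
proof -
  from assms have "\<exists>F. finite F \<and> (\<forall>w. \<exists>f\<in>F. \<exists>k. cosw m n \<Lambda> w = cosw m n \<Lambda> (f @ bpow k))"
    unfolding inf_bcosets_def cosw_def by simp
  then obtain F where F: "finite F" "\<forall>w. \<exists>f\<in>F. \<exists>k. cosw m n \<Lambda> w = cosw m n \<Lambda> (f @ bpow k)" by (elim exE conjE)
  show thesis by (rule that[OF F])
qed

lemma inf_bcosets_infinite_phenotype:
  assumes mn: "2 \<le> \<bar>m\<bar>" "2 \<le> \<bar>n\<bar>" and L: "subgroup \<Lambda> (BS m n)" "PH m n \<Lambda> = \<infinity>" and ne: "\<bar>m\<bar> \<noteq> \<bar>n\<bar>"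
  shows "inf_bcosets m n \<Lambda>"
proof (rule ccontr)
  assume "\<not> ?thesis"
  then obtain F where F: "finite F" "\<forall>w. \<exists>f\<in>F. \<exists>k. cosw m n \<Lambda> w = cosw m n \<Lambda> (f @ bpow k)"
    by (rule not_inf_bcosetsE)
  obtain B sz \<iota> where "coset_system B sz (orbit_sizes m n \<infinity>) m n \<Lambda> \<iota>" using coset_universe[OF mn L] by blast
  then interpret coset_system B sz "orbit_sizes m n \<infinity>" m n \<Lambda> \<iota> .
  have P: "piso G" and R: "range \<iota> \<subseteq> (\<Union>f\<in>\<iota> ` F. orb f)" using G_piso[OF F] by blast+
  have fin: "finite (\<iota> ` F)" using F(1) by simp
  have z: "\<forall>x\<in>range \<iota>. sz x = 0" using sz_in by (simp add: orbit_sizes_def)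
  have o: "\<forall>x\<in>range \<iota>. orb x \<subseteq> range \<iota>" using orb_iota by blast
  have ne': "range \<iota> \<noteq> {}" by simp
  show False
  proof (cases "\<bar>m\<bar> \<le> \<bar>n\<bar>")
    case True
    from free_class_count(1)[OF P o _ G_image(1) fin R z ne' True] show False using ne by (simp add: Domain_G)
  next
    case False
    then have le: "\<bar>n\<bar> \<le> \<bar>m\<bar>" by simp
    have P': "orbit_system.piso B n m (G\<inverse>)" using P by (simp add: piso_dual)
    from orbit_system.free_class_count(1)[OF dual P' o _ G_image(2) fin R z ne' le] show False
      using ne by (simp add: Range_G)
  qed
qed

lemma finite_index_of_finite_phenotype:
  assumes mn: "2 \<le> \<bar>m\<bar>" "2 \<le> \<bar>n\<bar>" and L: "subgroup \<Lambda> (BS m n)" "PH m n \<Lambda> \<noteq> \<infinity>" and ni: "\<not> inf_bcosets m n \<Lambda>"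
  shows "finite (rcosets\<^bsub>BS m n\<^esub> \<Lambda>)"
proof -
  obtain F where F: "finite F" "\<forall>w. \<exists>f\<in>F. \<exists>k. cosw m n \<Lambda> w = cosw m n \<Lambda> (f @ bpow k)"
    using ni by (rule not_inf_bcosetsE)
  define q where "q = PH m n \<Lambda>"
  obtain B sz \<iota> where "coset_system B sz (orbit_sizes m n q) m n \<Lambda> \<iota>" using coset_universe[OF mn L(1) q_def[symmetric]] by blast
  then interpret coset_system B sz "orbit_sizes m n q" m n \<Lambda> \<iota> .
  have R: "range \<iota> \<subseteq> (\<Union>f\<in>\<iota> ` F. orb f)" using G_piso[OF F] by blast
  have "sz x > 0" for x using sz_in[of x] L(2) by (simp add: orbit_sizes_def q_def)
  then have "finite (\<Union>f\<in>\<iota> ` F. orb f)" using F(1) finite_orb by simp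
  then have "finite (range \<iota>)" using R finite_subset by blast
  then show ?thesis by (rule finite_rcosets)
qed

section \<open>The space of subgroups\<close>

definition agree :: "int \<Rightarrow> int \<Rightarrow> word set \<Rightarrow> word set set \<Rightarrow> word set set \<Rightarrow> bool" where
  "agree m n W \<Lambda> \<Lambda>' \<longleftrightarrow> (\<forall>w\<in>W. bcls m n w \<in> \<Lambda>' \<longleftrightarrow> bcls m n w \<in> \<Lambda>)"

lemma topspace_Sub_top: "topspace (Sub_top m n) = SubG m n"
proof -
  have "UNIV \<in> {{\<Lambda>. I \<subseteq> \<Lambda> \<and> J \<inter> \<Lambda> = {}} | I J.
           finite I \<and> finite J \<and> I \<subseteq> carrier (BS m n) \<and> J \<subseteq> carrier (BS m n)}"
    by (intro CollectI exI[of _ "{}"]) simp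
  then show ?thesis unfolding Sub_top_def by auto
qed

lemma Sub_top_nbhd:
  assumes U: "openin (Sub_top m n) U" and L: "\<Lambda> \<in> U"
  shows "\<exists>W. finite W \<and> (\<forall>\<Lambda>'\<in>SubG m n. agree m n W \<Lambda> \<Lambda>' \<longrightarrow> \<Lambda>' \<in> U)"
proof -
  let ?S = "{{\<Lambda>. I \<subseteq> \<Lambda> \<and> J \<inter> \<Lambda> = {}} | I J.
           finite I \<and> finite J \<and> I \<subseteq> carrier (BS m n) \<and> J \<subseteq> carrier (BS m n)}"
  obtain U' where U': "generate_topology_on ?S U'" "U = U' \<inter> SubG m n"
    using U unfolding Sub_top_def openin_subtopology openin_topology_generated_by_iff by blast
  have "\<forall>\<Lambda>\<in>U'. \<exists>W. finite W \<and> (\<forall>\<Lambda>'. agree m n W \<Lambda> \<Lambda>' \<longrightarrow> \<Lambda>' \<in> U')"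
    using U'(1)
  proof (induction rule: generate_topology_on.induct)
    case Empty
    then show ?case by simp
  next
    case (Int a b)
    show ?case
    proof
      fix \<Lambda> assume "\<Lambda> \<in> a \<inter> b"
      then obtain W1 W2 where W: "finite W1" "\<forall>\<Lambda>'. agree m n W1 \<Lambda> \<Lambda>' \<longrightarrow> \<Lambda>' \<in> a"
        "finite W2" "\<forall>\<Lambda>'. agree m n W2 \<Lambda> \<Lambda>' \<longrightarrow> \<Lambda>' \<in> b" using Int.IH by (metis IntE)
      have "\<forall>\<Lambda>'. agree m n (W1 \<union> W2) \<Lambda> \<Lambda>' \<longrightarrow> \<Lambda>' \<in> a \<inter> b" using W(2,4) by (simp add: agree_def)
      then show "\<exists>W. finite W \<and> (\<forall>\<Lambda>'. agree m n W \<Lambda> \<Lambda>' \<longrightarrow> \<Lambda>' \<in> a \<inter> b)"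
        using W(1,3) by (intro exI[of _ "W1 \<union> W2"]) simp
    qed
  next
    case (UN K)
    then show ?case by (meson Union_iff)
  next
    case (Basis s)
    then obtain I J where IJ: "s = {\<Lambda>. I \<subseteq> \<Lambda> \<and> J \<inter> \<Lambda> = {}}" "finite I" "finite J" "I \<subseteq> range (bcls m n)" "J \<subseteq> range (bcls m n)"
      unfolding carrier_BS by blast
    obtain A where A: "finite A" "I = bcls m n ` A" using finite_subset_image[OF IJ(2,4)] by blast
    obtain C where C: "finite C" "J = bcls m n ` C" using finite_subset_image[OF IJ(3,5)] by blast
    show ?case
    proof
      fix \<Lambda> assume L: "\<Lambda> \<in> s"
      have "\<Lambda>' \<in> s" if "agree m n (A \<union> C) \<Lambda> \<Lambda>'" for \<Lambda>'
        using that L unfolding IJ(1) A(2) C(2) agree_def by auto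
      then show "\<exists>W. finite W \<and> (\<forall>\<Lambda>'. agree m n W \<Lambda> \<Lambda>' \<longrightarrow> \<Lambda>' \<in> s)"
        using A(1) C(1) by (intro exI[of _ "A \<union> C"]) simp
    qed
  qed
  moreover have "\<Lambda> \<in> U'" using L U'(2) by blast
  ultimately obtain W where "finite W" "\<forall>\<Lambda>'. agree m n W \<Lambda> \<Lambda>' \<longrightarrow> \<Lambda>' \<in> U'" by blast
  then show ?thesis unfolding U'(2) by (intro exI[of _ W]) simp
qed

lemma openin_agree:
  assumes W: "finite W"
  shows "openin (Sub_top m n) {\<Lambda>' \<in> SubG m n. agree m n W \<Lambda> \<Lambda>'}"
proof -
  define I where "I = bcls m n ` {w \<in> W. bcls m n w \<in> \<Lambda>}"
  define J where "J = bcls m n ` {w \<in> W. bcls m n w \<notin> \<Lambda>}"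
  have IJ: "finite I" "finite J" "I \<subseteq> carrier (BS m n)" "J \<subseteq> carrier (BS m n)" using W by (auto simp: I_def J_def)
  have e: "{\<Lambda>' \<in> SubG m n. agree m n W \<Lambda> \<Lambda>'} = {\<Lambda>'. I \<subseteq> \<Lambda>' \<and> J \<inter> \<Lambda>' = {}} \<inter> SubG m n"
    by (auto simp: agree_def I_def J_def)
  show ?thesis unfolding e Sub_top_def
    by (rule openin_subtopology_Int, rule topology_generated_by_Basis) (use IJ in blast)
qed

lemma openin_by_words:
  assumes "\<And>\<Lambda>. \<Lambda> \<in> A \<Longrightarrow> \<Lambda> \<in> SubG m n \<and> (\<exists>W. finite W \<and> (\<forall>\<Lambda>'\<in>SubG m n. agree m n W \<Lambda> \<Lambda>' \<longrightarrow> \<Lambda>' \<in> A))"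
  shows "openin (Sub_top m n) A"
proof (subst openin_subopen, intro ballI)
  fix \<Lambda> assume "\<Lambda> \<in> A"
  then obtain W where W: "\<Lambda> \<in> SubG m n" "finite W" "\<forall>\<Lambda>'\<in>SubG m n. agree m n W \<Lambda> \<Lambda>' \<longrightarrow> \<Lambda>' \<in> A" using assms by blast
  have "\<Lambda> \<in> {\<Lambda>' \<in> SubG m n. agree m n W \<Lambda> \<Lambda>'}" using W(1) by (simp add: agree_def)
  moreover have "{\<Lambda>' \<in> SubG m n. agree m n W \<Lambda> \<Lambda>'} \<subseteq> A" using W(3) by blast
  ultimately show "\<exists>T. openin (Sub_top m n) T \<and> \<Lambda> \<in> T \<and> T \<subseteq> A" using openin_agree[OF W(2)] by blast
qed

lemma inf_subgroups_SubG: "inf_subgroups m n q \<subseteq> SubG m n" by (auto simp: inf_subgroups_def SubG_def)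

lemma inf_subgroups_subset_kernel:
  assumes mn: "2 \<le> \<bar>m\<bar>" "2 \<le> \<bar>n\<bar>"
  shows "inf_subgroups m n q \<subseteq> perfect_kernel (Sub_top m n)"
proof -
  let ?X = "Sub_top m n" and ?D = "inf_subgroups m n q"
  have sub: "?D \<subseteq> topspace ?X" using inf_subgroups_SubG by (simp add: topspace_Sub_top)
  have "?D \<subseteq> ?X derived_set_of ?D"
  proof
    fix \<Lambda> assume L: "\<Lambda> \<in> ?D"
    show "\<Lambda> \<in> ?X derived_set_of ?D" unfolding in_derived_set_of
    proof (intro conjI allI impI)
      show "\<Lambda> \<in> topspace ?X" using L sub by blast
      fix U assume "\<Lambda> \<in> U \<and> openin ?X U"
      then obtain W where W: "finite W" "\<forall>\<Lambda>'\<in>SubG m n. agree m n W \<Lambda> \<Lambda>' \<longrightarrow> \<Lambda>' \<in> U" using Sub_top_nbhd by blast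
      from inf_subgroups_two[OF mn L W(1)] obtain \<Lambda>1 \<Lambda>2 where 1: "\<Lambda>1 \<in> ?D" "\<Lambda>2 \<in> ?D" "\<Lambda>1 \<noteq> \<Lambda>2"
        "\<forall>w\<in>W. (bcls m n w \<in> \<Lambda>1 \<longleftrightarrow> bcls m n w \<in> \<Lambda>) \<and> (bcls m n w \<in> \<Lambda>2 \<longleftrightarrow> bcls m n w \<in> \<Lambda>)" by (elim exE conjE)
      have "agree m n W \<Lambda> \<Lambda>1" "agree m n W \<Lambda> \<Lambda>2" using 1(4) by (simp_all add: agree_def)
      then have "\<Lambda>1 \<in> U" "\<Lambda>2 \<in> U" using W(2) 1(1,2) inf_subgroups_SubG by blast+
      then show "\<exists>y. y \<noteq> \<Lambda> \<and> y \<in> ?D \<and> y \<in> U" using 1(1-3) by metis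
    qed
  qed
  then have "?X closure_of ?D \<subseteq> ?X derived_set_of ?D" unfolding closure_of by blast
  also have "\<dots> \<subseteq> ?X derived_set_of (?X closure_of ?D)" using closure_of_subset[OF sub] by (rule derived_set_of_mono)
  finally have "?X closure_of ?D \<in> {P. closedin ?X P \<and> P \<subseteq> ?X derived_set_of P}" by simp
  then show ?thesis unfolding perfect_kernel_def using closure_of_subset[OF sub] by blast
qed

lemma kernel_not_isolated:
  assumes L: "\<Lambda> \<in> perfect_kernel (Sub_top m n)"
  shows "\<Lambda> \<in> SubG m n" "openin (Sub_top m n) U \<Longrightarrow> \<Lambda> \<in> U \<Longrightarrow> \<exists>\<Lambda>'. \<Lambda>' \<noteq> \<Lambda> \<and> \<Lambda>' \<in> U"
proof -
  obtain P where P: "closedin (Sub_top m n) P" "P \<subseteq> Sub_top m n derived_set_of P" "\<Lambda> \<in> P"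
    using L unfolding perfect_kernel_def by blast
  then have d: "\<Lambda> \<in> Sub_top m n derived_set_of P" by blast
  then show "\<Lambda> \<in> SubG m n" unfolding in_derived_set_of topspace_Sub_top by blast
  show "openin (Sub_top m n) U \<Longrightarrow> \<Lambda> \<in> U \<Longrightarrow> \<exists>\<Lambda>'. \<Lambda>' \<noteq> \<Lambda> \<and> \<Lambda>' \<in> U" using d unfolding in_derived_set_of by blast
qed

lemma finite_index_isolated:
  assumes L: "subgroup \<Lambda> (BS m n)" and fin: "finite (rcosets\<^bsub>BS m n\<^esub> \<Lambda>)"
  shows "\<exists>W. finite W \<and> (\<forall>\<Lambda>'\<in>SubG m n. agree m n W \<Lambda> \<Lambda>' \<longrightarrow> \<Lambda>' = \<Lambda>)"
proof -
  let ?c = "cosw m n \<Lambda>"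
  have fin: "finite (range ?c)" using fin by (simp add: rcosets_cosw)
  define r where "r = (\<lambda>y. SOME w. ?c w = y)"
  define \<rho> where "\<rho> = (\<lambda>w. r (?c w))"
  have rho: "?c (\<rho> w) = ?c w" for w unfolding \<rho>_def r_def by (rule someI[of _ w]) simp
  define R where "R = insert [] (r ` range ?c)"
  have R: "finite R" "\<And>w. \<rho> w \<in> R" "[] \<in> R" using fin by (auto simp: R_def \<rho>_def)
  define W where "W = (\<lambda>(x, y). x @ winv y) ` (R \<times> R) \<union> (\<lambda>(x, a, y). x @ [a] @ winv y) ` (R \<times> UNIV \<times> R)"
  have W: "finite W" unfolding W_def using R(1) finite_letters by simp
  have W1: "x @ winv y \<in> W" if "x \<in> R" "y \<in> R" for x y using that unfolding W_def by force
  have W2: "(x @ [a]) @ winv y \<in> W" if "x \<in> R" "y \<in> R" for x y a using that unfolding W_def by force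
  have "\<Lambda>' = \<Lambda>" if L': "\<Lambda>' \<in> SubG m n" and ag: "agree m n W \<Lambda> \<Lambda>'" for \<Lambda>'
  proof -
    let ?c' = "cosw m n \<Lambda>'"
    have L'': "subgroup \<Lambda>' (BS m n)" using L' by (simp add: SubG_def)
    have tr: "?c' u = ?c' v \<longleftrightarrow> ?c u = ?c v" if "u @ winv v \<in> W" for u v
      using ag that unfolding agree_def cosw_eq[OF L] cosw_eq[OF L''] by blast
    have key: "?c' w = ?c' (\<rho> w)" for w
    proof (induction w rule: rev_induct)
      case Nil
      show ?case using tr[OF W1[OF R(3) R(2)[of "[]"]]] rho[of "[]"] by simp
    next
      case (snoc a w)
      have "?c' (w @ [a]) = ?c' (\<rho> w @ [a])" using snoc cosw_append_iff[OF L''] by blast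
      also have "\<dots> = ?c' (\<rho> (w @ [a]))"
      proof -
        have "?c (\<rho> w @ [a]) = ?c (w @ [a])" using rho[of w] cosw_append_iff[OF L] by blast
        then have "?c (\<rho> w @ [a]) = ?c (\<rho> (w @ [a]))" using rho by simp
        then show ?thesis using tr[OF W2[OF R(2)[of w] R(2)[of "w @ [a]"]]] by blast
      qed
      finally show ?case .
    qed
    have "bcls m n w \<in> \<Lambda>' \<longleftrightarrow> bcls m n w \<in> \<Lambda>" for w
    proof -
      have "bcls m n w \<in> \<Lambda>' \<longleftrightarrow> ?c' w = ?c' []" by (simp add: cosw_eq_Nil[OF L''])
      also have "\<dots> \<longleftrightarrow> ?c' (\<rho> w) = ?c' (\<rho> [])" using key by simp
      also have "\<dots> \<longleftrightarrow> ?c (\<rho> w) = ?c (\<rho> [])" by (rule tr[OF W1[OF R(2) R(2)]])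
      also have "\<dots> \<longleftrightarrow> bcls m n w \<in> \<Lambda>" using rho by (simp add: cosw_eq_Nil[OF L])
      finally show ?thesis .
    qed
    moreover have "\<Lambda>' \<subseteq> range (bcls m n)" "\<Lambda> \<subseteq> range (bcls m n)"
      using subgroup.subset[OF L''] subgroup.subset[OF L] by (simp_all add: carrier_BS)
    ultimately show ?thesis by blast
  qed
  then show ?thesis using W by blast
qed

lemma kernel_subset_inf_subgroups:
  assumes mn: "2 \<le> \<bar>m\<bar>" "2 \<le> \<bar>n\<bar>" and q: "q = 1 \<or> q = \<infinity> \<and> \<bar>m\<bar> \<noteq> \<bar>n\<bar>"
  shows "Kq m n q \<subseteq> inf_subgroups m n q"
proof
  fix \<Lambda> assume "\<Lambda> \<in> Kq m n q"
  then have K: "\<Lambda> \<in> perfect_kernel (Sub_top m n)" "PH m n \<Lambda> = q" by (auto simp: Kq_def)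
  have L: "subgroup \<Lambda> (BS m n)" using kernel_not_isolated(1)[OF K(1)] by (simp add: SubG_def)
  have "inf_bcosets m n \<Lambda>"
  proof (cases "q = \<infinity>")
    case True
    then have "\<bar>m\<bar> \<noteq> \<bar>n\<bar>" using q by auto
    then show ?thesis using inf_bcosets_infinite_phenotype[OF mn L] K(2) True by simp
  next
    case False
    show ?thesis
    proof (rule ccontr)
      assume "\<not> inf_bcosets m n \<Lambda>"
      then have "finite (rcosets\<^bsub>BS m n\<^esub> \<Lambda>)" using finite_index_of_finite_phenotype[OF mn L] K(2) False by simp
      then obtain W where W: "finite W" "\<forall>\<Lambda>'\<in>SubG m n. agree m n W \<Lambda> \<Lambda>' \<longrightarrow> \<Lambda>' = \<Lambda>"
        using finite_index_isolated[OF L] by blast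
      have "\<Lambda> \<in> {\<Lambda>' \<in> SubG m n. agree m n W \<Lambda> \<Lambda>'}" using L by (simp add: agree_def SubG_def)
      from kernel_not_isolated(2)[OF K(1) openin_agree[OF W(1)] this] show False using W(2) by blast
    qed
  qed
  then show "\<Lambda> \<in> inf_subgroups m n q" using L K(2) by (simp add: inf_subgroups_def)
qed

lemma inf_subgroups_subset_Kq: "2 \<le> \<bar>m\<bar> \<Longrightarrow> 2 \<le> \<bar>n\<bar> \<Longrightarrow> inf_subgroups m n q \<subseteq> Kq m n q"
  using inf_subgroups_subset_kernel by (auto simp: Kq_def inf_subgroups_def)

lemma Kq_SubG: "Kq m n q \<subseteq> SubG m n"
  unfolding Kq_def using kernel_not_isolated(1) by blast

definition many :: "int \<Rightarrow> int \<Rightarrow> nat \<Rightarrow> word set set \<Rightarrow> bool" where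
  "many m n k \<Lambda> \<longleftrightarrow> (\<exists>ws. length ws = k \<and> distinct (map (cosw m n \<Lambda>) ws))"

definition moves :: "int \<Rightarrow> int \<Rightarrow> word list \<Rightarrow> word list \<Rightarrow> word set set \<Rightarrow> bool" where
  "moves m n us vs \<Lambda> \<longleftrightarrow> (length us = length vs \<and> distinct (map (cosw m n \<Lambda>) us) \<and> distinct (map (cosw m n \<Lambda>) vs) \<longrightarrow>
     (\<exists>w. \<forall>i<length us. cosw m n \<Lambda> (us ! i @ w) = cosw m n \<Lambda> (vs ! i)))"

lemma highly_transitive_iff:
  assumes L: "subgroup \<Lambda> (BS m n)"
  shows "highly_transitive m n \<Lambda> \<longleftrightarrow> (\<forall>k. many m n k \<Lambda>) \<and> (\<forall>us vs. moves m n us vs \<Lambda>)"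
proof -
  let ?c = "cosw m n \<Lambda>"
  have inf: "infinite (range ?c) \<longleftrightarrow> (\<forall>k. many m n k \<Lambda>)"
  proof
    assume i: "infinite (range ?c)"
    show "\<forall>k. many m n k \<Lambda>"
    proof
      fix k
      obtain A where A: "finite A" "card A = k" "A \<subseteq> range ?c" using infinite_arbitrarily_large[OF i] by blast
      obtain xs where xs: "set xs = A" "distinct xs" using finite_distinct_list[OF A(1)] by blast
      have "\<forall>x\<in>set xs. \<exists>w. x = ?c w" using xs A(3) by blast
      then obtain ws where ws: "xs = map ?c ws" unfolding ex_map_conv[symmetric] by blast
      have "length ws = k" using distinct_card[OF xs(2)] xs(1) A(2) ws by simp
      then show "many m n k \<Lambda>" unfolding many_def using xs(2) ws by blast
    qed
  next
    assume a: "\<forall>k. many m n k \<Lambda>"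
    show "infinite (range ?c)"
    proof
      assume f: "finite (range ?c)"
      obtain ws where ws: "length ws = Suc (card (range ?c))" "distinct (map ?c ws)" using a unfolding many_def by blast
      have "card (set (map ?c ws)) \<le> card (range ?c)" by (rule card_mono[OF f]) auto
      then show False using distinct_card[OF ws(2)] ws(1) by simp
    qed
  qed
  have mov: "(\<forall>xs ys. length xs = length ys \<and> distinct xs \<and> distinct ys \<and> set xs \<subseteq> range ?c \<and> set ys \<subseteq> range ?c \<longrightarrow>
        (\<exists>\<gamma>\<in>carrier (BS m n). \<forall>i<length xs. xs ! i #>\<^bsub>BS m n\<^esub> \<gamma> = ys ! i)) \<longleftrightarrow> (\<forall>us vs. moves m n us vs \<Lambda>)" (is "?l \<longleftrightarrow> ?r")
  proof
    assume l: ?l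
    show ?r
    proof (intro allI)
      fix us vs
      show "moves m n us vs \<Lambda>" unfolding moves_def
      proof
        assume A: "length us = length vs \<and> distinct (map ?c us) \<and> distinct (map ?c vs)"
        have "\<exists>\<gamma>\<in>carrier (BS m n). \<forall>i<length (map ?c us). map ?c us ! i #>\<^bsub>BS m n\<^esub> \<gamma> = map ?c vs ! i"
          using A by (intro l[rule_format]) auto
        then obtain w where w: "\<forall>i<length us. ?c (us ! i) #>\<^bsub>BS m n\<^esub> bcls m n w = ?c (vs ! i)"
          using A by (auto simp: carrier_BS)
        then show "\<exists>w. \<forall>i<length us. ?c (us ! i @ w) = ?c (vs ! i)" unfolding cosw_mult[OF L] by blast
      qed
    qed
  next
    assume r: ?r
    show ?l
    proof (intro allI impI)
      fix xs ys
      assume A: "length xs = length ys \<and> distinct xs \<and> distinct ys \<and> set xs \<subseteq> range ?c \<and> set ys \<subseteq> range ?c"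
      have "\<forall>x\<in>set xs. \<exists>a. x = ?c a" "\<forall>x\<in>set ys. \<exists>a. x = ?c a" using A by blast+
      then obtain us vs where us: "xs = map ?c us" and vs: "ys = map ?c vs" unfolding ex_map_conv[symmetric] by blast
      have "\<exists>w. \<forall>i<length us. ?c (us ! i @ w) = ?c (vs ! i)"
        using r[rule_format, of us vs] A unfolding moves_def us vs by simp
      then obtain w where w: "\<forall>i<length us. ?c (us ! i @ w) = ?c (vs ! i)" ..
      have "\<forall>i<length xs. xs ! i #>\<^bsub>BS m n\<^esub> bcls m n w = ys ! i"
        using w A unfolding us vs by (simp add: cosw_mult[OF L])
      then show "\<exists>\<gamma>\<in>carrier (BS m n). \<forall>i<length xs. xs ! i #>\<^bsub>BS m n\<^esub> \<gamma> = ys ! i"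
        by (intro bexI[of _ "bcls m n w"]) simp_all
    qed
  qed
  show ?thesis unfolding highly_transitive_def rcosets_cosw inf mov ..
qed

definition pairs :: "word list \<Rightarrow> word set" where
  "pairs ws = (\<lambda>(x, y). x @ winv y) ` (set ws \<times> set ws)"

lemma finite_pairs: "finite (pairs ws)" by (simp add: pairs_def)

lemma distinct_agree:
  assumes L: "subgroup \<Lambda> (BS m n)" "subgroup \<Lambda>' (BS m n)" and ag: "agree m n (pairs ws) \<Lambda> \<Lambda>'"
  shows "distinct (map (cosw m n \<Lambda>') ws) \<longleftrightarrow> distinct (map (cosw m n \<Lambda>) ws)"
proof -
  have "cosw m n \<Lambda>' x = cosw m n \<Lambda>' y \<longleftrightarrow> cosw m n \<Lambda> x = cosw m n \<Lambda> y" if "x \<in> set ws" "y \<in> set ws" for x y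
  proof -
    have "x @ winv y \<in> pairs ws" using that by (force simp: pairs_def)
    then show ?thesis using ag unfolding agree_def cosw_eq[OF L(1)] cosw_eq[OF L(2)] by blast
  qed
  then show ?thesis unfolding distinct_map inj_on_def by blast
qed

lemma openin_many: "openin (Sub_top m n) {\<Lambda> \<in> SubG m n. many m n k \<Lambda>}"
proof (rule openin_by_words)
  fix \<Lambda> assume L: "\<Lambda> \<in> {\<Lambda> \<in> SubG m n. many m n k \<Lambda>}"
  then obtain ws where ws: "length ws = k" "distinct (map (cosw m n \<Lambda>) ws)" by (auto simp: many_def)
  have "many m n k \<Lambda>'" if "\<Lambda>' \<in> SubG m n" "agree m n (pairs ws) \<Lambda> \<Lambda>'" for \<Lambda>'
    using distinct_agree[of \<Lambda> m n \<Lambda>' ws] that L ws unfolding many_def SubG_def by blast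
  then show "\<Lambda> \<in> SubG m n \<and> (\<exists>W. finite W \<and> (\<forall>\<Lambda>'\<in>SubG m n. agree m n W \<Lambda> \<Lambda>' \<longrightarrow> \<Lambda>' \<in> {\<Lambda> \<in> SubG m n. many m n k \<Lambda>}))"
    using L finite_pairs[of ws] by (intro conjI exI[of _ "pairs ws"]) simp_all
qed

lemma openin_moves: "openin (Sub_top m n) {\<Lambda> \<in> SubG m n. moves m n us vs \<Lambda>}"
proof (rule openin_by_words)
  fix \<Lambda> assume L: "\<Lambda> \<in> {\<Lambda> \<in> SubG m n. moves m n us vs \<Lambda>}"
  have sL: "subgroup \<Lambda> (BS m n)" using L by (simp add: SubG_def)
  show "\<Lambda> \<in> SubG m n \<and> (\<exists>W. finite W \<and> (\<forall>\<Lambda>'\<in>SubG m n. agree m n W \<Lambda> \<Lambda>' \<longrightarrow> \<Lambda>' \<in> {\<Lambda> \<in> SubG m n. moves m n us vs \<Lambda>}))"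
  proof (cases "length us = length vs \<and> distinct (map (cosw m n \<Lambda>) us) \<and> distinct (map (cosw m n \<Lambda>) vs)")
    case True
    then obtain w where w: "\<forall>i<length us. cosw m n \<Lambda> (us ! i @ w) = cosw m n \<Lambda> (vs ! i)" using L by (auto simp: moves_def)
    define W where "W = (\<lambda>i. (us ! i @ w) @ winv (vs ! i)) ` {..<length us}"
    have "moves m n us vs \<Lambda>'" if L': "\<Lambda>' \<in> SubG m n" "agree m n W \<Lambda> \<Lambda>'" for \<Lambda>'
    proof -
      have sL': "subgroup \<Lambda>' (BS m n)" using L' by (simp add: SubG_def)
      have "cosw m n \<Lambda>' (us ! i @ w) = cosw m n \<Lambda>' (vs ! i)" if i: "i < length us" for i
      proof -
        have "(us ! i @ w) @ winv (vs ! i) \<in> W" using i unfolding W_def by blast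
        then show ?thesis using L'(2) w i unfolding agree_def cosw_eq[OF sL] cosw_eq[OF sL'] by blast
      qed
      then show ?thesis unfolding moves_def by blast
    qed
    moreover have "finite W" by (simp add: W_def)
    ultimately show ?thesis using L by (intro conjI exI[of _ W]) simp_all
  next
    case False
    have "moves m n us vs \<Lambda>'" if L': "\<Lambda>' \<in> SubG m n" "agree m n (pairs us \<union> pairs vs) \<Lambda> \<Lambda>'" for \<Lambda>'
    proof -
      have sL': "subgroup \<Lambda>' (BS m n)" using L' by (simp add: SubG_def)
      have "agree m n (pairs us) \<Lambda> \<Lambda>'" "agree m n (pairs vs) \<Lambda> \<Lambda>'" using L'(2) by (simp_all add: agree_def)
      then have d: "distinct (map (cosw m n \<Lambda>') us) \<longleftrightarrow> distinct (map (cosw m n \<Lambda>) us)"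
        "distinct (map (cosw m n \<Lambda>') vs) \<longleftrightarrow> distinct (map (cosw m n \<Lambda>) vs)"
        using distinct_agree[OF sL sL'] by blast+
      show ?thesis using False unfolding moves_def d by blast
    qed
    then show ?thesis using L finite_pairs by (intro conjI exI[of _ "pairs us \<union> pairs vs"]) simp_all
  qed
qed

lemma gdelta_HTq: "gdelta_in (subtopology (Sub_top m n) (Kq m n q)) (HTq m n q)"
proof -
  let ?Y = "subtopology (Sub_top m n) (Kq m n q)"
  define F where "F = range (\<lambda>k. {\<Lambda> \<in> SubG m n. many m n k \<Lambda>} \<inter> Kq m n q) \<union>
     (\<lambda>(us, vs). {\<Lambda> \<in> SubG m n. moves m n us vs \<Lambda>} \<inter> Kq m n q) ` (UNIV \<times> UNIV)"
  have "countable (lists (UNIV :: word set))" by (intro countable_lists countable_words)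
  then have cl: "countable (UNIV :: word list set)" by simp
  have cp: "countable ((UNIV :: word list set) \<times> (UNIV :: word list set))" using cl by (intro countable_SIGMA)
  have 1: "countable F" unfolding F_def by (rule countable_Un[OF _ countable_image[OF cp]]) simp
  have 2: "F \<noteq> {}" by (simp add: F_def)
  have 3: "gdelta_in ?Y A" if "A \<in> F" for A
  proof -
    have "openin ?Y A" using that unfolding F_def by (auto intro: openin_subtopology_Int openin_many openin_moves)
    then show ?thesis by (rule open_imp_gdelta_in)
  qed
  have "HTq m n q = \<Inter> F"
  proof -
    have "\<Lambda> \<in> \<Inter> F \<longleftrightarrow> \<Lambda> \<in> Kq m n q \<and> (\<forall>k. many m n k \<Lambda>) \<and> (\<forall>us vs. moves m n us vs \<Lambda>)" for \<Lambda>
    proof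
      assume A: "\<Lambda> \<in> \<Inter> F"
      have "\<Lambda> \<in> {\<Lambda> \<in> SubG m n. many m n k \<Lambda>} \<inter> Kq m n q" for k
        by (rule InterD[OF A]) (simp add: F_def)
      moreover have "\<Lambda> \<in> {\<Lambda> \<in> SubG m n. moves m n us vs \<Lambda>} \<inter> Kq m n q" for us vs
        by (rule InterD[OF A], unfold F_def, rule UnI2, rule image_eqI[of _ _ "(us, vs)"]) simp_all
      ultimately show "\<Lambda> \<in> Kq m n q \<and> (\<forall>k. many m n k \<Lambda>) \<and> (\<forall>us vs. moves m n us vs \<Lambda>)" by simp
    next
      assume A: "\<Lambda> \<in> Kq m n q \<and> (\<forall>k. many m n k \<Lambda>) \<and> (\<forall>us vs. moves m n us vs \<Lambda>)"
      then have S: "\<Lambda> \<in> SubG m n" using Kq_SubG by blast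
      show "\<Lambda> \<in> \<Inter> F"
      proof (rule InterI)
        fix X assume "X \<in> F"
        then consider k where "X = {\<Lambda> \<in> SubG m n. many m n k \<Lambda>} \<inter> Kq m n q"
          | us vs where "X = {\<Lambda> \<in> SubG m n. moves m n us vs \<Lambda>} \<inter> Kq m n q"
          unfolding F_def by fast
        then show "\<Lambda> \<in> X" using A S by cases simp_all
      qed
    qed
    moreover have "\<Lambda> \<in> HTq m n q \<longleftrightarrow> \<Lambda> \<in> Kq m n q \<and> (\<forall>k. many m n k \<Lambda>) \<and> (\<forall>us vs. moves m n us vs \<Lambda>)" for \<Lambda>
    proof (cases "\<Lambda> \<in> Kq m n q")
      case True
      then have "subgroup \<Lambda> (BS m n)" using Kq_SubG by (auto simp: SubG_def)
      then show ?thesis unfolding HTq_def using highly_transitive_iff True by simp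
    qed (simp add: HTq_def)
    ultimately show ?thesis by (intro equalityI subsetI) simp_all
  qed
  then show ?thesis using gdelta_in_Inter[OF 1 2 3] by simp
qed

lemma HTq_dense:
  assumes mn: "2 \<le> \<bar>m\<bar>" "2 \<le> \<bar>n\<bar>" and q: "q = 1 \<or> q = \<infinity> \<and> \<bar>m\<bar> \<noteq> \<bar>n\<bar>"
  shows "subtopology (Sub_top m n) (Kq m n q) closure_of HTq m n q = Kq m n q"
proof -
  let ?Y = "subtopology (Sub_top m n) (Kq m n q)"
  have top: "topspace ?Y = Kq m n q" using Kq_SubG[of m n q] by (auto simp: topspace_Sub_top)
  have "\<Lambda> \<in> ?Y closure_of HTq m n q" if L: "\<Lambda> \<in> Kq m n q" for \<Lambda>
    unfolding in_closure_of
  proof (intro conjI allI impI)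
    show "\<Lambda> \<in> topspace ?Y" using L top by simp
    fix T assume T: "\<Lambda> \<in> T \<and> openin ?Y T"
    then obtain U where U: "openin (Sub_top m n) U" "T = U \<inter> Kq m n q" unfolding openin_subtopology by blast
    then obtain W where W: "finite W" "\<forall>\<Lambda>'\<in>SubG m n. agree m n W \<Lambda> \<Lambda>' \<longrightarrow> \<Lambda>' \<in> U" using Sub_top_nbhd T by blast
    have D: "\<Lambda> \<in> inf_subgroups m n q" using kernel_subset_inf_subgroups[OF mn q] L by blast
    from inf_subgroups_ht[OF mn D W(1) q] obtain \<Lambda>' where L': "\<Lambda>' \<in> inf_subgroups m n q" "highly_transitive m n \<Lambda>'"
      "\<forall>w\<in>W. bcls m n w \<in> \<Lambda>' \<longleftrightarrow> bcls m n w \<in> \<Lambda>" by (elim exE conjE)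
    have K: "\<Lambda>' \<in> Kq m n q" using inf_subgroups_subset_Kq[OF mn] L'(1) by blast
    have "\<Lambda>' \<in> SubG m n" using inf_subgroups_SubG L'(1) by blast
    moreover have "agree m n W \<Lambda> \<Lambda>'" using L'(3) unfolding agree_def .
    ultimately have "\<Lambda>' \<in> U" using W(2) by blast
    then show "\<exists>y. y \<in> HTq m n q \<and> y \<in> T" unfolding U(2) HTq_def using K L'(2) by blast
  qed
  then show ?thesis using closure_of_subset_topspace[of ?Y "HTq m n q"] top by blast
qed

context coset_system
begin

lemma not_primitive:
  assumes refl: "\<And>x. r x x" and sym: "\<And>x y. r x y \<Longrightarrow> r y x" and trans: "\<And>x y z. r x y \<Longrightarrow> r y z \<Longrightarrow> r x z"
    and B: "\<And>x y j. r x y \<Longrightarrow> r (B j x) (B j y)"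
    and fw: "\<And>x x' y y'. (x, x') \<in> G \<Longrightarrow> (y, y') \<in> G \<Longrightarrow> r x y \<Longrightarrow> r x' y'"
    and bw: "\<And>x x' y y'. (x, x') \<in> G \<Longrightarrow> (y, y') \<in> G \<Longrightarrow> r x' y' \<Longrightarrow> r x y"
    and ne: "r (\<iota> u0) (\<iota> v0)" "\<iota> u0 \<noteq> \<iota> v0" and nf: "\<not> r (\<iota> u1) (\<iota> v1)"
  shows "\<not> primitive_action m n \<Lambda>"
proof
  let ?c = "cosw m n \<Lambda>"
  assume prim: "primitive_action m n \<Lambda>"
  define R where "R = {(?c u, ?c v) | u v. r (\<iota> u) (\<iota> v)}"
  have R: "(?c u, ?c v) \<in> R \<longleftrightarrow> r (\<iota> u) (\<iota> v)" for u v
  proof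
    assume "(?c u, ?c v) \<in> R"
    then obtain u' v' where "?c u = ?c u'" "?c v = ?c v'" "r (\<iota> u') (\<iota> v')" unfolding R_def by blast
    then show "r (\<iota> u) (\<iota> v)" by (simp flip: iota_eq)
  next
    assume "r (\<iota> u) (\<iota> v)" then show "(?c u, ?c v) \<in> R" unfolding R_def by blast
  qed
  have mv: "r (\<iota> (u @ w)) (\<iota> (v @ w))" if "r (\<iota> u) (\<iota> v)" for u v w
  proof (induction w rule: rev_induct)
    case Nil then show ?case using that by simp
  next
    case (snoc a w)
    obtain g s where a: "a = (g, s)" by force
    show ?case
    proof (cases g)
      case Bg
      have e: "[a] = bpow (if s then - 1 else 1)" by (simp add: a Bg bpow_def)
      show ?thesis using B[OF snoc, of "if s then - 1 else 1"] unfolding iota_B e[symmetric] by simp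
    next
      case Tg
      show ?thesis
      proof (cases s)
        case True
        show ?thesis using bw[OF G_I' G_I' snoc] by (simp add: a Tg True)
      next
        case False
        show ?thesis using fw[OF G_I G_I snoc] by (simp add: a Tg False)
      qed
    qed
  qed
  have "equiv (range ?c) R"
  proof (rule equivI)
    show "R \<subseteq> range ?c \<times> range ?c" by (auto simp: R_def)
    show "refl_on (range ?c) R" using refl R by (auto simp: refl_on_def)
    show "Relation.sym R"
    proof (rule symI)
      fix x y assume "(x, y) \<in> R"
      then show "(y, x) \<in> R" unfolding R_def using sym by blast
    qed
    show "Relation.trans R"
    proof (rule transI)
      fix x y z assume A: "(x, y) \<in> R" "(y, z) \<in> R"
      then obtain u v w where "x = ?c u" "y = ?c v" "z = ?c w" unfolding R_def by blast
      then show "(x, z) \<in> R" using A trans[of "\<iota> u" "\<iota> v" "\<iota> w"] by (simp add: R)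
    qed
  qed
  moreover have "\<forall>x y \<gamma>. (x, y) \<in> R \<and> \<gamma> \<in> carrier (BS m n) \<longrightarrow> (x #>\<^bsub>BS m n\<^esub> \<gamma>, y #>\<^bsub>BS m n\<^esub> \<gamma>) \<in> R"
  proof (intro allI impI, elim conjE)
    fix x y \<gamma> assume "(x, y) \<in> R" "\<gamma> \<in> carrier (BS m n)"
    then obtain u v w where uv: "x = ?c u" "y = ?c v" "r (\<iota> u) (\<iota> v)" "\<gamma> = bcls m n w"
      unfolding R_def carrier_BS by blast
    show "(x #>\<^bsub>BS m n\<^esub> \<gamma>, y #>\<^bsub>BS m n\<^esub> \<gamma>) \<in> R" unfolding uv(1,2,4) cosw_mult[OF sub] R by (rule mv[OF uv(3)])
  qed
  ultimately have "R = Id_on (range ?c) \<or> R = range ?c \<times> range ?c"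
    using prim unfolding primitive_action_def rcosets_cosw by blast
  then show False
  proof
    assume "R = Id_on (range ?c)"
    moreover have "(?c u0, ?c v0) \<in> R" using R ne(1) by simp
    ultimately have "?c u0 = ?c v0" by (simp only: Id_on_iff)
    then show False using ne(2) iota_eq by blast
  next
    assume "R = range ?c \<times> range ?c"
    then have "(?c u1, ?c v1) \<in> R" by blast
    then show False using R nf by blast
  qed
qed

end

section \<open>Invariant equivalence relations\<close>

lemma residue_in_multiples:
  fixes N p :: nat and n k :: int
  assumes p: "prime p" and N: "N > 0" and n: "n \<noteq> 0" and lt: "multiplicity p (nat \<bar>n\<bar>) < multiplicity p N"
    and d: "int N dvd int p * k"
  shows "\<exists>a. int N dvd k - n * a"
proof -
  define g where "g = gcd N (nat \<bar>n\<bar>)"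
  have "multiplicity p (N div g) = multiplicity p N - multiplicity p (nat \<bar>n\<bar>)"
    unfolding g_def using p N n by (intro multiplicity_div_gcd_nat) auto
  then have "multiplicity p (N div g) \<noteq> 0" using lt by simp
  then have "p dvd N div g" by (rule contrapos_np) (rule not_dvd_imp_multiplicity_0)
  then have "p * g dvd (N div g) * g" by (rule mult_dvd_mono) simp
  also have "(N div g) * g = N" unfolding g_def by (rule dvd_div_mult_self[OF gcd_dvd1])
  finally have "int p * int g dvd int N" by (metis int_dvd_int_iff of_nat_mult)
  then have "int p * int g dvd int p * k" using d dvd_trans by blast
  then have "int g dvd k" using p by (simp add: prime_gt_0_nat)
  moreover have "int g = gcd (int N) n" by (simp add: g_def)
  ultimately obtain c where c: "k = gcd (int N) n * c" by (metis dvdE)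
  obtain u v where uv: "u * int N + v * n = gcd (int N) n" using bezout_int by blast
  have "k - n * (v * c) = int N * (u * c)" unfolding c uv[symmetric] by (simp add: algebra_simps)
  then have "int N dvd k - n * (v * c)" by simp
  then show ?thesis by blast
qed

context orbit_system
begin

definition torsion_rel :: "nat \<Rightarrow> 'x \<Rightarrow> 'x \<Rightarrow> bool" where
  "torsion_rel p x y \<longleftrightarrow> (\<exists>k. y = B k x \<and> B (int p * k) x = x)"

lemma torsion_rel_step:
  assumes T: "single_valued T" "\<And>x y k. (x, y) \<in> T \<Longrightarrow> (B (n * k) x, B (m * k) y) \<in> T"
    and p: "prime p" and lt: "multiplicity p (nat \<bar>n\<bar>) < multiplicity p (sz x)" and pos: "sz x > 0"
    and xy: "(x, x') \<in> T" "(y, y') \<in> T" and r: "torsion_rel p x y"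
  shows "torsion_rel p x' y'"
proof -
  obtain k where k: "y = B k x" "B (int p * k) x = x" using r by (auto simp: torsion_rel_def)
  then have d: "int (sz x) dvd int p * k" by (simp add: B_fix)
  obtain a where a: "int (sz x) dvd k - n * a" using residue_in_multiples[OF p pos n0 lt d] by blast
  then have "y = B (n * a) x" using k(1) by (simp add: B_eq)
  then have "(y, B (m * a) x') \<in> T" using T(2)[OF xy(1)] by simp
  then have y': "y' = B (m * a) x'" using T(1) xy(2) by (meson single_valuedD)
  have "int (sz x) dvd int p * k - int p * (k - n * a)" using dvd_diff[OF d dvd_mult[OF a]] .
  moreover have "int p * k - int p * (k - n * a) = n * (int p * a)" by (simp add: algebra_simps)
  ultimately have "B (n * (int p * a)) x = x" by (simp add: B_fix)
  then have "(x, B (m * (int p * a)) x') \<in> T" using T(2)[OF xy(1), of "int p * a"] by simp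
  then have "B (m * (int p * a)) x' = x'" using T(1) xy(1) by (meson single_valuedD)
  moreover have "m * (int p * a) = int p * (m * a)" by simp
  ultimately show ?thesis unfolding torsion_rel_def using y' by metis
qed

end

lemma not_primitive_finite_phenotype:
  assumes mn: "2 \<le> \<bar>m\<bar>" "2 \<le> \<bar>n\<bar>" and L: "subgroup \<Lambda> (BS m n)" "PH m n \<Lambda> = q" and q: "q \<noteq> 1" "q \<noteq> \<infinity>"
    and inf: "infinite (rcosets\<^bsub>BS m n\<^esub> \<Lambda>)"
  shows "\<not> primitive_action m n \<Lambda>"
proof -
  obtain B sz \<iota> where "coset_system B sz (orbit_sizes m n q) m n \<Lambda> \<iota>" using coset_universe[OF mn L] by blast
  then interpret coset_system B sz "orbit_sizes m n q" m n \<Lambda> \<iota> .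
  have szq: "sz x > 0" "Ph m n (enat (sz x)) = q" for x using sz_in[of x] q(2) by (auto simp: orbit_sizes_def)
  obtain p where p: "prime p" "multiplicity p (nat \<bar>m\<bar>) = multiplicity p (nat \<bar>n\<bar>)"
    "multiplicity p (sz (\<iota> [])) > multiplicity p (nat \<bar>n\<bar>)"
    using Ph_not_one[of m n "sz (\<iota> [])"] q(1) szq by auto
  have lt: "multiplicity p (nat \<bar>n\<bar>) < multiplicity p (sz x)" for x
  proof -
    let ?f = "\<lambda>N. \<Prod>p\<in>ph_primes m n N. p ^ multiplicity p N"
    have "Ph m n (enat (sz (\<iota> []))) = Ph m n (enat (sz x))" unfolding szq(2) ..
    then have e: "?f (sz (\<iota> [])) = ?f (sz x)" unfolding Ph_enat enat.inject .
    have "p \<in> ph_primes m n (sz (\<iota> []))" using p by (simp add: ph_primes_def)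
    then have "p ^ multiplicity p (sz (\<iota> [])) dvd ?f (sz (\<iota> []))" using finite_ph_primes[OF szq(1)] by (rule dvd_prodI[rotated])
    moreover have "p dvd p ^ multiplicity p (sz (\<iota> []))" using p(3) by (intro dvd_power) simp
    ultimately have "p dvd ?f (sz x)" using e dvd_trans by metis
    then obtain p' where p': "p' \<in> ph_primes m n (sz x)" "p dvd p' ^ multiplicity p' (sz x)"
      unfolding prime_dvd_prod_iff[OF finite_ph_primes[OF szq(1)] p(1)] by blast
    have "prime p'" using p'(1) by (simp add: ph_primes_def)
    then have "p = p'" using p'(2) p(1) by (meson prime_dvd_power primes_dvd_imp_eq)
    then show ?thesis using p'(1) by (simp add: ph_primes_def)
  qed
  have dual_lt: "multiplicity p (nat \<bar>m\<bar>) < multiplicity p (sz x)" for x using lt p(2) by simp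
  define N where "N = sz (\<iota> [])"
  have "multiplicity p N \<noteq> 0" using p(3) by (simp add: N_def)
  then have "p dvd N" by (rule contrapos_np) (rule not_dvd_imp_multiplicity_0)
  then obtain N' where N': "N = p * N'" by (rule dvdE)
  have N0: "N > 0" using szq(1) by (simp add: N_def)
  have "\<not> int N dvd int N'"
  proof
    assume "int N dvd int N'"
    then have "N \<le> N'" using N' N0 by (intro dvd_imp_le) auto
    then show False using N' N0 prime_gt_1_nat[OF p(1)] by simp
  qed
  then have NN: "B (int N') (\<iota> []) \<noteq> \<iota> []" by (simp add: B_fix N_def)
  show ?thesis
  proof (rule not_primitive[of "torsion_rel p"])
    show "torsion_rel p x x" for x unfolding torsion_rel_def by (intro exI[of _ 0]) (simp add: B_zero)
    show "torsion_rel p y x" if r: "torsion_rel p x y" for x y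
    proof -
      obtain k where k: "y = B k x" "B (int p * k) x = x" using r by (auto simp: torsion_rel_def)
      have "x = B (- k) y" by (simp add: k(1) B_B B_zero)
      moreover have "B (int p * (- k)) y = y" using k(2) by (simp add: k(1) B_B B_eq B_fix)
      ultimately show ?thesis unfolding torsion_rel_def by blast
    qed
    show "torsion_rel p x z" if r: "torsion_rel p x y" "torsion_rel p y z" for x y z
    proof -
      obtain k where k: "y = B k x" "B (int p * k) x = x" using r by (auto simp: torsion_rel_def)
      obtain l where l: "z = B l y" "B (int p * l) y = y" using r by (auto simp: torsion_rel_def)
      have "z = B (l + k) x" by (simp add: l(1) k(1) B_B)
      moreover have "int (sz x) dvd int p * k" "int (sz x) dvd int p * l" using k l by (simp_all add: B_fix)
      then have "B (int p * (l + k)) x = x" by (simp add: B_fix distrib_left)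
      ultimately show ?thesis unfolding torsion_rel_def by blast
    qed
    show "torsion_rel p (B j x) (B j y)" if r: "torsion_rel p x y" for x y j
    proof -
      obtain k where k: "y = B k x" "B (int p * k) x = x" using r by (auto simp: torsion_rel_def)
      have "B j y = B k (B j x)" by (simp add: k(1) B_B add.commute)
      moreover have "B (int p * k) (B j x) = B j x" using k(2) by (simp add: B_fix)
      ultimately show ?thesis unfolding torsion_rel_def by blast
    qed
    show "torsion_rel p x' y'" if "(x, x') \<in> G" "(y, y') \<in> G" "torsion_rel p x y" for x x' y y'
      using torsion_rel_step[OF G_single(1) G_eqv p(1) lt szq(1) that] .
    show "torsion_rel p x y" if xy: "(x, x') \<in> G" "(y, y') \<in> G" "torsion_rel p x' y'" for x x' y y'
    proof -
      have e: "(B (m * k) x, B (n * k) y) \<in> G\<inverse>" if "(x, y) \<in> G\<inverse>" for x y k using G_eqv that by simp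
      have "(x', x) \<in> G\<inverse>" "(y', y) \<in> G\<inverse>" using xy by simp_all
      from orbit_system.torsion_rel_step[OF dual G_single(2) e p(1) dual_lt szq(1) this xy(3)] show ?thesis .
    qed
    from NN show "\<iota> [] \<noteq> \<iota> (bpow (int N'))" using iota_B[of "int N'" "[]"] by simp
    have "B (int p * int N') (\<iota> []) = \<iota> []" unfolding B_fix using N' by (simp add: N_def[symmetric])
    then show "torsion_rel p (\<iota> []) (\<iota> (bpow (int N')))" unfolding torsion_rel_def using iota_B[of "int N'" "[]"] by (metis append_Nil)
    have "\<exists>v. \<not> torsion_rel p (\<iota> []) (\<iota> v)"
    proof (rule ccontr)
      assume "\<not> ?thesis"
      then have "\<iota> v \<in> orb (\<iota> [])" for v unfolding torsion_rel_def orb_iff by blast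
      then have "finite (range \<iota>)" using finite_orb[OF szq(1)] finite_subset by (metis image_subsetI)
      then show False using inf finite_rcosets by blast
    qed
    then show "\<not> torsion_rel p (\<iota> []) (\<iota> (SOME v. \<not> torsion_rel p (\<iota> []) (\<iota> v)))" by (rule someI_ex)
  qed
qed

lemma not_primitive_infinite_phenotype:
  assumes mn: "2 \<le> \<bar>m\<bar>" "2 \<le> \<bar>n\<bar>" and L: "subgroup \<Lambda> (BS m n)" "PH m n \<Lambda> = \<infinity>" and e: "\<bar>m\<bar> = \<bar>n\<bar>"
  shows "\<not> primitive_action m n \<Lambda>"
proof -
  obtain B sz \<iota> where "coset_system B sz (orbit_sizes m n \<infinity>) m n \<Lambda> \<iota>" using coset_universe[OF mn L] by blast
  then interpret coset_system B sz "orbit_sizes m n \<infinity>" m n \<Lambda> \<iota> .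
  have z: "sz x = 0" for x using sz_in[of x] by (simp add: orbit_sizes_def)
  have inj: "B j x = B k x \<longleftrightarrow> j = k" for j k x by (simp add: B_eq z)
  obtain c where c: "m = n * c" "n = m * c" using e by (metis abs_eq_iff mult.right_neutral mult_minus_right minus_minus mult_1_right)
  define r where "r = (\<lambda>x y. \<exists>k. y = B (n * k) x)"
  show ?thesis
  proof (rule not_primitive[of r])
    show "r x x" for x unfolding r_def by (intro exI[of _ 0]) (simp add: B_zero)
    show "r y x" if rr: "r x y" for x y
    proof -
      obtain k where "y = B (n * k) x" using rr by (auto simp: r_def)
      then have "x = B (n * (- k)) y" by (simp add: B_B B_zero)
      then show ?thesis unfolding r_def by blast
    qed
    show "r x z" if rr: "r x y" "r y z" for x y z
    proof -
      obtain k l where "y = B (n * k) x" "z = B (n * l) y" using rr by (auto simp: r_def)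
      then have "z = B (n * (l + k)) x" by (simp add: B_B algebra_simps)
      then show ?thesis unfolding r_def by blast
    qed
    show "r (B j x) (B j y)" if rr: "r x y" for x y j
    proof -
      obtain k where "y = B (n * k) x" using rr by (auto simp: r_def)
      then have "B j y = B (n * k) (B j x)" by (simp add: B_B add.commute)
      then show ?thesis unfolding r_def by blast
    qed
    show "r x' y'" if xy: "(x, x') \<in> G" "(y, y') \<in> G" "r x y" for x x' y y'
    proof -
      obtain k where k: "y = B (n * k) x" using xy(3) by (auto simp: r_def)
      have "(y, B (m * k) x') \<in> G" using G_eqv[OF xy(1), of k] k by simp
      then have "y' = B (m * k) x'" using xy(2) G_single(1) by (meson single_valuedD)
      then have "y' = B (n * (c * k)) x'" using c(1) by (metis mult.assoc)
      then show ?thesis unfolding r_def by blast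
    qed
    show "r x y" if xy: "(x, x') \<in> G" "(y, y') \<in> G" "r x' y'" for x x' y y'
    proof -
      obtain k where k: "y' = B (n * k) x'" using xy(3) by (auto simp: r_def)
      then have "y' = B (m * (c * k)) x'" using c(2) by (metis mult.assoc)
      then have "(B (n * (c * k)) x, y') \<in> G" using G_eqv[OF xy(1), of "c * k"] by simp
      then have "y = B (n * (c * k)) x" using xy(2) G_single(2) by (meson converse_iff single_valuedD)
      then show ?thesis unfolding r_def by blast
    qed
    show "r (\<iota> []) (\<iota> (bpow n))" unfolding r_def using iota_B[of n "[]"] by (intro exI[of _ 1]) simp
    show "\<iota> [] \<noteq> \<iota> (bpow n)" using iota_B[of n "[]"] inj[of n "\<iota> []" 0] n0 by (simp add: B_zero)
    show "\<not> r (\<iota> []) (\<iota> (bpow 1))"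
    proof
      assume "r (\<iota> []) (\<iota> (bpow 1))"
      then obtain k where "B 1 (\<iota> []) = B (n * k) (\<iota> [])" using iota_B[of 1 "[]"] by (auto simp: r_def)
      then have "1 = n * k" using inj by blast
      then have "n dvd 1" by (rule dvdI)
      then show False using n_not_dvd_1 by blast
    qed
  qed
qed

lemma highly_transitive_primitive:
  assumes ht: "highly_transitive m n \<Lambda>" shows "primitive_action m n \<Lambda>"
  unfolding primitive_action_def
proof (intro allI impI)
  let ?Y = "rcosets\<^bsub>BS m n\<^esub> \<Lambda>"
  fix R assume R: "equiv ?Y R \<and> (\<forall>x y \<gamma>. (x, y) \<in> R \<and> \<gamma> \<in> carrier (BS m n) \<longrightarrow> (x #>\<^bsub>BS m n\<^esub> \<gamma>, y #>\<^bsub>BS m n\<^esub> \<gamma>) \<in> R)"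
  have sub: "R \<subseteq> ?Y \<times> ?Y" using R equiv_type by blast
  have rf: "(x, x) \<in> R" if "x \<in> ?Y" for x using R that by (meson equiv_class_self equivE refl_onD)
  show "R = Id_on ?Y \<or> R = ?Y \<times> ?Y"
  proof (rule ccontr)
    assume A: "\<not> ?thesis"
    have "Id_on ?Y \<subseteq> R" using rf by blast
    then obtain x y where xy: "(x, y) \<in> R" "x \<noteq> y" using A sub by blast
    obtain u v where uv: "u \<in> ?Y" "v \<in> ?Y" "(u, v) \<notin> R" using A sub by blast
    have "u \<noteq> v" using uv rf by blast
    then have "length [x, y] = length [u, v] \<and> distinct [x, y] \<and> distinct [u, v] \<and> set [x, y] \<subseteq> ?Y \<and> set [u, v] \<subseteq> ?Y"
      using xy uv sub by auto
    then obtain \<gamma> where g: "\<gamma> \<in> carrier (BS m n)" "\<forall>i<length [x, y]. [x, y] ! i #>\<^bsub>BS m n\<^esub> \<gamma> = [u, v] ! i"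
      using ht unfolding highly_transitive_def by blast
    have "x #>\<^bsub>BS m n\<^esub> \<gamma> = u" "y #>\<^bsub>BS m n\<^esub> \<gamma> = v" using g(2)[rule_format, of 0] g(2)[rule_format, of 1] by simp_all
    then show False using R xy(1) g(1) uv(3) by blast
  qed
qed

theorem theoremA:
  fixes m n :: int and q :: enat
  assumes "\<bar>m\<bar> \<ge> 2" and "\<bar>n\<bar> \<ge> 2" and "q \<in> phenotypes m n"
  shows "(dense_gdelta_in (subtopology (Sub_top m n) (Kq m n q)) (HTq m n q)
            \<longleftrightarrow> (q = 1 \<or> (q = \<infinity> \<and> \<bar>m\<bar> \<noteq> \<bar>n\<bar>)))
       \<and> (\<not> (q = 1 \<or> (q = \<infinity> \<and> \<bar>m\<bar> \<noteq> \<bar>n\<bar>)) \<longrightarrow>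
            HTq m n q = {} \<and>
            (\<forall>\<Lambda>. subgroup \<Lambda> (BS m n) \<and> infinite (rcosets\<^bsub>BS m n\<^esub> \<Lambda>) \<and> PH m n \<Lambda> = q
                  \<longrightarrow> \<not> primitive_action m n \<Lambda>))"
proof -
  let ?good = "q = 1 \<or> (q = \<infinity> \<and> \<bar>m\<bar> \<noteq> \<bar>n\<bar>)"
  let ?Y = "subtopology (Sub_top m n) (Kq m n q)"
  have top: "topspace ?Y = Kq m n q" using Kq_SubG[of m n q] by (auto simp: topspace_Sub_top)
  have bad: "\<not> primitive_action m n \<Lambda>"
    if "\<not> ?good" "subgroup \<Lambda> (BS m n)" "infinite (rcosets\<^bsub>BS m n\<^esub> \<Lambda>)" "PH m n \<Lambda> = q" for \<Lambda>
  proof (cases "q = \<infinity>")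
    case True
    then show ?thesis using not_primitive_infinite_phenotype[OF assms(1,2) that(2)] that(1,4) by simp
  next
    case False
    then show ?thesis using not_primitive_finite_phenotype[OF assms(1,2) that(2,4)] that(1,3) by blast
  qed
  have empty: "HTq m n q = {}" if b: "\<not> ?good"
  proof (rule ccontr)
    assume "HTq m n q \<noteq> {}"
    then obtain \<Lambda> where L: "\<Lambda> \<in> Kq m n q" "highly_transitive m n \<Lambda>" by (auto simp: HTq_def)
    have "subgroup \<Lambda> (BS m n)" "PH m n \<Lambda> = q" using L(1) Kq_SubG by (auto simp: SubG_def Kq_def)
    moreover have "infinite (rcosets\<^bsub>BS m n\<^esub> \<Lambda>)" using L(2) unfolding highly_transitive_def by blast
    ultimately show False using bad[OF b] highly_transitive_primitive[OF L(2)] by blast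
  qed
  have "dense_gdelta_in ?Y (HTq m n q) \<longleftrightarrow> ?good"
  proof
    assume g: ?good
    show "dense_gdelta_in ?Y (HTq m n q)"
      unfolding dense_gdelta_in_def top using gdelta_HTq HTq_dense[OF assms(1,2) g] by blast
  next
    assume d: "dense_gdelta_in ?Y (HTq m n q)"
    show ?good
    proof (rule ccontr)
      assume "\<not> ?good"
      then have "Kq m n q = {}" using d empty unfolding dense_gdelta_in_def top by simp
      then show False using inf_subgroups_nonempty[OF assms] inf_subgroups_subset_Kq[OF assms(1,2)] by blast
    qed
  qed
  then show ?thesis using empty bad by blast
qed

end
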